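(* Let $k$ be a positive integer and let $\Lambda$ be a left and right noetherian ring which is quasi $k$-Gorenstein. Then for any $0\leq d\leq k-1$, each module $M$ in $\Omega^d(\mathrm{mod}\,\Lambda)$ has an Evans-Griffith representation; that is, there is an exact sequence in $\mathrm{mod}\,\Lambda$ $$0\to S\to B\to M\to 0$$ where $B$ is a $d$th syzygy of $\mathrm{Ext}_\Lambda^{d+1}(D(M),\Lambda)$ and $S\in\Omega^{d+2}(\mathrm{mod}\,\Lambda)$.
   Context: $\mathrm{mod}\,\Lambda$ (resp. $\mathrm{mod}\,\Lambda^{op}$) is the category of finitely generated left (resp. right) $\Lambda$-modules. $(-)^*=\mathrm{Hom}_\Lambda(-,\Lambda)$, interchanging left and right modules; likewise $\mathrm{Ext}^i_\Lambda(-,\Lambda)$ interchanges $\mathrm{mod}\,\Lambda$ and $\mathrm{mod}\,\Lambda^{op}$. For a finitely generated (left or right) module $X$ and an integer $i\ge 0$, $\mathrm{grade}\,X\geq i$ means $\mathrm{Ext}_\Lambda^j(X,\Lambda)=0$ for all $0\leq j<i$. $\Lambda$ is quasi $k$-Gorenstein if $\mathrm{grade}\,\mathrm{Ext}^i_\Lambda(N,\Lambda)\geq i$ for every $N\in \mathrm{mod}\,\Lambda^{op}$ and every $1\leq i\leq k$. $\Omega^d(\mathrm{mod}\,\Lambda)$ is the full subcategory of $\mathrm{mod}\,\Lambda$ of $d$th syzygy modules, i.e. modules $M$ admitting an exact sequence $0\to M\to P_{d-1}\to\cdots\to P_0$ with all $P_i$ finitely generated projective; $\Omega^0(\mathrm{mod}\,\Lambda)=\mathrm{mod}\,\Lambda$.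 For a finitely generated module $X$, a $d$th syzygy of $X$ is a module $B$ fitting in an exact sequence $0\to B\to P_{d-1}\to\cdots\to P_0\to X\to 0$ with all $P_i$ finitely generated projective (for $d=0$ this means $B\cong X$). For $M\in\mathrm{mod}\,\Lambda$, choose a presentation $P_1\to P_0\to M\to 0$ with $P_0,P_1$ finitely generated projective and set $D(M)=\mathrm{Coker}(P_0^*\to P_1^* )\in\mathrm{mod}\,\Lambda^{op}$. Up to isomorphism, the modules $\mathrm{Ext}^i_\Lambda(D(M),\Lambda)$, $i\geq 1$, do not depend on the choice of presentation.
   Formalization: For d = 0, "B is a 0th syzygy of X" is read as B ≅ X ⊕ Q with Q finitely generated projective, instead of B ≅ X; with B ≅ X the claim fails for Λ a field, k = 1, M = Λ, since then Ext^1(D(M),Λ) = 0. *)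

theory Defs
  imports "HOL-Algebra.AbelCoset" "HOL-Algebra.Module"
begin

text \<open>
  The library locale \<open>module\<close> asks for a commutative ring of scalars, so unital left modules over
  a possibly noncommutative ring are introduced here, on the library's record \<open>module\<close>
  (whose fields \<open>mult\<close> and \<open>one\<close> are not used).  Right modules over \<open>R\<close> are left modules
  over the opposite ring \<open>opp_ring R\<close>; note that \<open>opp_ring (opp_ring R) = R\<close>.
\<close>

definition opp_ring :: "'a ring \<Rightarrow> 'a ring" where
  "opp_ring R = R\<lparr>mult := \<lambda>x y. y \<otimes>\<^bsub>R\<^esub> x\<rparr>"

locale left_module = R?: ring R + M?: abelian_group M
  for R :: "'a ring" (structure) and M :: "('a, 'b) module" (structure) +
  assumes smult_closed:
      "\<lbrakk>a \<in> carrier R; x \<in> carrier M\<rbrakk> \<Longrightarrow> a \<odot>\<^bsub>M\<^esub> x \<in> carrier M"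
    and smult_l_distr:
      "\<lbrakk>a \<in> carrier R; b \<in> carrier R; x \<in> carrier M\<rbrakk> \<Longrightarrow>
        (a \<oplus>\<^bsub>R\<^esub> b) \<odot>\<^bsub>M\<^esub> x = a \<odot>\<^bsub>M\<^esub> x \<oplus>\<^bsub>M\<^esub> b \<odot>\<^bsub>M\<^esub> x"
    and smult_r_distr:
      "\<lbrakk>a \<in> carrier R; x \<in> carrier M; y \<in> carrier M\<rbrakk> \<Longrightarrow>
        a \<odot>\<^bsub>M\<^esub> (x \<oplus>\<^bsub>M\<^esub> y) = a \<odot>\<^bsub>M\<^esub> x \<oplus>\<^bsub>M\<^esub> a \<odot>\<^bsub>M\<^esub> y"
    and smult_assoc:
      "\<lbrakk>a \<in> carrier R; b \<in> carrier R; x \<in> carrier M\<rbrakk> \<Longrightarrow>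
        (a \<otimes>\<^bsub>R\<^esub> b) \<odot>\<^bsub>M\<^esub> x = a \<odot>\<^bsub>M\<^esub> (b \<odot>\<^bsub>M\<^esub> x)"
    and smult_one:
      "x \<in> carrier M \<Longrightarrow> \<one>\<^bsub>R\<^esub> \<odot>\<^bsub>M\<^esub> x = x"

definition regular_module :: "'a ring \<Rightarrow> ('a, 'a) module" where
  "regular_module R = \<lparr>carrier = carrier R, mult = (\<otimes>\<^bsub>R\<^esub>), one = \<one>\<^bsub>R\<^esub>,
     zero = \<zero>\<^bsub>R\<^esub>, add = (\<oplus>\<^bsub>R\<^esub>), smult = (\<otimes>\<^bsub>R\<^esub>)\<rparr>"

definition mod_hom :: "'a ring \<Rightarrow> ('a, 'b) module \<Rightarrow> ('a, 'c) module \<Rightarrow> ('b \<Rightarrow> 'c) set" where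
  "mod_hom R M N = {f \<in> hom (add_monoid M) (add_monoid N).
     \<forall>a\<in>carrier R. \<forall>x\<in>carrier M. f (a \<odot>\<^bsub>M\<^esub> x) = a \<odot>\<^bsub>N\<^esub> f x}"

definition quot_module :: "('a, 'b) module \<Rightarrow> 'b set \<Rightarrow> ('a, 'b set) module" where
  "quot_module M N = \<lparr>carrier = a_rcosets\<^bsub>M\<^esub> N, mult = undefined, one = undefined,
     zero = N, add = set_add M,
     smult = \<lambda>a X. N <+>\<^bsub>M\<^esub> ((\<lambda>x. a \<odot>\<^bsub>M\<^esub> x) ` X)\<rparr>"

definition fg_module :: "'a ring \<Rightarrow> ('a, 'b) module \<Rightarrow> bool" where
  "fg_module R M \<longleftrightarrow> left_module R M \<and>
     (\<exists>A. finite A \<and> A \<subseteq> carrier M \<and> \<Inter>{N. submodule N R M \<and> A \<subseteq> N} = carrier M)"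

definition left_noetherian :: "'a ring \<Rightarrow> bool" where
  "left_noetherian R \<longleftrightarrow>
     (\<forall>I. submodule I R (regular_module R) \<longrightarrow> fg_module R ((regular_module R)\<lparr>carrier := I\<rparr>))"

definition right_noetherian :: "'a ring \<Rightarrow> bool" where
  "right_noetherian R \<longleftrightarrow> left_noetherian (opp_ring R)"

text \<open>
  HOL cannot quantify over types inside a formula, so bound modules get their elements from
  the type \<open>'a univ\<close>.  No generality is lost: a finitely generated module is isomorphic to a
  quotient of some \<open>R\<^sup>n\<close>, and the elements of such a quotient are cosets, i.e.
  sets of sequences \<open>nat \<Rightarrow> 'a\<close> (vanishing from \<open>n\<close> on).
\<close>

type_synonym 'a univ = "(nat \<Rightarrow> 'a) set"

text \<open>
  Testing the lifting property on modules over \<open>'a univ\<close> suffices for a finitely generated \<open>P\<close>: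
  a surjection from some \<open>R\<^sup>n\<close> onto \<open>P\<close> has an isomorphic copy there, so it splits.
\<close>

definition fg_projective :: "'a ring \<Rightarrow> ('a, 'b) module \<Rightarrow> bool" where
  "fg_projective R P \<longleftrightarrow> fg_module R P \<and>
     (\<forall>(X :: ('a, 'a univ) module) (Y :: ('a, 'a univ) module) g h.
        left_module R X \<and> left_module R Y \<and> g \<in> mod_hom R X Y \<and> g ` carrier X = carrier Y \<and>
        h \<in> mod_hom R P Y \<longrightarrow>
        (\<exists>h' \<in> mod_hom R P X. \<forall>x\<in>carrier P. g (h' x) = h x))"

text \<open>
  The dual \<open>Hom\<^sub>R(M, R)\<close> of a left \<open>R\<close>-module is a right \<open>R\<close>-module by \<open>(f a) x = (f x) a\<close>, that is,
  a left module over \<open>opp_ring R\<close>.  Its elements are normalised to \<open>undefined\<close> outside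
  \<open>carrier M\<close>, so that equality of homomorphisms is equality of HOL functions.
\<close>

definition dual :: "'a ring \<Rightarrow> ('a, 'b) module \<Rightarrow> ('a, 'b \<Rightarrow> 'a) module" where
  "dual R M = \<lparr>carrier = mod_hom R M (regular_module R) \<inter> extensional (carrier M),
     mult = undefined, one = undefined,
     zero = (\<lambda>x\<in>carrier M. \<zero>\<^bsub>R\<^esub>),
     add = (\<lambda>f g. \<lambda>x\<in>carrier M. f x \<oplus>\<^bsub>R\<^esub> g x),
     smult = (\<lambda>a f. \<lambda>x\<in>carrier M. f x \<otimes>\<^bsub>R\<^esub> a)\<rparr>"

text \<open>For \<open>f : M \<rightarrow> N\<close>, the map \<open>dual_map M f : N\<^sup>* \<rightarrow> M\<^sup>*\<close>.\<close>

definition dual_map :: "('a, 'b) module \<Rightarrow> ('b \<Rightarrow> 'c) \<Rightarrow> ('c \<Rightarrow> 'a) \<Rightarrow> 'b \<Rightarrow> 'a" where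
  "dual_map M f = (\<lambda>g. compose (carrier M) g f)"

text \<open>\<open>\<dots> \<rightarrow> P 2 \<rightarrow> P 1 \<rightarrow> P 0 \<rightarrow> X \<rightarrow> 0\<close> with \<open>\<delta> i : P (i + 1) \<rightarrow> P i\<close> and \<open>\<epsilon> : P 0 \<rightarrow> X\<close>.\<close>

definition proj_resolution ::
  "'a ring \<Rightarrow> ('a, 'b) module \<Rightarrow> (nat \<Rightarrow> ('a, 'c) module) \<Rightarrow> (nat \<Rightarrow> 'c \<Rightarrow> 'c) \<Rightarrow> ('c \<Rightarrow> 'b) \<Rightarrow> bool"
where
  "proj_resolution R X P \<delta> \<epsilon> \<longleftrightarrow>
     (\<forall>i. fg_projective R (P i)) \<and>
     (\<forall>i. \<delta> i \<in> mod_hom R (P (Suc i)) (P i)) \<and>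
     (\<forall>i. \<delta> (Suc i) ` carrier (P (Suc (Suc i))) = a_kernel (P (Suc i)) (P i) (\<delta> i)) \<and>
     \<epsilon> \<in> mod_hom R (P 0) X \<and> \<epsilon> ` carrier (P 0) = carrier X \<and>
     \<delta> 0 ` carrier (P 1) = a_kernel (P 0) X \<epsilon>"

definition dual_cohomology ::
  "'a ring \<Rightarrow> (nat \<Rightarrow> ('a, 'c) module) \<Rightarrow> (nat \<Rightarrow> 'c \<Rightarrow> 'c) \<Rightarrow> nat \<Rightarrow> ('a, ('c \<Rightarrow> 'a) set) module"
where
  "dual_cohomology R P \<delta> i =
     quot_module
       ((dual R (P i))\<lparr>carrier :=
          a_kernel (dual R (P i)) (dual R (P (Suc i))) (dual_map (P (Suc i)) (\<delta> i))\<rparr>)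
       (case i of
          0 \<Rightarrow> {\<zero>\<^bsub>dual R (P 0)\<^esub>}
        | Suc j \<Rightarrow> dual_map (P (Suc j)) (\<delta> j) ` carrier (dual R (P j)))"

text \<open>
  \<open>Ext_ring R i X\<close> is \<open>Ext\<^sup>i\<^sub>R(X, R)\<close>, a left module over \<open>opp_ring R\<close>, computed from a chosen
  resolution of \<open>X\<close> by finitely generated projectives.  It is meaningful for finitely generated
  modules over a left noetherian ring, which have such a resolution.
\<close>

definition Ext_ring :: "'a ring \<Rightarrow> nat \<Rightarrow> ('a, 'b) module \<Rightarrow> ('a, ('a univ \<Rightarrow> 'a) set) module" where
  "Ext_ring R i X =
     (let (P, \<delta>) = (SOME (P, \<delta>). \<exists>\<epsilon>. proj_resolution R X P \<delta> \<epsilon>)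
      in dual_cohomology R P \<delta> i)"

definition grade_ge :: "'a ring \<Rightarrow> ('a, 'b) module \<Rightarrow> nat \<Rightarrow> bool" where
  "grade_ge R X i \<longleftrightarrow> (\<forall>j<i. carrier (Ext_ring R j X) = {\<zero>\<^bsub>Ext_ring R j X\<^esub>})"

definition quasi_gorenstein :: "nat \<Rightarrow> 'a ring \<Rightarrow> bool" where
  "quasi_gorenstein k R \<longleftrightarrow>
     (\<forall>N :: ('a, 'a univ) module. fg_module (opp_ring R) N \<longrightarrow>
        (\<forall>i. 1 \<le> i \<and> i \<le> k \<longrightarrow> grade_ge R (Ext_ring (opp_ring R) i N) i))"

text \<open>
  Exactness of \<open>0 \<rightarrow> M \<rightarrow> P (d - 1) \<rightarrow> \<dots> \<rightarrow> P 0\<close>, where \<open>\<delta> i : P (i + 1) \<rightarrow> P i\<close> and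
  \<open>\<iota> : M \<rightarrow> P (d - 1)\<close>; nothing is required at \<open>P 0\<close> when \<open>d > 0\<close>, and nothing at all when \<open>d = 0\<close>.
\<close>

definition exact_proj_seq ::
  "'a ring \<Rightarrow> nat \<Rightarrow> ('a, 'b) module \<Rightarrow> ('b \<Rightarrow> 'c) \<Rightarrow>
   (nat \<Rightarrow> ('a, 'c) module) \<Rightarrow> (nat \<Rightarrow> 'c \<Rightarrow> 'c) \<Rightarrow> bool"
where
  "exact_proj_seq R d M \<iota> P \<delta> \<longleftrightarrow>
     (\<forall>i<d. fg_projective R (P i)) \<and>
     (\<forall>i. Suc i < d \<longrightarrow> \<delta> i \<in> mod_hom R (P (Suc i)) (P i)) \<and>
     (\<forall>i. Suc (Suc i) < d \<longrightarrow>
        \<delta> (Suc i) ` carrier (P (Suc (Suc i))) = a_kernel (P (Suc i)) (P i) (\<delta> i)) \<and>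
     (0 < d \<longrightarrow> \<iota> \<in> mod_hom R M (P (d - 1)) \<and> inj_on \<iota> (carrier M)) \<and>
     (1 < d \<longrightarrow> \<iota> ` carrier M = a_kernel (P (d - 1)) (P (d - 2)) (\<delta> (d - 2)))"

definition in_Omega :: "'a ring \<Rightarrow> nat \<Rightarrow> ('a, 'b) module \<Rightarrow> bool" where
  "in_Omega R d M \<longleftrightarrow> fg_module R M \<and>
     (\<exists>\<iota> (P :: nat \<Rightarrow> ('a, 'a univ) module) \<delta>. exact_proj_seq R d M \<iota> P \<delta>)"

text \<open>
  For \<open>d > 0\<close> a \<open>d\<close>th syzygy is a module \<open>B\<close> in an exact sequence
  \<open>0 \<rightarrow> B \<rightarrow> P (d - 1) \<rightarrow> \<dots> \<rightarrow> P 0 \<rightarrow> X \<rightarrow> 0\<close>; these are closed under adding finitely generated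
  projective summands.  For \<open>d = 0\<close> the same freedom is made explicit: \<open>B \<cong> X \<oplus> Q\<close> with \<open>Q\<close>
  finitely generated projective.  Under the narrower convention \<open>B \<cong> X\<close>, the regular module \<open>R\<close>
  of a nonzero ring would have no representation \<open>0 \<rightarrow> S \<rightarrow> B \<rightarrow> R \<rightarrow> 0\<close> for \<open>d = 0\<close>: \<open>D(R)\<close> is
  projective, so \<open>Ext\<^sup>1(D(R), R) = 0\<close> and \<open>B = 0\<close>.
\<close>

definition is_syzygy :: "'a ring \<Rightarrow> nat \<Rightarrow> ('a, 'b) module \<Rightarrow> ('a, 'c) module \<Rightarrow> bool" where
  "is_syzygy R d X B \<longleftrightarrow> left_module R B \<and>
     (if d = 0 then \<exists>(Q :: ('a, 'a univ) module) \<phi> \<psi>.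
        fg_projective R Q \<and> \<phi> \<in> mod_hom R B X \<and> \<psi> \<in> mod_hom R B Q \<and>
        bij_betw (\<lambda>b. (\<phi> b, \<psi> b)) (carrier B) (carrier X \<times> carrier Q)
      else \<exists>\<iota> (P :: nat \<Rightarrow> ('a, 'a univ) module) \<delta> \<epsilon>.
        exact_proj_seq R d B \<iota> P \<delta> \<and>
        \<epsilon> \<in> mod_hom R (P 0) X \<and> \<epsilon> ` carrier (P 0) = carrier X \<and>
        (if d = 1 then \<iota> ` carrier B else \<delta> 0 ` carrier (P 1)) = a_kernel (P 0) X \<epsilon>)"

definition proj_presentation ::
  "'a ring \<Rightarrow> ('a, 'q) module \<Rightarrow> ('q \<Rightarrow> 'p) \<Rightarrow> ('a, 'p) module \<Rightarrow> ('p \<Rightarrow> 'b) \<Rightarrow> ('a, 'b) module \<Rightarrow> bool"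
where
  "proj_presentation R P1 f P0 \<epsilon> M \<longleftrightarrow>
     fg_projective R P1 \<and> fg_projective R P0 \<and>
     f \<in> mod_hom R P1 P0 \<and> \<epsilon> \<in> mod_hom R P0 M \<and>
     f ` carrier P1 = a_kernel P0 M \<epsilon> \<and> \<epsilon> ` carrier P0 = carrier M"

text \<open>\<open>D(M) = Coker(P0\<^sup>* \<rightarrow> P1\<^sup>*)\<close> for the presentation \<open>P1 \<rightarrow> P0 \<rightarrow> M \<rightarrow> 0\<close> with first map \<open>f\<close>.\<close>

definition transpose_module ::
  "'a ring \<Rightarrow> ('a, 'q) module \<Rightarrow> ('q \<Rightarrow> 'p) \<Rightarrow> ('a, 'p) module \<Rightarrow> ('a, ('q \<Rightarrow> 'a) set) module"
where
  "transpose_module R P1 f P0 =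
     quot_module (dual R P1) (dual_map P1 f ` carrier (dual R P0))"

definition short_exact ::
  "'a ring \<Rightarrow> ('a, 's) module \<Rightarrow> ('s \<Rightarrow> 'b) \<Rightarrow> ('a, 'b) module \<Rightarrow> ('b \<Rightarrow> 'm) \<Rightarrow> ('a, 'm) module \<Rightarrow> bool"
where
  "short_exact R S \<alpha> B \<beta> M \<longleftrightarrow>
     \<alpha> \<in> mod_hom R S B \<and> inj_on \<alpha> (carrier S) \<and>
     \<beta> \<in> mod_hom R B M \<and> \<beta> ` carrier B = carrier M \<and>
     \<alpha> ` carrier S = a_kernel B M \<beta>"

end

theory Submission
  imports Defs
begin

text \<open>
  Choose a projective resolution of \<open>D(M)\<close> that starts with \<open>P0\<^sup>* \<rightarrow> P1\<^sup>*\<close>.  Its dual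
  \<open>C 0 \<rightarrow> C 1 \<rightarrow> C 2 \<rightarrow> \<dots>\<close>, with differential \<open>c\<close>, starts with \<open>P1 \<rightarrow> P0\<close>, so \<open>M\<close> is the
  cokernel of \<open>c 0\<close>, and \<open>Ext\<^sup>i(D(M), \<Lambda>)\<close> is the cohomology \<open>H\<^sup>i(C)\<close> for \<open>i \<ge> 1\<close>.

  For \<open>M\<close> in \<open>\<Omega>\<^sup>d\<close> and \<open>1 \<le> n \<le> d\<close> one has \<open>H\<^sup>n(C) = 0\<close>, by induction on \<open>n\<close>.  A homomorphism
  from \<open>C (i + 1)\<close> to a projective that vanishes on the image of \<open>c i\<close> factors through
  \<open>c (i + 1)\<close>; hence \<open>C 1 \<rightarrow> M\<close> extends to a chain map from \<open>C\<close> to an exact sequence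
  \<open>0 \<rightarrow> M \<rightarrow> E 1 \<rightarrow> \<dots> \<rightarrow> E n\<close> with projective \<open>E i\<close>.  By the induction hypothesis a projective
  resolution \<open>G\<close> of \<open>X = H\<^sup>n(C)\<close> maps to \<open>C n \<leftarrow> C (n - 1) \<leftarrow> \<dots> \<leftarrow> C 1\<close>.  The composite with the
  chain map to \<open>E\<close> is null-homotopic, because \<open>X\<close> goes to zero in \<open>E n\<close>.  As
  \<open>Ext\<^sup>j(X, \<Lambda>) = 0\<close> for \<open>j < n - 1\<close>, the homotopy can be carried back from \<open>M\<close> to the start of \<open>G\<close>,
  where it shows that \<open>G 0 \<rightarrow> X\<close> is zero.

  Consequently \<open>M\<close> is a \<open>d\<close>th syzygy of the cokernel \<open>W\<close> of \<open>c d\<close>.  With \<open>X = H\<^sup>d\<^sup>+\<^sup>1(C)\<close> and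
  \<open>I\<close> the image of \<open>c (d + 1)\<close> there is an exact sequence \<open>0 \<rightarrow> X \<rightarrow> W \<rightarrow> I \<rightarrow> 0\<close>, which is
  rotated to \<open>0 \<rightarrow> \<Omega> I \<rightarrow> X \<oplus> C (d + 1) \<rightarrow> W \<rightarrow> 0\<close>.  The horseshoe lemma passes to
  \<open>d\<close>th syzygies, and the kernel \<open>\<Omega>\<^sup>d\<^sup>+\<^sup>1 I\<close> is in \<open>\<Omega>\<^sup>d\<^sup>+\<^sup>2\<close> since \<open>I\<close> is contained in \<open>C (d + 2)\<close>.
\<close>

section \<open>Left modules, submodules and homomorphisms\<close>

text \<open>In classical terms, the vanishing of \<open>H\<^sup>n(C)\<close> for
  \<open>1 \<le> n \<le> d\<close> says that M is d-torsionfree: \<open>H\<^sup>1\<close> and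
  \<open>H\<^sup>2\<close> are the kernel and cokernel of the canonical map from M to its double
  dual. A first syzygy is always 1-torsionfree, but over a general ring a second syzygy need not be
  reflexive; the grade condition closes this gap. The rotation at the end is forced by the direction
  of the arrows: X is a submodule of W, whereas B has to map onto W. Adding \<open>C (d + 1)\<close>
  repairs this, and for d = 0 it is the source of the projective summand in
  \<open>is_syzygy\<close>. Two points shape the formulation. Duals, cosets and pairs live in new
  types, while the definitions quantify over modules in \<open>'a univ\<close>; hence modules are
  copied there repeatedly, and projectivity is replaced by a form that mentions no test type. Right
  modules are left modules over \<open>opp_ring\<close>, so that each lemma serves both
  sides.\<close>

lemma left_moduleI:
  assumes "ring R"
    and "\<And>x y. \<lbrakk>x \<in> carrier M; y \<in> carrier M\<rbrakk> \<Longrightarrow> x \<oplus>\<^bsub>M\<^esub> y \<in> carrier M"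
    and "\<zero>\<^bsub>M\<^esub> \<in> carrier M"
    and "\<And>x y z. \<lbrakk>x \<in> carrier M; y \<in> carrier M; z \<in> carrier M\<rbrakk> \<Longrightarrow>
      (x \<oplus>\<^bsub>M\<^esub> y) \<oplus>\<^bsub>M\<^esub> z = x \<oplus>\<^bsub>M\<^esub> (y \<oplus>\<^bsub>M\<^esub> z)"
    and "\<And>x y. \<lbrakk>x \<in> carrier M; y \<in> carrier M\<rbrakk> \<Longrightarrow> x \<oplus>\<^bsub>M\<^esub> y = y \<oplus>\<^bsub>M\<^esub> x"
    and "\<And>x. x \<in> carrier M \<Longrightarrow> \<zero>\<^bsub>M\<^esub> \<oplus>\<^bsub>M\<^esub> x = x"
    and "\<And>x. x \<in> carrier M \<Longrightarrow> \<exists>y\<in>carrier M. y \<oplus>\<^bsub>M\<^esub> x = \<zero>\<^bsub>M\<^esub>"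
    and "\<And>a x. \<lbrakk>a \<in> carrier R; x \<in> carrier M\<rbrakk> \<Longrightarrow> a \<odot>\<^bsub>M\<^esub> x \<in> carrier M"
    and "\<And>a b x. \<lbrakk>a \<in> carrier R; b \<in> carrier R; x \<in> carrier M\<rbrakk> \<Longrightarrow>
        (a \<oplus>\<^bsub>R\<^esub> b) \<odot>\<^bsub>M\<^esub> x = a \<odot>\<^bsub>M\<^esub> x \<oplus>\<^bsub>M\<^esub> b \<odot>\<^bsub>M\<^esub> x"
    and "\<And>a x y. \<lbrakk>a \<in> carrier R; x \<in> carrier M; y \<in> carrier M\<rbrakk> \<Longrightarrow>
        a \<odot>\<^bsub>M\<^esub> (x \<oplus>\<^bsub>M\<^esub> y) = a \<odot>\<^bsub>M\<^esub> x \<oplus>\<^bsub>M\<^esub> a \<odot>\<^bsub>M\<^esub> y"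
    and "\<And>a b x. \<lbrakk>a \<in> carrier R; b \<in> carrier R; x \<in> carrier M\<rbrakk> \<Longrightarrow>
        (a \<otimes>\<^bsub>R\<^esub> b) \<odot>\<^bsub>M\<^esub> x = a \<odot>\<^bsub>M\<^esub> (b \<odot>\<^bsub>M\<^esub> x)"
    and "\<And>x. x \<in> carrier M \<Longrightarrow> \<one>\<^bsub>R\<^esub> \<odot>\<^bsub>M\<^esub> x = x"
  shows "left_module R M"
  by (intro left_module.intro left_module_axioms.intro assms abelian_groupI) auto

context left_module
begin

declare smult_closed [simp] smult_one [simp]

lemma smult_l_null [simp]:
  assumes "x \<in> carrier M"
  shows "\<zero>\<^bsub>R\<^esub> \<odot>\<^bsub>M\<^esub> x = \<zero>\<^bsub>M\<^esub>"
  using smult_l_distr[of "\<zero>\<^bsub>R\<^esub>" "\<zero>\<^bsub>R\<^esub>" x] assms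
  by simp

lemma smult_r_null [simp]:
  assumes "a \<in> carrier R"
  shows "a \<odot>\<^bsub>M\<^esub> \<zero>\<^bsub>M\<^esub> = \<zero>\<^bsub>M\<^esub>"
  using smult_r_distr[of a "\<zero>\<^bsub>M\<^esub>" "\<zero>\<^bsub>M\<^esub>"] assms
  by simp

lemma smult_r_minus:
  assumes "a \<in> carrier R" "x \<in> carrier M"
  shows "a \<odot>\<^bsub>M\<^esub> (\<ominus>\<^bsub>M\<^esub> x) = \<ominus>\<^bsub>M\<^esub> (a \<odot>\<^bsub>M\<^esub> x)"
  using smult_r_distr[of a "\<ominus>\<^bsub>M\<^esub> x" x] assms
  by (simp add: M.l_neg) (metis M.a_inv_closed M.minus_equality smult_closed)

lemma smult_l_minus:
  assumes "x \<in> carrier M"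
  shows "(\<ominus>\<^bsub>R\<^esub> \<one>\<^bsub>R\<^esub>) \<odot>\<^bsub>M\<^esub> x = \<ominus>\<^bsub>M\<^esub> x"
  using smult_l_distr[of "\<ominus>\<^bsub>R\<^esub> \<one>\<^bsub>R\<^esub>" "\<one>\<^bsub>R\<^esub>" x] assms
  by (simp add: R.l_neg) (metis M.minus_equality R.a_inv_closed R.one_closed smult_closed)

lemma smult_diff:
  assumes "a \<in> carrier R" "x \<in> carrier M" "y \<in> carrier M"
  shows "a \<odot>\<^bsub>M\<^esub> (x \<ominus>\<^bsub>M\<^esub> y) = a \<odot>\<^bsub>M\<^esub> x \<ominus>\<^bsub>M\<^esub> a \<odot>\<^bsub>M\<^esub> y"
  using assms by (simp add: a_minus_def smult_r_distr smult_r_minus)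

lemma add_diff_swap:
  assumes "x \<in> carrier M" "y \<in> carrier M" "z \<in> carrier M" "w \<in> carrier M"
  shows "(x \<oplus>\<^bsub>M\<^esub> y) \<ominus>\<^bsub>M\<^esub> (z \<oplus>\<^bsub>M\<^esub> w) = (x \<ominus>\<^bsub>M\<^esub> z) \<oplus>\<^bsub>M\<^esub> (y \<ominus>\<^bsub>M\<^esub> w)"
  using assms by (simp add: a_minus_def M.minus_add M.a_ac)

lemma diff_closed [simp]: "\<lbrakk>x \<in> carrier M; y \<in> carrier M\<rbrakk> \<Longrightarrow> x \<ominus>\<^bsub>M\<^esub> y \<in> carrier M"
  by (simp add: a_minus_def)

lemma diff_eq_zero:
  "\<lbrakk>x \<in> carrier M; y \<in> carrier M\<rbrakk> \<Longrightarrow> x \<ominus>\<^bsub>M\<^esub> y = \<zero>\<^bsub>M\<^esub> \<longleftrightarrow> x = y"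
  by (metis M.a_assoc M.a_inv_closed M.l_neg M.l_zero M.r_neg M.r_zero a_minus_def)

lemma diff_self [simp]: "x \<in> carrier M \<Longrightarrow> x \<ominus>\<^bsub>M\<^esub> x = \<zero>\<^bsub>M\<^esub>"
  by (simp add: diff_eq_zero)

lemma diff_zero [simp]: "x \<in> carrier M \<Longrightarrow> x \<ominus>\<^bsub>M\<^esub> \<zero>\<^bsub>M\<^esub> = x"
  by (simp add: a_minus_def)

lemma diff_add_cancel [simp]:
  "\<lbrakk>x \<in> carrier M; y \<in> carrier M\<rbrakk> \<Longrightarrow> (x \<ominus>\<^bsub>M\<^esub> y) \<oplus>\<^bsub>M\<^esub> y = x"
  by (simp add: a_minus_def M.a_assoc M.l_neg)

lemma add_diff_cancel [simp]:
  "\<lbrakk>x \<in> carrier M; y \<in> carrier M\<rbrakk> \<Longrightarrow> (x \<oplus>\<^bsub>M\<^esub> y) \<ominus>\<^bsub>M\<^esub> y = x"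
  by (simp add: a_minus_def M.a_assoc M.r_neg)

lemma add_diff_cancel_left [simp]:
  "\<lbrakk>x \<in> carrier M; y \<in> carrier M\<rbrakk> \<Longrightarrow> x \<oplus>\<^bsub>M\<^esub> (y \<ominus>\<^bsub>M\<^esub> x) = y"
  by (metis diff_add_cancel diff_closed M.a_comm)

lemma add_eq_iff_diff:
  "\<lbrakk>x \<in> carrier M; y \<in> carrier M; z \<in> carrier M\<rbrakk> \<Longrightarrow> x = y \<oplus>\<^bsub>M\<^esub> z \<longleftrightarrow> x \<ominus>\<^bsub>M\<^esub> z = y"
  by (metis diff_add_cancel add_diff_cancel)

end

text \<open>Closure under negatives is omitted, since the scalar -1 provides it. This saves an
  obligation whenever a kernel, image or preimage is formed.\<close>

definition subm :: "'a ring \<Rightarrow> ('a, 'b) module \<Rightarrow> 'b set \<Rightarrow> bool" where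
  "subm R M N \<longleftrightarrow> N \<subseteq> carrier M \<and> \<zero>\<^bsub>M\<^esub> \<in> N \<and> (\<forall>x\<in>N. \<forall>y\<in>N. x \<oplus>\<^bsub>M\<^esub> y \<in> N) \<and>
     (\<forall>a\<in>carrier R. \<forall>x\<in>N. a \<odot>\<^bsub>M\<^esub> x \<in> N)"

abbreviation sub :: "('a, 'b) module \<Rightarrow> 'b set \<Rightarrow> ('a, 'b) module" where
  "sub M N \<equiv> M\<lparr>carrier := N\<rparr>"

lemma subm_minus:
  assumes "left_module R M" "subm R M N" "x \<in> N"
  shows "\<ominus>\<^bsub>M\<^esub> x \<in> N"
proof -
  interpret left_module R M by fact
  show ?thesis
    using assms smult_l_minus[of x] by (metis R.a_inv_closed R.one_closed subm_def subsetD)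
qed

lemma subm_diff:
  assumes "left_module R M" "subm R M N" "x \<in> N" "y \<in> N"
  shows "x \<ominus>\<^bsub>M\<^esub> y \<in> N"
  using assms subm_minus[OF assms(1,2)] by (simp add: a_minus_def subm_def)

lemma submodule_iff_subm:
  assumes "left_module R M"
  shows "submodule N R M \<longleftrightarrow> subm R M N"
proof
  assume "submodule N R M"
  then interpret submodule N R M .
  show "subm R M N"
    using subset one_closed m_closed smult_closed by (auto simp: subm_def)
next
  assume N: "subm R M N"
  have "inv\<^bsub>add_monoid M\<^esub> x \<in> N" if "x \<in> N" for x
    using subm_minus[OF assms N that] by (simp add: a_inv_def)
  then show "submodule N R M"
    using N by (intro submodule.intro subgroup.intro submodule_axioms.intro) (auto simp: subm_def)
qed

lemma left_module_sub:
  assumes "left_module R M" "subm R M N"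
  shows "left_module R (sub M N)"
proof -
  interpret left_module R M by fact
  have N: "x \<in> carrier M" if "x \<in> N" for x using assms that by (auto simp: subm_def)
  have N': "\<zero>\<^bsub>M\<^esub> \<in> N" "\<And>x y. x \<in> N \<Longrightarrow> y \<in> N \<Longrightarrow> x \<oplus>\<^bsub>M\<^esub> y \<in> N"
    "\<And>a x. a \<in> carrier R \<Longrightarrow> x \<in> N \<Longrightarrow> a \<odot>\<^bsub>M\<^esub> x \<in> N"
    using assms(2) by (auto simp: subm_def)
  show ?thesis
  proof (rule left_moduleI)
    fix x assume "x \<in> carrier (sub M N)"
    then show "\<exists>y\<in>carrier (sub M N). y \<oplus>\<^bsub>sub M N\<^esub> x = \<zero>\<^bsub>sub M N\<^esub>"
      using subm_minus[OF assms] N M.l_neg by auto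
  qed (simp_all add: N N' R.ring_axioms M.a_assoc smult_l_distr smult_r_distr smult_assoc,
      simp add: N M.a_comm)
qed

lemma subm_carrier:
  assumes "left_module R M"
  shows "subm R M (carrier M)"
proof -
  interpret left_module R M by fact
  show ?thesis by (auto simp: subm_def)
qed

lemma subm_zero:
  assumes "left_module R M"
  shows "subm R M {\<zero>\<^bsub>M\<^esub>}"
proof -
  interpret left_module R M by fact
  show ?thesis by (auto simp: subm_def)
qed

text \<open>Membership in \<open>mod_hom\<close> does not make source and target modules. Bundling
  the three facts lets one premise carry all that computing with a map requires.\<close>

locale lhom = M: left_module R M + N: left_module R N
  for R :: "'a ring" and M :: "('a, 'b) module" and N :: "('a, 'c) module" +
  fixes f :: "'b \<Rightarrow> 'c"
  assumes mem: "f \<in> mod_hom R M N"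
begin

lemma closed [simp]: "x \<in> carrier M \<Longrightarrow> f x \<in> carrier N"
  using mem by (auto simp: mod_hom_def hom_def)

lemma add [simp]:
  "\<lbrakk>x \<in> carrier M; y \<in> carrier M\<rbrakk> \<Longrightarrow> f (x \<oplus>\<^bsub>M\<^esub> y) = f x \<oplus>\<^bsub>N\<^esub> f y"
  using mem by (auto simp: mod_hom_def hom_def)

lemma smult [simp]:
  "\<lbrakk>a \<in> carrier R; x \<in> carrier M\<rbrakk> \<Longrightarrow> f (a \<odot>\<^bsub>M\<^esub> x) = a \<odot>\<^bsub>N\<^esub> f x"
  using mem by (auto simp: mod_hom_def)

lemma zero [simp]: "f \<zero>\<^bsub>M\<^esub> = \<zero>\<^bsub>N\<^esub>"
  using add[of "\<zero>\<^bsub>M\<^esub>" "\<zero>\<^bsub>M\<^esub>"]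
  by (metis M.M.l_zero M.M.zero_closed N.M.add.r_cancel_one closed)

lemma minus [simp]: "x \<in> carrier M \<Longrightarrow> f (\<ominus>\<^bsub>M\<^esub> x) = \<ominus>\<^bsub>N\<^esub> f x"
  by (metis M.M.a_inv_closed M.M.l_neg N.M.minus_equality add closed zero)

lemma diff [simp]:
  "\<lbrakk>x \<in> carrier M; y \<in> carrier M\<rbrakk> \<Longrightarrow> f (x \<ominus>\<^bsub>M\<^esub> y) = f x \<ominus>\<^bsub>N\<^esub> f y"
  by (simp add: a_minus_def)

end

lemma lhomI:
  assumes "left_module R M" "left_module R N"
    and "\<And>x. x \<in> carrier M \<Longrightarrow> f x \<in> carrier N"
    and "\<And>x y. \<lbrakk>x \<in> carrier M; y \<in> carrier M\<rbrakk> \<Longrightarrow> f (x \<oplus>\<^bsub>M\<^esub> y) = f x \<oplus>\<^bsub>N\<^esub> f y"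
    and "\<And>a x. \<lbrakk>a \<in> carrier R; x \<in> carrier M\<rbrakk> \<Longrightarrow> f (a \<odot>\<^bsub>M\<^esub> x) = a \<odot>\<^bsub>N\<^esub> f x"
  shows "lhom R M N f"
  using assms by (intro lhom.intro lhom_axioms.intro) (auto simp: mod_hom_def hom_def)

lemma lhom_iff: "lhom R M N f \<longleftrightarrow> left_module R M \<and> left_module R N \<and> f \<in> mod_hom R M N"
  by (auto simp: lhom_def lhom_axioms_def)

lemma lhom_modules: "lhom R M N f \<Longrightarrow> left_module R M" "lhom R M N f \<Longrightarrow> left_module R N"
  by (auto simp: lhom_iff)

lemma lhom_cong:
  assumes "lhom R M N f" "\<And>x. x \<in> carrier M \<Longrightarrow> f x = g x"
  shows "lhom R M N g"
proof -
  interpret f: lhom R M N f by fact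
  show ?thesis
    by (rule lhomI) (simp_all add: assms(2)[symmetric] f.M.left_module_axioms f.N.left_module_axioms)
qed

lemma lhom_comp:
  assumes "lhom R M N f" "lhom R N L g"
  shows "lhom R M L (\<lambda>x. g (f x))"
proof -
  interpret f: lhom R M N f by fact
  interpret g: lhom R N L g by fact
  show ?thesis by (rule lhomI) (auto simp: f.M.left_module_axioms g.N.left_module_axioms)
qed

lemma lhom_id: "left_module R M \<Longrightarrow> lhom R M M (\<lambda>x. x)"
  by (rule lhomI) auto

lemma lhom_zero: 
  assumes "left_module R M" "left_module R N"
  shows "lhom R M N (\<lambda>x. \<zero>\<^bsub>N\<^esub>)"
proof -
  interpret N: left_module R N by fact
  show ?thesis by (rule lhomI) (auto simp: assms)
qed

lemma lhom_add:
  assumes "lhom R M N f" "lhom R M N g"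
  shows "lhom R M N (\<lambda>x. f x \<oplus>\<^bsub>N\<^esub> g x)"
proof -
  interpret f: lhom R M N f by fact
  interpret g: lhom R M N g by fact
  show ?thesis
    by (rule lhomI)
      (auto simp: f.M.left_module_axioms f.N.left_module_axioms f.N.smult_r_distr f.N.M.a_ac)
qed

lemma lhom_diff:
  assumes "lhom R M N f" "lhom R M N g"
  shows "lhom R M N (\<lambda>x. f x \<ominus>\<^bsub>N\<^esub> g x)"
proof -
  interpret f: lhom R M N f by fact
  interpret g: lhom R M N g by fact
  show ?thesis
    by (rule lhomI)
      (auto simp: f.M.left_module_axioms f.N.left_module_axioms f.N.smult_diff f.N.add_diff_swap)
qed

lemma subm_kernel:
  assumes "lhom R M N f"
  shows "subm R M (a_kernel M N f)"
proof -
  interpret f: lhom R M N f by fact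
  show ?thesis by (auto simp: subm_def a_kernel_def')
qed

lemma subm_image:
  assumes "lhom R M N f" "subm R M K"
  shows "subm R N (f ` K)"
proof -
  interpret f: lhom R M N f by fact
  have K: "x \<in> K \<Longrightarrow> x \<in> carrier M" for x using assms(2) by (auto simp: subm_def)
  show ?thesis
    unfolding subm_def
  proof (intro conjI ballI)
    show "f ` K \<subseteq> carrier N" using K by auto
    show "\<zero>\<^bsub>N\<^esub> \<in> f ` K" using assms(2) f.zero by (metis image_eqI subm_def)
    show "x \<oplus>\<^bsub>N\<^esub> y \<in> f ` K" if "x \<in> f ` K" "y \<in> f ` K" for x y
      using that assms(2) K by (auto simp: subm_def f.add[symmetric] simp del: f.add)
    show "a \<odot>\<^bsub>N\<^esub> x \<in> f ` K" if "a \<in> carrier R" "x \<in> f ` K" for a x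
      using that assms(2) K by (auto simp: subm_def f.smult[symmetric] simp del: f.smult)
  qed
qed

lemma subm_range: "lhom R M N f \<Longrightarrow> subm R N (f ` carrier M)"
  by (simp add: subm_image subm_carrier lhom_modules)

lemma subm_vimage:
  assumes "lhom R M N f" "subm R N K"
  shows "subm R M {x \<in> carrier M. f x \<in> K}"
proof -
  interpret f: lhom R M N f by fact
  show ?thesis using assms(2) by (auto simp: subm_def)
qed

lemma lhom_sub_dom:
  assumes "lhom R M N f" "subm R M K"
  shows "lhom R (sub M K) N f"
proof -
  interpret f: lhom R M N f by fact
  show ?thesis
    using assms(2)
    by (intro lhomI left_module_sub f.M.left_module_axioms f.N.left_module_axioms)
      (auto simp: subm_def subset_iff)
qed

lemma lhom_sub_cod:
  assumes "lhom R M N f" "subm R N K" "\<And>x. x \<in> carrier M \<Longrightarrow> f x \<in> K"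
  shows "lhom R M (sub N K) f"
proof -
  interpret f: lhom R M N f by fact
  show ?thesis
    using assms(2,3)
    by (intro lhomI left_module_sub f.M.left_module_axioms f.N.left_module_axioms) auto
qed

lemma lhom_incl:
  assumes "left_module R M" "subm R M K"
  shows "lhom R (sub M K) M (\<lambda>x. x)"
  by (intro lhom_sub_dom lhom_id assms)

lemma subm_sub:
  "subm R M K \<Longrightarrow> L \<subseteq> K \<Longrightarrow> subm R (sub M K) L \<longleftrightarrow> subm R M L"
  by (auto simp: subm_def)

lemma lhom_sub_codD:
  assumes "lhom R M (sub N K) f" "left_module R N" "subm R N K"
  shows "lhom R M N f"
  using lhom_comp[OF assms(1) lhom_incl[OF assms(2,3)]] by simp

lemma inj_on_lhom_iff:
  assumes "lhom R M N f"
  shows "inj_on f (carrier M) \<longleftrightarrow> (\<forall>x\<in>carrier M. f x = \<zero>\<^bsub>N\<^esub> \<longrightarrow> x = \<zero>\<^bsub>M\<^esub>)"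
proof -
  interpret f: lhom R M N f by fact
  show ?thesis
  proof
    assume "inj_on f (carrier M)"
    then show "\<forall>x\<in>carrier M. f x = \<zero>\<^bsub>N\<^esub> \<longrightarrow> x = \<zero>\<^bsub>M\<^esub>"
      by (metis f.M.M.zero_closed f.zero inj_onD)
  next
    assume *: "\<forall>x\<in>carrier M. f x = \<zero>\<^bsub>N\<^esub> \<longrightarrow> x = \<zero>\<^bsub>M\<^esub>"
    show "inj_on f (carrier M)"
    proof (rule inj_onI)
      fix x y assume "x \<in> carrier M" "y \<in> carrier M" "f x = f y"
      then show "x = y" using *[rule_format, of "x \<ominus>\<^bsub>M\<^esub> y"] f.M.diff_eq_zero by auto
    qed
  qed
qed

text \<open>The chosen preimage map \<open>s\<close> need not be linear. Still \<open>h\<close> is,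
  because two preimages of a point differ by an element of the kernel of \<open>p\<close>, on which
  \<open>g\<close> vanishes.\<close>

lemma lhom_factor:
  assumes p: "lhom R M N p" "p ` carrier M = carrier N" and g: "lhom R M L g"
    and k: "\<And>x. \<lbrakk>x \<in> carrier M; p x = \<zero>\<^bsub>N\<^esub>\<rbrakk> \<Longrightarrow> g x = \<zero>\<^bsub>L\<^esub>"
  obtains h where "lhom R N L h" "\<And>x. x \<in> carrier M \<Longrightarrow> h (p x) = g x"
proof -
  interpret p: lhom R M N p by fact
  interpret g: lhom R M L g by fact
  define s where "s y = (SOME x. x \<in> carrier M \<and> p x = y)" for y
  have s: "s y \<in> carrier M \<and> p (s y) = y" if "y \<in> carrier N" for y
    unfolding s_def by (rule someI_ex) (use that p(2) in \<open>metis imageE\<close>)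
  have eq: "g x = g y" if "x \<in> carrier M" "y \<in> carrier M" "p x = p y" for x y
    using k[of "x \<ominus>\<^bsub>M\<^esub> y"] that p.N.diff_eq_zero g.N.diff_eq_zero by auto
  define h where "h y = g (s y)" for y
  have hp: "h (p x) = g x" if "x \<in> carrier M" for x
    unfolding h_def using that s[of "p x"] by (intro eq) auto
  have "lhom R N L h"
  proof (rule lhomI)
    fix x y assume "x \<in> carrier N" "y \<in> carrier N"
    then obtain x' y' where "x' \<in> carrier M" "y' \<in> carrier M" "x = p x'" "y = p y'"
      using p(2) by (metis imageE)
    then show "h (x \<oplus>\<^bsub>N\<^esub> y) = h x \<oplus>\<^bsub>L\<^esub> h y"
      using hp[of "x' \<oplus>\<^bsub>M\<^esub> y'"] by (simp add: hp)
  next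
    fix a x assume "a \<in> carrier R" "x \<in> carrier N"
    then obtain x' where "x' \<in> carrier M" "x = p x'" using p(2) by (metis imageE)
    then show "h (a \<odot>\<^bsub>N\<^esub> x) = a \<odot>\<^bsub>L\<^esub> h x"
      using hp[of "a \<odot>\<^bsub>M\<^esub> x'"] \<open>a \<in> carrier R\<close> by (simp add: hp)
  qed (use s p.N.left_module_axioms g.N.left_module_axioms in \<open>auto simp: h_def\<close>)
  with hp that show ?thesis by blast
qed

text \<open>Factoring the identity of \<open>M\<close> through \<open>f\<close> yields an inverse
  whose linearity comes for free.\<close>

lemma lhom_inv:
  assumes "lhom R M N f" "bij_betw f (carrier M) (carrier N)"
  obtains g where "lhom R N M g" "\<And>x. x \<in> carrier M \<Longrightarrow> g (f x) = x"
    "\<And>y. y \<in> carrier N \<Longrightarrow> g y \<in> carrier M \<and> f (g y) = y"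
proof -
  interpret f: lhom R M N f by fact
  have inj: "inj_on f (carrier M)" and sur: "f ` carrier M = carrier N"
    using assms(2) by (auto simp: bij_betw_def)
  obtain g where g: "lhom R N M g" "\<And>x. x \<in> carrier M \<Longrightarrow> g (f x) = x"
  proof (rule lhom_factor[OF assms(1) sur lhom_id[OF f.M.left_module_axioms]])
    show "x = \<zero>\<^bsub>M\<^esub>" if "x \<in> carrier M" "f x = \<zero>\<^bsub>N\<^esub>" for x
      using that inj inj_on_lhom_iff[OF assms(1)] by blast
  qed (rule that)
  moreover have "g y \<in> carrier M \<and> f (g y) = y" if "y \<in> carrier N" for y
    using that sur g(2) by (metis imageE)
  ultimately show ?thesis using that by blast
qed

section \<open>Direct sums and transport of structure\<close>

definition dsum :: "('a, 'b) module \<Rightarrow> ('a, 'c) module \<Rightarrow> ('a, 'b \<times> 'c) module" where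
  "dsum M N = \<lparr>carrier = carrier M \<times> carrier N, mult = undefined, one = undefined,
     zero = (\<zero>\<^bsub>M\<^esub>, \<zero>\<^bsub>N\<^esub>), add = (\<lambda>x y. (fst x \<oplus>\<^bsub>M\<^esub> fst y, snd x \<oplus>\<^bsub>N\<^esub> snd y)),
     smult = (\<lambda>a x. (a \<odot>\<^bsub>M\<^esub> fst x, a \<odot>\<^bsub>N\<^esub> snd x))\<rparr>"

lemma dsum_simps [simp]:
  "carrier (dsum M N) = carrier M \<times> carrier N"
  "\<zero>\<^bsub>dsum M N\<^esub> = (\<zero>\<^bsub>M\<^esub>, \<zero>\<^bsub>N\<^esub>)"
  "x \<oplus>\<^bsub>dsum M N\<^esub> y = (fst x \<oplus>\<^bsub>M\<^esub> fst y, snd x \<oplus>\<^bsub>N\<^esub> snd y)"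
  "a \<odot>\<^bsub>dsum M N\<^esub> x = (a \<odot>\<^bsub>M\<^esub> fst x, a \<odot>\<^bsub>N\<^esub> snd x)"
  by (auto simp: dsum_def)

lemma left_module_dsum:
  assumes "left_module R M" "left_module R N"
  shows "left_module R (dsum M N)"
proof -
  interpret M: left_module R M by fact
  interpret N: left_module R N by fact
  show ?thesis
  proof (rule left_moduleI)
    fix x assume "x \<in> carrier (dsum M N)"
    then show "\<exists>y\<in>carrier (dsum M N). y \<oplus>\<^bsub>dsum M N\<^esub> x = \<zero>\<^bsub>dsum M N\<^esub>"
      by (intro bexI[of _ "(\<ominus>\<^bsub>M\<^esub> fst x, \<ominus>\<^bsub>N\<^esub> snd x)"]) (auto simp: M.M.l_neg N.M.l_neg)
  qed (auto simp: M.R.ring_axioms M.M.a_ac N.M.a_ac M.smult_l_distr N.smult_l_distr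
      M.smult_r_distr N.smult_r_distr M.smult_assoc N.smult_assoc)
qed

lemma lhom_fst: "\<lbrakk>left_module R M; left_module R N\<rbrakk> \<Longrightarrow> lhom R (dsum M N) M fst"
  by (rule lhomI) (auto simp: left_module_dsum)

lemma lhom_snd: "\<lbrakk>left_module R M; left_module R N\<rbrakk> \<Longrightarrow> lhom R (dsum M N) N snd"
  by (rule lhomI) (auto simp: left_module_dsum)

lemma lhom_pair:
  assumes "lhom R L M f" "lhom R L N g"
  shows "lhom R L (dsum M N) (\<lambda>x. (f x, g x))"
proof -
  interpret f: lhom R L M f by fact
  interpret g: lhom R L N g by fact
  show ?thesis
    by (rule lhomI) (auto simp: left_module_dsum f.M.left_module_axioms f.N.left_module_axioms
        g.N.left_module_axioms)
qed

lemma lhom_copair: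
  assumes "lhom R M L f" "lhom R N L g"
  shows "lhom R (dsum M N) L (\<lambda>x. f (fst x) \<oplus>\<^bsub>L\<^esub> g (snd x))"
  using lhom_modules[OF assms(1)] lhom_modules[OF assms(2)]
  by (intro lhom_add lhom_comp[OF lhom_fst assms(1)] lhom_comp[OF lhom_snd assms(2)])

text \<open>Moves a module to another type. The module laws hold on the image as soon as
  \<open>\<phi>\<close> is injective on the carrier.\<close>

definition transport :: "('b \<Rightarrow> 'c) \<Rightarrow> ('a, 'b) module \<Rightarrow> ('a, 'c) module" where
  "transport \<phi> M = \<lparr>carrier = \<phi> ` carrier M, mult = undefined, one = undefined,
     zero = \<phi> \<zero>\<^bsub>M\<^esub>,
     add = (\<lambda>x y. \<phi> (inv_into (carrier M) \<phi> x \<oplus>\<^bsub>M\<^esub> inv_into (carrier M) \<phi> y)),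
     smult = (\<lambda>a x. \<phi> (a \<odot>\<^bsub>M\<^esub> inv_into (carrier M) \<phi> x))\<rparr>"

lemma lhom_transport:
  assumes "left_module R M" "inj_on \<phi> (carrier M)"
  shows "lhom R M (transport \<phi> M) \<phi>" "bij_betw \<phi> (carrier M) (carrier (transport \<phi> M))"
proof -
  interpret left_module R M by fact
  have i [simp]: "inv_into (carrier M) \<phi> (\<phi> x) = x" if "x \<in> carrier M" for x
    using assms(2) that by simp
  have "left_module R (transport \<phi> M)"
  proof (rule left_moduleI)
    fix x assume "x \<in> carrier (transport \<phi> M)"
    then obtain y where "y \<in> carrier M" "x = \<phi> y" by (auto simp: transport_def)
    then show "\<exists>y\<in>carrier (transport \<phi> M). y \<oplus>\<^bsub>transport \<phi> M\<^esub> x = \<zero>\<^bsub>transport \<phi> M\<^esub>"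
      by (intro bexI[of _ "\<phi> (\<ominus>\<^bsub>M\<^esub> y)"]) (auto simp: transport_def M.l_neg)
  qed (auto simp: transport_def M.a_ac smult_l_distr smult_r_distr smult_assoc intro: R.ring_axioms)
  then show "lhom R M (transport \<phi> M) \<phi>"
    by (intro lhomI left_module_axioms) (auto simp: transport_def)
  show "bij_betw \<phi> (carrier M) (carrier (transport \<phi> M))"
    using assms(2) by (simp add: bij_betw_def transport_def)
qed

section \<open>Finitely generated, noetherian and projective modules\<close>

primrec lc :: "('a, 'b) module \<Rightarrow> nat \<Rightarrow> (nat \<Rightarrow> 'a) \<Rightarrow> (nat \<Rightarrow> 'b) \<Rightarrow> 'b" where
  "lc M 0 a x = \<zero>\<^bsub>M\<^esub>"
| "lc M (Suc n) a x = lc M n a x \<oplus>\<^bsub>M\<^esub> a n \<odot>\<^bsub>M\<^esub> x n"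

lemma lc_cong:
  "\<lbrakk>\<And>i. i < n \<Longrightarrow> a i = b i; \<And>i. i < n \<Longrightarrow> x i = y i\<rbrakk> \<Longrightarrow> lc M n a x = lc M n b y"
  by (induction n) auto

lemma lc_sub [simp]: "lc (sub M K) n a x = lc M n a x"
  by (induction n) auto

lemma lc_subm:
  assumes "subm R M K" "\<And>i. i < n \<Longrightarrow> a i \<in> carrier R" "\<And>i. i < n \<Longrightarrow> x i \<in> K"
  shows "lc M n a x \<in> K"
  using assms(2,3) by (induction n) (use assms(1) in \<open>auto simp: subm_def\<close>)

lemma (in lhom) lc:
  assumes "\<And>i. i < n \<Longrightarrow> a i \<in> carrier R" "\<And>i. i < n \<Longrightarrow> x i \<in> carrier M"
  shows "f (lc M n a x) = lc N n a (\<lambda>i. f (x i))"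
  using assms
proof (induction n)
  case (Suc n)
  then show ?case
    using lc_subm[OF subm_carrier[OF M.left_module_axioms], of n a x] by auto
qed auto

context left_module
begin

lemma lc_closed:
  assumes "\<And>i. i < n \<Longrightarrow> a i \<in> carrier R" "\<And>i. i < n \<Longrightarrow> x i \<in> carrier M"
  shows "lc M n a x \<in> carrier M"
  by (rule lc_subm[OF subm_carrier[OF left_module_axioms] assms])

lemma lc_add:
  assumes "\<And>i. i < n \<Longrightarrow> a i \<in> carrier R" "\<And>i. i < n \<Longrightarrow> b i \<in> carrier R"
    "\<And>i. i < n \<Longrightarrow> x i \<in> carrier M"
  shows "lc M n (\<lambda>i. a i \<oplus>\<^bsub>R\<^esub> b i) x = lc M n a x \<oplus>\<^bsub>M\<^esub> lc M n b x"
  using assms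
proof (induction n)
  case (Suc n)
  then have "lc M n a x \<in> carrier M" "lc M n b x \<in> carrier M" by (auto intro: lc_closed)
  with Suc show ?case by (simp add: smult_l_distr M.a_ac)
qed auto

lemma lc_smult:
  assumes "c \<in> carrier R" "\<And>i. i < n \<Longrightarrow> a i \<in> carrier R" "\<And>i. i < n \<Longrightarrow> x i \<in> carrier M"
  shows "lc M n (\<lambda>i. c \<otimes>\<^bsub>R\<^esub> a i) x = c \<odot>\<^bsub>M\<^esub> lc M n a x"
  using assms(2,3)
proof (induction n)
  case (Suc n)
  then have "lc M n a x \<in> carrier M" by (auto intro: lc_closed)
  with Suc assms(1) show ?case by (simp add: smult_r_distr smult_assoc)
qed (use assms in auto)

lemma lc_zero:
  assumes "\<And>i. i < n \<Longrightarrow> a i = \<zero>\<^bsub>R\<^esub>" "\<And>i. i < n \<Longrightarrow> x i \<in> carrier M"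
  shows "lc M n a x = \<zero>\<^bsub>M\<^esub>"
  using assms by (induction n) auto

lemma lc_unit:
  assumes "\<And>i. i < n \<Longrightarrow> x i \<in> carrier M" "j < n"
  shows "lc M n (\<lambda>i. if i = j then \<one>\<^bsub>R\<^esub> else \<zero>\<^bsub>R\<^esub>) x = x j"
  using assms
proof (induction n)
  case (Suc n)
  show ?case
  proof (cases "j = n")
    case True
    then show ?thesis using Suc.prems lc_zero[of n "\<lambda>i. if i = j then \<one>\<^bsub>R\<^esub> else \<zero>\<^bsub>R\<^esub>" x] by simp
  next
    case False
    then show ?thesis using Suc by simp
  qed
qed auto

lemma lc_append:
  assumes "\<And>i. i < n + m \<Longrightarrow> a i \<in> carrier R" "\<And>i. i < n + m \<Longrightarrow> x i \<in> carrier M"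
  shows "lc M (n + m) a x = lc M n a x \<oplus>\<^bsub>M\<^esub> lc M m (\<lambda>i. a (n + i)) (\<lambda>i. x (n + i))"
  using assms
proof (induction m)
  case 0
  then have "lc M n a x \<in> carrier M" by (intro lc_closed) auto
  then show ?case by simp
next
  case (Suc m)
  then have "lc M n a x \<in> carrier M" "lc M m (\<lambda>i. a (n + i)) (\<lambda>i. x (n + i)) \<in> carrier M"
    by (auto intro!: lc_closed)
  with Suc show ?case by (simp add: M.a_assoc)
qed

end

definition gen :: "'a ring \<Rightarrow> ('a, 'b) module \<Rightarrow> nat \<Rightarrow> (nat \<Rightarrow> 'b) \<Rightarrow> bool" where
  "gen R M n x \<longleftrightarrow> (\<forall>i<n. x i \<in> carrier M) \<and>
     (\<forall>y\<in>carrier M. \<exists>a. (\<forall>i<n. a i \<in> carrier R) \<and> y = lc M n a x)"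

text \<open>The combinations of finitely many elements form the smallest submodule containing them,
  so an intersection of submodules turns into explicit coefficients.\<close>

lemma fg_module_iff_gen: "fg_module R M \<longleftrightarrow> left_module R M \<and> (\<exists>n x. gen R M n x)"
proof (cases "left_module R M")
  case False
  then show ?thesis by (simp add: fg_module_def)
next
  case True
  then interpret left_module R M .
  show ?thesis
  proof
    assume "fg_module R M"
    then obtain A where A: "finite A" "A \<subseteq> carrier M"
      and gA: "\<Inter>{N. submodule N R M \<and> A \<subseteq> N} = carrier M"
      by (auto simp: fg_module_def)
    obtain n x where x: "A = x ` {i::nat. i < n}" using finite_imp_nat_seg_image_inj_on[OF A(1)] by blast
    have xM: "x i \<in> carrier M" if "i < n" for i using that x A(2) by auto
    define N where "N = {lc M n a x | a. \<forall>i<n. a i \<in> carrier R}"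
    have "subm R M N"
      unfolding subm_def
    proof (intro conjI ballI)
      show "N \<subseteq> carrier M" using lc_closed xM by (auto simp: N_def)
      show "\<zero>\<^bsub>M\<^esub> \<in> N" unfolding N_def using lc_zero[of n "\<lambda>_. \<zero>\<^bsub>R\<^esub>" x] xM
        by (intro CollectI exI[of _ "\<lambda>_. \<zero>\<^bsub>R\<^esub>"]) auto
      show "y \<oplus>\<^bsub>M\<^esub> z \<in> N" if yz: "y \<in> N" "z \<in> N" for y z
      proof -
        obtain a b where "\<forall>i<n. a i \<in> carrier R" "y = lc M n a x" "\<forall>i<n. b i \<in> carrier R" "z = lc M n b x"
          using yz by (auto simp: N_def)
        then show ?thesis unfolding N_def using lc_add[of n a b x] xM
          by (intro CollectI exI[of _ "\<lambda>i. a i \<oplus>\<^bsub>R\<^esub> b i"]) auto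
      qed
      show "c \<odot>\<^bsub>M\<^esub> y \<in> N" if yz: "c \<in> carrier R" "y \<in> N" for c y
      proof -
        obtain a where "\<forall>i<n. a i \<in> carrier R" "y = lc M n a x"
          using yz by (auto simp: N_def)
        then show ?thesis unfolding N_def using lc_smult[of c n a x] xM yz
          by (intro CollectI exI[of _ "\<lambda>i. c \<otimes>\<^bsub>R\<^esub> a i"]) auto
      qed
    qed
    moreover have "A \<subseteq> N"
    proof
      fix y assume "y \<in> A"
      then obtain j where j: "j < n" "y = x j" using x by auto
      have "lc M n (\<lambda>i. if i = j then \<one>\<^bsub>R\<^esub> else \<zero>\<^bsub>R\<^esub>) x = y"
        using lc_unit[of n x j] xM j by simp
      then show "y \<in> N"
        unfolding N_def by (intro CollectI exI[of _ "\<lambda>i. if i = j then \<one>\<^bsub>R\<^esub> else \<zero>\<^bsub>R\<^esub>"]) auto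
    qed
    ultimately have "carrier M \<subseteq> N" using gA submodule_iff_subm[OF True] by blast
    then have "gen R M n x" unfolding gen_def N_def using xM by blast
    then show "left_module R M \<and> (\<exists>n x. gen R M n x)" using True by blast
  next
    assume "left_module R M \<and> (\<exists>n x. gen R M n x)"
    then obtain n x where g: "gen R M n x" by blast
    let ?A = "x ` {..<n}"
    have "carrier M \<subseteq> N" if N: "subm R M N" "?A \<subseteq> N" for N
    proof
      fix y assume "y \<in> carrier M"
      then obtain a where "\<forall>i<n. a i \<in> carrier R" "y = lc M n a x" using g by (auto simp: gen_def)
      then show "y \<in> N" using N lc_subm[OF N(1), of n a x] by auto
    qed
    then have "\<Inter>{N. submodule N R M \<and> ?A \<subseteq> N} = carrier M"
      using g subm_carrier[OF True] submodule_iff_subm[OF True] by (auto simp: gen_def)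
    then show "fg_module R M"
      unfolding fg_module_def using True g by (intro conjI exI[of _ ?A]) (auto simp: gen_def)
  qed
qed

lemma fg_module_left_module: "fg_module R M \<Longrightarrow> left_module R M"
  by (simp add: fg_module_def)

lemma fg_module_surj:
  assumes "fg_module R M" "lhom R M N f" "f ` carrier M = carrier N"
  shows "fg_module R N"
proof -
  interpret f: lhom R M N f by fact
  obtain n x where g: "gen R M n x" using assms(1) fg_module_iff_gen by blast
  then have x: "x i \<in> carrier M" if "i < n" for i using that by (auto simp: gen_def)
  have "gen R N n (\<lambda>i. f (x i))"
    unfolding gen_def
  proof (intro conjI ballI)
    show "\<forall>i<n. f (x i) \<in> carrier N" using x by auto
    fix y assume "y \<in> carrier N"
    then obtain z where z: "z \<in> carrier M" "y = f z" using assms(3) by (metis imageE)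
    then obtain a where "\<forall>i<n. a i \<in> carrier R" "z = lc M n a x" using g by (auto simp: gen_def)
    then show "\<exists>a. (\<forall>i<n. a i \<in> carrier R) \<and> y = lc N n a (\<lambda>i. f (x i))"
      using z x f.lc[of n a x] by auto
  qed
  then show ?thesis using fg_module_iff_gen f.N.left_module_axioms by blast
qed

text \<open>Take generators of the kernel followed by preimages of generators of \<open>N\<close>: a
  combination of the latter agrees with any given element up to the kernel.\<close>

lemma fg_module_extension:
  assumes f: "lhom R M N f" "f ` carrier M = carrier N"
    and N: "fg_module R N" and K: "fg_module R (sub M (a_kernel M N f))"
  shows "fg_module R M"
proof -
  interpret f: lhom R M N f by fact
  let ?K = "a_kernel M N f"
  obtain n x where g: "gen R (sub M ?K) n x" using K fg_module_iff_gen by blast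
  obtain m y where h: "gen R N m y" using N fg_module_iff_gen by blast
  have x: "x i \<in> carrier M" if "i < n" for i using that g by (auto simp: gen_def a_kernel_def')
  have "\<forall>i<m. \<exists>z\<in>carrier M. f z = y i" using h f(2) by (metis gen_def imageE)
  then obtain z where z: "\<And>i. i < m \<Longrightarrow> z i \<in> carrier M" "\<And>i. i < m \<Longrightarrow> f (z i) = y i" by metis
  define w where "w i = (if i < n then x i else z (i - n))" for i
  have w: "w i \<in> carrier M" if "i < n + m" for i using that x z by (auto simp: w_def)
  have "gen R M (n + m) w"
    unfolding gen_def
  proof (intro conjI ballI)
    show "\<forall>i<n+m. w i \<in> carrier M" using w by blast
    fix u assume u: "u \<in> carrier M"
    then obtain b where b: "\<forall>i<m. b i \<in> carrier R" "f u = lc N m b y" 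
      using h f.closed[OF u] unfolding gen_def by blast
    define v where "v = lc M m b z"
    have v: "v \<in> carrier M" unfolding v_def using b z by (intro f.M.lc_closed) auto
    have "f v = f u" unfolding v_def using f.lc[of m b z] b z lc_cong[of m b b "\<lambda>i. f (z i)" y N] by auto
    then have "u \<ominus>\<^bsub>M\<^esub> v \<in> ?K" using u v by (simp add: a_kernel_def')
    then obtain a where a: "\<forall>i<n. a i \<in> carrier R" "u \<ominus>\<^bsub>M\<^esub> v = lc M n a x" using g by (auto simp: gen_def)
    define c where "c i = (if i < n then a i else b (i - n))" for i
    have c: "c i \<in> carrier R" if "i < n + m" for i using that a b by (auto simp: c_def)
    have "lc M (n + m) c w = lc M n c w \<oplus>\<^bsub>M\<^esub> lc M m (\<lambda>i. c (n + i)) (\<lambda>i. w (n + i))"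
      using c w by (intro f.M.lc_append)
    also have "lc M n c w = u \<ominus>\<^bsub>M\<^esub> v" unfolding a by (intro lc_cong) (auto simp: c_def w_def)
    also have "lc M m (\<lambda>i. c (n + i)) (\<lambda>i. w (n + i)) = v"
      unfolding v_def by (intro lc_cong) (auto simp: c_def w_def)
    finally have "lc M (n + m) c w = u" using u v by simp
    then show "\<exists>a. (\<forall>i<n+m. a i \<in> carrier R) \<and> u = lc M (n + m) a w"
      using c by blast
  qed
  then show ?thesis using fg_module_iff_gen f.M.left_module_axioms by blast
qed

text \<open>Vectors of all ranks share one type and are padded with zeros. Equality of vectors is
  then equality of functions, and the kernel of the last coordinate on \<open>free R (Suc n)\<close>
  is literally \<open>free R n\<close>.\<close>

definition free :: "'a ring \<Rightarrow> nat \<Rightarrow> ('a, nat \<Rightarrow> 'a) module" where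
  "free R n = \<lparr>carrier = {a. (\<forall>i<n. a i \<in> carrier R) \<and> (\<forall>i\<ge>n. a i = \<zero>\<^bsub>R\<^esub>)},
     mult = undefined, one = undefined, zero = (\<lambda>_. \<zero>\<^bsub>R\<^esub>),
     add = (\<lambda>a b i. a i \<oplus>\<^bsub>R\<^esub> b i), smult = (\<lambda>c a i. c \<otimes>\<^bsub>R\<^esub> a i)\<rparr>"

definition unit_vec :: "'a ring \<Rightarrow> nat \<Rightarrow> nat \<Rightarrow> 'a" where
  "unit_vec R j = (\<lambda>i. if i = j then \<one>\<^bsub>R\<^esub> else \<zero>\<^bsub>R\<^esub>)"

lemma free_coord: "ring R \<Longrightarrow> x \<in> carrier (free R n) \<Longrightarrow> x i \<in> carrier R"
  by (cases "i < n") (auto simp: free_def ring.ring_simprules)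

lemma left_module_free:
  assumes R: "ring R"
  shows "left_module R (free R n)"
proof -
  interpret ring R by fact
  note c = free_coord[OF R, of _ n]
  show ?thesis
  proof (rule left_moduleI)
    fix x assume x: "x \<in> carrier (free R n)"
    show "\<exists>y\<in>carrier (free R n). y \<oplus>\<^bsub>free R n\<^esub> x = \<zero>\<^bsub>free R n\<^esub>"
      by (rule bexI[of _ "\<lambda>i. \<ominus>\<^bsub>R\<^esub> x i"]) (use c[OF x] x in \<open>simp_all add: free_def l_neg\<close>)
  next
    fix x y z assume "x \<in> carrier (free R n)" "y \<in> carrier (free R n)" "z \<in> carrier (free R n)"
    then show "(x \<oplus>\<^bsub>free R n\<^esub> y) \<oplus>\<^bsub>free R n\<^esub> z = x \<oplus>\<^bsub>free R n\<^esub> (y \<oplus>\<^bsub>free R n\<^esub> z)"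
      using c[of x] c[of y] c[of z] by (simp add: free_def a_assoc)
  next
    fix x y assume "x \<in> carrier (free R n)" "y \<in> carrier (free R n)"
    then show "x \<oplus>\<^bsub>free R n\<^esub> y = y \<oplus>\<^bsub>free R n\<^esub> x"
      "\<zero>\<^bsub>free R n\<^esub> \<oplus>\<^bsub>free R n\<^esub> x = x" "\<one>\<^bsub>R\<^esub> \<odot>\<^bsub>free R n\<^esub> x = x"
      "\<And>a. a \<in> carrier R \<Longrightarrow> a \<odot>\<^bsub>free R n\<^esub> (x \<oplus>\<^bsub>free R n\<^esub> y) = a \<odot>\<^bsub>free R n\<^esub> x \<oplus>\<^bsub>free R n\<^esub> a \<odot>\<^bsub>free R n\<^esub> y"
      using c[of x] c[of y] by (simp_all add: free_def a_comm r_distr)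
  next
    fix a b x assume "a \<in> carrier R" "b \<in> carrier R" "x \<in> carrier (free R n)"
    then show "(a \<oplus>\<^bsub>R\<^esub> b) \<odot>\<^bsub>free R n\<^esub> x = a \<odot>\<^bsub>free R n\<^esub> x \<oplus>\<^bsub>free R n\<^esub> b \<odot>\<^bsub>free R n\<^esub> x"
      "(a \<otimes>\<^bsub>R\<^esub> b) \<odot>\<^bsub>free R n\<^esub> x = a \<odot>\<^bsub>free R n\<^esub> (b \<odot>\<^bsub>free R n\<^esub> x)"
      using c[of x] by (simp_all add: free_def l_distr m_assoc)
  qed (auto simp: free_def ring_axioms)
qed

lemma unit_vec_closed: "ring R \<Longrightarrow> j < n \<Longrightarrow> unit_vec R j \<in> carrier (free R n)"
  by (auto simp: unit_vec_def free_def ring.ring_simprules)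

lemma lc_unit_vec:
  assumes "ring R" "a \<in> carrier (free R n)"
  shows "lc (free R n) n a (unit_vec R) = a"
proof -
  interpret ring R by fact
  have "lc (free R n) k a (unit_vec R) = (\<lambda>j. if j < k then a j else \<zero>\<^bsub>R\<^esub>)" if "k \<le> n" for k
    using that
  proof (induction k)
    case (Suc k)
    then have "a k \<in> carrier R" "\<And>j. j < k \<Longrightarrow> a j \<in> carrier R" using assms(2) by (auto simp: free_def)
    with Suc show ?case by (auto simp: free_def unit_vec_def fun_eq_iff less_Suc_eq)
  qed (simp add: free_def)
  then have "lc (free R n) n a (unit_vec R) = (\<lambda>j. if j < n then a j else \<zero>\<^bsub>R\<^esub>)" by simp
  also have "\<dots> = a" using assms(2) by (auto simp: free_def fun_eq_iff)
  finally show ?thesis .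
qed

lemma lhom_lc:
  assumes "left_module R M" "\<And>i. i < n \<Longrightarrow> x i \<in> carrier M"
  shows "lhom R (free R n) M (\<lambda>a. lc M n a x)"
proof -
  interpret left_module R M by fact
  show ?thesis
  proof (rule lhomI)
    show "left_module R (free R n)" by (rule left_module_free[OF R.ring_axioms])
  qed (use assms lc_closed[of n _ x] lc_add[of n _ _ x] lc_smult[of _ n _ x] in \<open>auto simp: free_def\<close>)
qed

lemma fg_module_free_surj:
  assumes "fg_module R M"
  obtains n p where "lhom R (free R n) M p" "p ` carrier (free R n) = carrier M"
proof -
  obtain n x where g: "gen R M n x" using assms fg_module_iff_gen by blast
  interpret left_module R M using assms by (simp add: fg_module_def)
  have x: "x i \<in> carrier M" if "i < n" for i using that g by (auto simp: gen_def)
  interpret p: lhom R "free R n" M "\<lambda>a. lc M n a x"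
    using lhom_lc[OF left_module_axioms, of n x] x by blast
  have "y \<in> (\<lambda>a. lc M n a x) ` carrier (free R n)" if "y \<in> carrier M" for y
  proof -
    obtain a where a: "\<forall>i<n. a i \<in> carrier R" "y = lc M n a x" 
      using g \<open>y \<in> carrier M\<close> unfolding gen_def by blast
    show ?thesis
    proof
      \<comment> \<open>The coefficients are cut off at \<open>n\<close> to obtain a padded vector;
        \<open>lc\<close> does not see the difference.\<close>
      show "y = lc M n (\<lambda>i. if i < n then a i else \<zero>\<^bsub>R\<^esub>) x" unfolding a by (rule lc_cong) auto
    qed (use a in \<open>auto simp: free_def\<close>)
  qed
  then have "(\<lambda>a. lc M n a x) ` carrier (free R n) = carrier M" using p.closed by blast
  with p.lhom_axioms that show ?thesis by blast
qed

lemma fg_module_free: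
  assumes "ring R"
  shows "fg_module R (free R n)"
proof -
  have "gen R (free R n) n (unit_vec R)"
    unfolding gen_def using assms lc_unit_vec[OF assms] unit_vec_closed[OF assms]
    by (auto simp: free_def intro: exI[where x = x for x])
  then show ?thesis using fg_module_iff_gen left_module_free[OF assms] by blast
qed

text \<open>An element of \<open>M\<close> is represented by its fibre under a surjection from
  \<open>free R n\<close>. Fibres are sets of sequences, and distinct elements have distinct fibres
  because these are nonempty.\<close>

lemma univ_copy:
  fixes M :: "('a, 'b) module"
  assumes "fg_module R M"
  obtains M' :: "('a, 'a univ) module" and \<phi>
  where "lhom R M M' \<phi>" "bij_betw \<phi> (carrier M) (carrier M')"
proof -
  obtain n p where p: "lhom R (free R n) M p" "p ` carrier (free R n) = carrier M"
    using fg_module_free_surj[OF assms] .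
  define \<phi> where "\<phi> y = {a \<in> carrier (free R n). p a = y}" for y
  have "inj_on \<phi> (carrier M)"
  proof (rule inj_onI)
    fix x y assume "x \<in> carrier M" "y \<in> carrier M" and eq: "\<phi> x = \<phi> y"
    then obtain a where "a \<in> carrier (free R n)" "p a = x" using p(2) by (metis imageE)
    then have "a \<in> \<phi> y" using eq by (auto simp: \<phi>_def)
    then show "x = y" using \<open>p a = x\<close> by (simp add: \<phi>_def)
  qed
  from lhom_transport[OF fg_module_left_module[OF assms] this] that show ?thesis by blast
qed

lemma univ_copy_inv:
  fixes M :: "('a, 'b) module"
  assumes "fg_module R M"
  obtains M' :: "('a, 'a univ) module" and \<phi>
  where "lhom R M' M \<phi>" "bij_betw \<phi> (carrier M') (carrier M)" "fg_module R M'"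
proof -
  obtain M' :: "('a, 'a univ) module" and \<phi> where \<phi>: "lhom R M M' \<phi>" "bij_betw \<phi> (carrier M) (carrier M')"
    using univ_copy[OF assms] .
  obtain \<psi> where \<psi>: "lhom R M' M \<psi>" "\<And>x. x \<in> carrier M \<Longrightarrow> \<psi> (\<phi> x) = x"
    "\<And>y. y \<in> carrier M' \<Longrightarrow> \<psi> y \<in> carrier M \<and> \<phi> (\<psi> y) = y"
    using lhom_inv[OF \<phi>] by blast
  have "bij_betw \<psi> (carrier M') (carrier M)"
    using \<psi>(2,3) lhom.closed[OF \<phi>(1)] by (intro bij_betw_byWitness[where f' = \<phi>]) blast+
  moreover have "fg_module R M'" using fg_module_surj[OF assms \<phi>(1)] \<phi>(2) by (simp add: bij_betw_def)
  ultimately show ?thesis using that \<psi>(1) by blast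
qed

section \<open>Noetherian modules\<close>

definition noeth :: "'a ring \<Rightarrow> ('a, 'b) module \<Rightarrow> bool" where
  "noeth R M \<longleftrightarrow> left_module R M \<and> (\<forall>K. subm R M K \<longrightarrow> fg_module R (sub M K))"

text \<open>A submodule \<open>L\<close> is an extension of its image in \<open>N\<close> by its
  intersection with the kernel, and both of these are finitely generated.\<close>

lemma noeth_extension:
  assumes f: "lhom R M N f" and N: "noeth R N" and K: "noeth R (sub M (a_kernel M N f))"
  shows "noeth R M"
proof -
  interpret f: lhom R M N f by fact
  have "fg_module R (sub M L)" if L: "subm R M L" for L
  proof (rule fg_module_extension)
    show "lhom R (sub M L) (sub N (f ` L)) f"
      by (rule lhom_sub_cod[OF lhom_sub_dom[OF f L] subm_image[OF f L]]) auto
    show "fg_module R (sub N (f ` L))" using N subm_image[OF f L] by (simp add: noeth_def)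
    have "subm R (sub M (a_kernel M N f)) (a_kernel (sub M L) (sub N (f ` L)) f)"
      using L subsetD[of L "carrier M"] by (auto simp: subm_def a_kernel_def')
    then show "fg_module R (sub (sub M L) (a_kernel (sub M L) (sub N (f ` L)) f))"
      using K by (auto simp: noeth_def)
  qed auto
  then show ?thesis using f.M.left_module_axioms by (simp add: noeth_def)
qed

lemma left_module_regular: "ring R \<Longrightarrow> left_module R (regular_module R)"
proof -
  assume "ring R"
  then interpret ring R .
  show ?thesis
  proof (rule left_moduleI)
    fix x assume "x \<in> carrier (regular_module R)"
    then show "\<exists>y\<in>carrier (regular_module R). y \<oplus>\<^bsub>regular_module R\<^esub> x = \<zero>\<^bsub>regular_module R\<^esub>"
      by (intro bexI[of _ "\<ominus>\<^bsub>R\<^esub> x"]) (simp_all add: regular_module_def l_neg)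
  qed (simp_all add: regular_module_def a_assoc l_distr r_distr m_assoc ring_axioms, simp add: a_comm)
qed

lemma noeth_regular:
  assumes "ring R" "left_noetherian R"
  shows "noeth R (regular_module R)"
  using assms(2) left_module_regular[OF assms(1)] submodule_iff_subm[OF left_module_regular[OF assms(1)]]
  by (simp add: noeth_def left_noetherian_def)

lemma noeth_free:
  assumes "ring R" "left_noetherian R"
  shows "noeth R (free R n)"
proof (induction n)
  case 0
  have "fg_module R (sub (free R 0) K)" if K: "subm R (free R 0) K" for K
  proof -
    have "K = {\<zero>\<^bsub>free R 0\<^esub>}" using K by (auto simp: subm_def free_def)
    then have "gen R (sub (free R 0) K) 0 (\<lambda>_. \<zero>\<^bsub>free R 0\<^esub>)" by (simp add: gen_def)
    then show ?thesis using fg_module_iff_gen left_module_sub[OF left_module_free[OF assms(1)] K] by blast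
  qed
  then show ?case using left_module_free[OF assms(1)] by (auto simp: noeth_def)
next
  case (Suc n)
  interpret ring R by fact
  have hom: "lhom R (free R (Suc n)) (regular_module R) (\<lambda>a. a n)"
    by (rule lhomI) (auto simp: left_module_free left_module_regular assms(1), auto simp: free_def regular_module_def)
  have "carrier (free R n) = a_kernel (free R (Suc n)) (regular_module R) (\<lambda>a. a n)"
    by (auto simp: a_kernel_def' free_def regular_module_def less_Suc_eq)
      (metis le_antisym not_less_eq_eq)
  then have "sub (free R (Suc n)) (a_kernel (free R (Suc n)) (regular_module R) (\<lambda>a. a n)) = free R n"
    by (simp add: free_def flip: \<open>_ = a_kernel _ _ _\<close>)
  then show ?case using noeth_extension[OF hom noeth_regular[OF assms]] Suc by simp
qed

text \<open>A submodule of \<open>M\<close> is the image of its preimage in a free module, so the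
  free case suffices.\<close>

lemma fg_module_noeth:
  assumes "ring R" "left_noetherian R" "fg_module R M"
  shows "noeth R M"
proof -
  obtain n p where p: "lhom R (free R n) M p" "p ` carrier (free R n) = carrier M"
    using fg_module_free_surj[OF assms(3)] .
  have "fg_module R (sub M K)" if K: "subm R M K" for K
  proof (rule fg_module_surj)
    let ?L = "{a \<in> carrier (free R n). p a \<in> K}"
    have L: "subm R (free R n) ?L" by (rule subm_vimage[OF p(1) K])
    then show "fg_module R (sub (free R n) ?L)" using noeth_free[OF assms(1,2)] by (auto simp: noeth_def)
    show "lhom R (sub (free R n) ?L) (sub M K) p"
      by (intro lhom_sub_cod lhom_sub_dom L K p) auto
    have "y \<in> p ` ?L" if "y \<in> K" for y
    proof -
      have "y \<in> carrier M" using K that by (auto simp: subm_def)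
      then obtain a where "a \<in> carrier (free R n)" "p a = y" using p(2) by (metis imageE)
      with that show ?thesis by auto
    qed
    then show "p ` carrier (sub (free R n) ?L) = carrier (sub M K)" by auto
  qed
  then show ?thesis using fg_module_left_module[OF assms(3)] by (simp add: noeth_def)
qed

text \<open>A retract of a free module can be described without a type of test modules. The lifting
  property in \<open>fg_projective\<close> tests only modules over \<open>'a univ\<close>, whereas
  the lifts below also go into modules of other types.\<close>

definition proj :: "'a ring \<Rightarrow> ('a, 'b) module \<Rightarrow> bool" where
  "proj R P \<longleftrightarrow> (\<exists>n p s. lhom R (free R n) P p \<and> lhom R P (free R n) s \<and> (\<forall>x\<in>carrier P. p (s x) = x))"

lemma proj_left_module: "proj R P \<Longrightarrow> left_module R P"
  by (auto simp: proj_def lhom_iff)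

lemma proj_fg:
  assumes "proj R P"
  shows "fg_module R P"
proof -
  obtain n p s where p: "lhom R (free R n) P p" and s: "lhom R P (free R n) s"
    and ps: "\<And>x. x \<in> carrier P \<Longrightarrow> p (s x) = x"
    using assms unfolding proj_def by blast
  interpret p: lhom R "free R n" P p by fact
  interpret s: lhom R P "free R n" s by fact
  have "p ` carrier (free R n) = carrier P"
    using p.closed s.closed ps by (metis imageI subset_antisym image_subsetI subsetI)
  then show ?thesis using fg_module_surj[OF fg_module_free p] p.M.R.ring_axioms by blast
qed

text \<open>Lift the images of the unit vectors, extend linearly to \<open>free R n\<close> and
  restrict along the section \<open>s\<close>. Only the values of \<open>h\<close> have to lie in
  the image of \<open>g\<close>, so exactness can be used without first shrinking
  \<open>Y\<close>.\<close>

lemma proj_lift: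
  assumes P: "proj R P" and g: "lhom R X Y g" and h: "lhom R P Y h"
    and im: "\<And>x. x \<in> carrier P \<Longrightarrow> h x \<in> g ` carrier X"
  obtains h' where "lhom R P X h'" "\<And>x. x \<in> carrier P \<Longrightarrow> g (h' x) = h x"
proof -
  obtain n p s where p: "lhom R (free R n) P p" and s: "lhom R P (free R n) s"
    and ps: "\<And>x. x \<in> carrier P \<Longrightarrow> p (s x) = x"
    using P unfolding proj_def by blast
  interpret p: lhom R "free R n" P p by fact
  interpret s: lhom R P "free R n" s by fact
  interpret g: lhom R X Y g by fact
  interpret hp: lhom R "free R n" Y "\<lambda>a. h (p a)" by (rule lhom_comp[OF p h])
  have e: "unit_vec R i \<in> carrier (free R n)" if "i < n" for i
    using that unit_vec_closed p.M.R.ring_axioms by blast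
  have "\<forall>i<n. \<exists>x\<in>carrier X. g x = h (p (unit_vec R i))" using im e p.closed by (metis imageE)
  then obtain x where x: "\<And>i. i < n \<Longrightarrow> x i \<in> carrier X" "\<And>i. i < n \<Longrightarrow> g (x i) = h (p (unit_vec R i))"
    by metis
  have L: "lhom R (free R n) X (\<lambda>a. lc X n a x)" using lhom_lc[OF g.M.left_module_axioms] x(1) by blast
  have "g (lc X n (s y) x) = h y" if y: "y \<in> carrier P" for y
  proof -
    have sy: "s y \<in> carrier (free R n)" using y by simp
    then have sR: "s y i \<in> carrier R" if "i < n" for i using that by (auto simp: free_def)
    have "g (lc X n (s y) x) = lc Y n (s y) (\<lambda>i. g (x i))" using g.lc x(1) sR by blast
    also have "\<dots> = lc Y n (s y) (\<lambda>i. h (p (unit_vec R i)))" using x(2) by (intro lc_cong) auto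
    also have "\<dots> = h (p (lc (free R n) n (s y) (unit_vec R)))" using hp.lc e sR by metis
    also have "\<dots> = h y" using lc_unit_vec[OF p.M.R.ring_axioms sy] ps y by simp
    finally show ?thesis .
  qed
  with lhom_comp[OF s L] that show ?thesis by blast
qed

lemma proj_retract:
  assumes "proj R P" "lhom R P Q p" "lhom R Q P s" "\<And>x. x \<in> carrier Q \<Longrightarrow> p (s x) = x"
  shows "proj R Q"
proof -
  obtain n q t where q: "lhom R (free R n) P q" and t: "lhom R P (free R n) t"
    and qt: "\<And>x. x \<in> carrier P \<Longrightarrow> q (t x) = x"
    using assms(1) unfolding proj_def by blast
  interpret s: lhom R Q P s by fact
  have "p (q (t (s x))) = x" if "x \<in> carrier Q" for x using that qt assms(4) by simp
  then show ?thesis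
    using lhom_comp[OF q assms(2)] lhom_comp[OF assms(3) t] unfolding proj_def by blast
qed

lemma proj_iso:
  assumes "proj R P" "lhom R P Q \<phi>" "bij_betw \<phi> (carrier P) (carrier Q)"
  shows "proj R Q"
proof -
  obtain g where "lhom R Q P g" "\<And>y. y \<in> carrier Q \<Longrightarrow> g y \<in> carrier P \<and> \<phi> (g y) = y"
    using lhom_inv[OF assms(2,3)] by metis
  then show ?thesis using proj_retract[OF assms(1,2)] by blast
qed

lemma proj_free: "ring R \<Longrightarrow> proj R (free R n)"
  unfolding proj_def using lhom_id[OF left_module_free]
  by (intro exI[of _ n] exI[of _ "\<lambda>x. x"]) simp

lemma projI:
  assumes "fg_module R P"
    and "\<And>n p. \<lbrakk>lhom R (free R n) P p; p ` carrier (free R n) = carrier P\<rbrakk> \<Longrightarrow>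
      \<exists>s. lhom R P (free R n) s \<and> (\<forall>x\<in>carrier P. p (s x) = x)"
  shows "proj R P"
proof -
  obtain n p where p: "lhom R (free R n) P p" "p ` carrier (free R n) = carrier P"
    using fg_module_free_surj[OF assms(1)] .
  from assms(2)[OF p] obtain s where "lhom R P (free R n) s" "\<forall>x\<in>carrier P. p (s x) = x" by blast
  with p(1) show ?thesis unfolding proj_def by (intro exI conjI)
qed

lemma fg_projective_iff_proj: "fg_projective R P \<longleftrightarrow> proj R P"
proof
  assume P: "fg_projective R P"
  then have fg: "fg_module R P" by (simp add: fg_projective_def)
  show "proj R P"
  proof (rule projI[OF fg])
    fix n p assume p: "lhom R (free R n) P p" "p ` carrier (free R n) = carrier P"
    then interpret p: lhom R "free R n" P p by simp
    \<comment> \<open>The surjection \<open>p\<close> is carried to copies \<open>X\<close> and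
      \<open>Y\<close> over \<open>'a univ\<close>, where the lifting property applies. Lifting
      \<open>\<eta>\<close>, which is the identity of \<open>P\<close> in disguise, produces the
      section.\<close>
    obtain X :: "('a, 'a univ) module" and \<xi>
      where \<xi>: "lhom R X (free R n) \<xi>" "bij_betw \<xi> (carrier X) (carrier (free R n))"
      using univ_copy_inv[OF fg_module_free[OF p.M.R.ring_axioms]] .
    obtain Y :: "('a, 'a univ) module" and \<eta>
      where Y: "lhom R P Y \<eta>" "bij_betw \<eta> (carrier P) (carrier Y)"
      using univ_copy[OF fg] .
    have g: "lhom R X Y (\<lambda>x. \<eta> (p (\<xi> x)))" using lhom_comp[OF lhom_comp[OF \<xi>(1) p(1)] Y(1)] .
    have "(\<lambda>x. \<eta> (p (\<xi> x))) ` carrier X = \<eta> ` p ` \<xi> ` carrier X" by (simp add: image_image)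
    also have "\<dots> = carrier Y" by (simp only: p(2) bij_betw_imp_surj_on[OF \<xi>(2)] bij_betw_imp_surj_on[OF Y(2)])
    finally have "(\<lambda>x. \<eta> (p (\<xi> x))) ` carrier X = carrier Y" .
    then have "\<exists>h\<in>mod_hom R P X. \<forall>x\<in>carrier P. \<eta> (p (\<xi> (h x))) = \<eta> x"
      using P[unfolded fg_projective_def, THEN conjunct2, rule_format, of X Y "\<lambda>x. \<eta> (p (\<xi> x))" \<eta>]
        g Y(1) by (simp add: lhom_iff)
    then obtain h where h: "h \<in> mod_hom R P X" "\<forall>x\<in>carrier P. \<eta> (p (\<xi> (h x))) = \<eta> x" by blast
    then have hh: "lhom R P X h" using lhom_modules[OF \<xi>(1)] fg_module_left_module[OF fg] by (simp add: lhom_iff)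
    interpret h: lhom R P X h by fact
    have "p (\<xi> (h x)) = x" if "x \<in> carrier P" for x
    proof -
      have "p (\<xi> (h x)) \<in> carrier P" using that by (simp add: lhom.closed[OF \<xi>(1)])
      then show ?thesis using h(2) that Y(2) by (metis bij_betw_imp_inj_on inj_onD)
    qed
    then show "\<exists>s. lhom R P (free R n) s \<and> (\<forall>x\<in>carrier P. p (s x) = x)"
      using lhom_comp[OF hh \<xi>(1)] by blast
  qed
next
  assume P: "proj R P"
  show "fg_projective R P"
    unfolding fg_projective_def
  proof (intro conjI allI impI proj_fg[OF P], elim conjE)
    fix X Y :: "('a, 'a univ) module" and g h
    assume a: "left_module R X" "left_module R Y" "g \<in> mod_hom R X Y" "g ` carrier X = carrier Y"
      "h \<in> mod_hom R P Y"
    then have g: "lhom R X Y g" and h: "lhom R P Y h" using proj_left_module[OF P] by (auto simp: lhom_iff)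
    have "h x \<in> g ` carrier X" if "x \<in> carrier P" for x using lhom.closed[OF h that] a(4) by simp
    from proj_lift[OF P g h this] obtain h' where "lhom R P X h'" "\<And>x. x \<in> carrier P \<Longrightarrow> g (h' x) = h x"
      by blast
    then show "\<exists>h'\<in>mod_hom R P X. \<forall>x\<in>carrier P. g (h' x) = h x" by (auto simp: lhom_iff)
  qed
qed

lemma fg_module_dsum:
  assumes "fg_module R M" "fg_module R N"
  shows "fg_module R (dsum M N)"
proof -
  have lM: "left_module R M" and lN: "left_module R N" using assms by (auto simp: fg_module_def)
  interpret M: left_module R M by fact
  interpret N: left_module R N by fact
  let ?K = "a_kernel (dsum M N) N snd"
  have K: "?K = carrier M \<times> {\<zero>\<^bsub>N\<^esub>}" by (auto simp: a_kernel_def')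
  have i: "lhom R M (dsum M N) (\<lambda>x. (x, \<zero>\<^bsub>N\<^esub>))"
    by (intro lhom_pair lhom_id lhom_zero lM lN)
  have iK: "lhom R M (sub (dsum M N) ?K) (\<lambda>x. (x, \<zero>\<^bsub>N\<^esub>))"
    by (rule lhom_sub_cod[OF i subm_kernel[OF lhom_snd[OF lM lN]]]) (simp add: K)
  have "fg_module R (sub (dsum M N) ?K)"
    by (rule fg_module_surj[OF assms(1) iK]) (auto simp: K)
  moreover have "snd ` carrier (dsum M N) = carrier N" by force
  ultimately show ?thesis using fg_module_extension[OF lhom_snd[OF lM lN] _ assms(2)] by blast
qed

text \<open>A surjection onto the sum splits because it splits over each summand. In this way two
  free modules never have to be combined into one.\<close>

lemma proj_dsum:
  assumes P: "proj R P" and Q: "proj R Q"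
  shows "proj R (dsum P Q)"
proof (rule projI[OF fg_module_dsum[OF proj_fg[OF P] proj_fg[OF Q]]])
  fix n p assume p: "lhom R (free R n) (dsum P Q) p" "p ` carrier (free R n) = carrier (dsum P Q)"
  note lP = proj_left_module[OF P] and lQ = proj_left_module[OF Q]
  interpret P: left_module R P by fact
  interpret Q: left_module R Q by fact
  obtain s where s: "lhom R P (free R n) s" "\<And>x. x \<in> carrier P \<Longrightarrow> p (s x) = (x, \<zero>\<^bsub>Q\<^esub>)"
    using proj_lift[OF P p(1) lhom_pair[OF lhom_id[OF lP] lhom_zero[OF lP lQ]]] p(2) by auto
  obtain t where t: "lhom R Q (free R n) t" "\<And>x. x \<in> carrier Q \<Longrightarrow> p (t x) = (\<zero>\<^bsub>P\<^esub>, x)"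
    using proj_lift[OF Q p(1) lhom_pair[OF lhom_zero[OF lQ lP] lhom_id[OF lQ]]] p(2) by auto
  interpret p: lhom R "free R n" "dsum P Q" p by fact
  have "p (s (fst x) \<oplus>\<^bsub>free R n\<^esub> t (snd x)) = x" if "x \<in> carrier (dsum P Q)" for x
    using that lhom.closed[OF s(1)] lhom.closed[OF t(1)] s(2) t(2) by auto
  then show "\<exists>s. lhom R (dsum P Q) (free R n) s \<and> (\<forall>x\<in>carrier (dsum P Q). p (s x) = x)"
    using lhom_copair[OF s(1) t(1)] by blast
qed

section \<open>Duals and quotients\<close>

lemma opp_ring_simps [simp]:
  "carrier (opp_ring R) = carrier R" "\<zero>\<^bsub>opp_ring R\<^esub> = \<zero>\<^bsub>R\<^esub>" "\<one>\<^bsub>opp_ring R\<^esub> = \<one>\<^bsub>R\<^esub>"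
  "x \<oplus>\<^bsub>opp_ring R\<^esub> y = x \<oplus>\<^bsub>R\<^esub> y" "x \<otimes>\<^bsub>opp_ring R\<^esub> y = y \<otimes>\<^bsub>R\<^esub> x" "opp_ring (opp_ring R) = R"
  by (simp_all add: opp_ring_def)

lemma ring_opp_ring:
  assumes "ring R"
  shows "ring (opp_ring R)"
proof -
  interpret ring R by fact
  show ?thesis
  proof (intro ringI abelian_groupI monoidI)
    fix x assume "x \<in> carrier (opp_ring R)"
    then show "\<exists>y\<in>carrier (opp_ring R). y \<oplus>\<^bsub>opp_ring R\<^esub> x = \<zero>\<^bsub>opp_ring R\<^esub>"
      by (intro bexI[of _ "\<ominus>\<^bsub>R\<^esub> x"]) (simp_all add: l_neg)
  qed (simp_all add: a_assoc m_assoc l_distr r_distr, simp add: a_comm)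
qed

lemma regular_module_simps [simp]:
  "carrier (regular_module R) = carrier R" "\<zero>\<^bsub>regular_module R\<^esub> = \<zero>\<^bsub>R\<^esub>"
  "x \<oplus>\<^bsub>regular_module R\<^esub> y = x \<oplus>\<^bsub>R\<^esub> y" "x \<odot>\<^bsub>regular_module R\<^esub> y = x \<otimes>\<^bsub>R\<^esub> y"
  by (simp_all add: regular_module_def)

lemma dual_simps:
  "\<zero>\<^bsub>dual R M\<^esub> = (\<lambda>x\<in>carrier M. \<zero>\<^bsub>R\<^esub>)"
  "\<phi> \<oplus>\<^bsub>dual R M\<^esub> \<psi> = (\<lambda>x\<in>carrier M. \<phi> x \<oplus>\<^bsub>R\<^esub> \<psi> x)"
  "a \<odot>\<^bsub>dual R M\<^esub> \<phi> = (\<lambda>x\<in>carrier M. \<phi> x \<otimes>\<^bsub>R\<^esub> a)"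
  by (simp_all add: dual_def)

lemma dual_apply [simp]:
  assumes "x \<in> carrier M"
  shows "\<zero>\<^bsub>dual R M\<^esub> x = \<zero>\<^bsub>R\<^esub>" "(\<phi> \<oplus>\<^bsub>dual R M\<^esub> \<psi>) x = \<phi> x \<oplus>\<^bsub>R\<^esub> \<psi> x"
    "(a \<odot>\<^bsub>dual R M\<^esub> \<phi>) x = \<phi> x \<otimes>\<^bsub>R\<^esub> a"
  using assms by (simp_all add: dual_simps)

lemma dual_carrier_iff:
  assumes "left_module R M"
  shows "\<phi> \<in> carrier (dual R M) \<longleftrightarrow> lhom R M (regular_module R) \<phi> \<and> \<phi> \<in> extensional (carrier M)"
  using assms left_module_regular[of R] left_module.axioms(1)[OF assms]
  by (auto simp: lhom_iff dual_def)

lemma dual_lhom: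
  assumes "left_module R M" "\<phi> \<in> carrier (dual R M)"
  shows "lhom R M (regular_module R) \<phi>"
  using assms dual_carrier_iff by blast

lemma dual_ext:
  assumes "\<phi> \<in> carrier (dual R M)" "\<psi> \<in> carrier (dual R M)" "\<And>x. x \<in> carrier M \<Longrightarrow> \<phi> x = \<psi> x"
  shows "\<phi> = \<psi>"
proof (rule extensionalityI[of _ "carrier M"])
  show "\<phi> \<in> extensional (carrier M)" "\<psi> \<in> extensional (carrier M)"
    using assms by (simp_all add: dual_def)
qed (rule assms(3))

lemma restrict_dual:
  assumes "lhom R M (regular_module R) \<phi>"
  shows "restrict \<phi> (carrier M) \<in> carrier (dual R M)"
  unfolding dual_carrier_iff[OF lhom_modules(1)[OF assms]]
  using lhom_cong[OF assms, of "restrict \<phi> (carrier M)"] by simp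

lemma left_module_dual:
  assumes M: "left_module R M"
  shows "left_module (opp_ring R) (dual R M)"
proof -
  interpret M: left_module R M by fact
  have reg: "left_module R (regular_module R)" by (rule left_module_regular[OF M.R.ring_axioms])
  have cl [simp]: "\<phi> x \<in> carrier R" if "\<phi> \<in> carrier (dual R M)" "x \<in> carrier M" for \<phi> x
    using lhom.closed[OF dual_lhom[OF M that(1)] that(2)] by simp
  have addc: "\<phi> \<oplus>\<^bsub>dual R M\<^esub> \<psi> \<in> carrier (dual R M)"
    if "\<phi> \<in> carrier (dual R M)" "\<psi> \<in> carrier (dual R M)" for \<phi> \<psi>
    using restrict_dual[OF lhom_add[OF dual_lhom[OF M that(1)] dual_lhom[OF M that(2)]]]
    by (simp add: dual_simps)
  have zeroc: "\<zero>\<^bsub>dual R M\<^esub> \<in> carrier (dual R M)"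
    using restrict_dual[OF lhom_zero[OF M reg]] by (simp add: dual_simps)
  have smc: "a \<odot>\<^bsub>dual R M\<^esub> \<phi> \<in> carrier (dual R M)"
    if a: "a \<in> carrier R" and \<phi>: "\<phi> \<in> carrier (dual R M)" for a \<phi>
  proof -
    interpret \<phi>: lhom R M "regular_module R" \<phi> by (rule dual_lhom[OF M \<phi>])
    have "lhom R M (regular_module R) (\<lambda>x. \<phi> x \<otimes>\<^bsub>R\<^esub> a)"
      by (rule lhomI[OF M reg]) (use a \<phi> in \<open>simp_all add: M.R.l_distr M.R.m_assoc\<close>)
    then show ?thesis using restrict_dual by (simp add: dual_simps)
  qed
  show ?thesis
  proof (rule left_moduleI)
    fix \<phi> assume \<phi>: "\<phi> \<in> carrier (dual R M)"
    \<comment> \<open>The negative is written as zero minus \<open>\<phi>\<close>, so that its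
      linearity comes from \<open>lhom_diff\<close>.\<close>
    let ?n = "\<lambda>x\<in>carrier M. \<zero>\<^bsub>R\<^esub> \<ominus>\<^bsub>R\<^esub> \<phi> x"
    have n: "?n \<in> carrier (dual R M)"
    proof -
      have "lhom R M (regular_module R) (\<lambda>x. \<zero>\<^bsub>regular_module R\<^esub> \<ominus>\<^bsub>regular_module R\<^esub> \<phi> x)"
        by (rule lhom_diff[OF lhom_zero[OF M reg] dual_lhom[OF M \<phi>]])
      moreover have "a_inv (regular_module R) = a_inv R"
        by (simp add: a_inv_def m_inv_def regular_module_def fun_eq_iff)
      ultimately show ?thesis using restrict_dual by (fastforce simp: a_minus_def)
    qed
    then show "\<exists>y\<in>carrier (dual R M). y \<oplus>\<^bsub>dual R M\<^esub> \<phi> = \<zero>\<^bsub>dual R M\<^esub>"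
      by (intro bexI[OF _ n] dual_ext[OF addc[OF n \<phi>] zeroc])
        (use \<phi> in \<open>simp add: a_minus_def M.R.l_neg\<close>)
  next
    fix \<phi> assume "\<phi> \<in> carrier (dual R M)"
    then show "\<one>\<^bsub>opp_ring R\<^esub> \<odot>\<^bsub>dual R M\<^esub> \<phi> = \<phi>" "\<zero>\<^bsub>dual R M\<^esub> \<oplus>\<^bsub>dual R M\<^esub> \<phi> = \<phi>"
      by (intro dual_ext[of _ R M]; simp add: smc addc zeroc)+
  qed (rule dual_ext[of _ R M] | simp add: addc zeroc smc M.R.a_assoc M.R.l_distr M.R.r_distr M.R.m_assoc
      ring_opp_ring M.R.ring_axioms | simp add: M.R.a_comm)+
qed

lemma lhom_dual_map:
  assumes f: "lhom R M N f"
  shows "lhom (opp_ring R) (dual R N) (dual R M) (dual_map M f)"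
proof -
  interpret f: lhom R M N f by fact
  note M = f.M.left_module_axioms and N = f.N.left_module_axioms
  have mem: "dual_map M f \<phi> \<in> carrier (dual R M)" if "\<phi> \<in> carrier (dual R N)" for \<phi>
    using restrict_dual[OF lhom_comp[OF f dual_lhom[OF N that]]] by (simp add: dual_map_def compose_def)
  interpret DM: left_module "opp_ring R" "dual R M" by (rule left_module_dual[OF M])
  interpret DN: left_module "opp_ring R" "dual R N" by (rule left_module_dual[OF N])
  show ?thesis
  proof (rule lhomI)
    show "left_module (opp_ring R) (dual R N)" "left_module (opp_ring R) (dual R M)"
      by (rule DN.left_module_axioms DM.left_module_axioms)+
    fix \<phi> \<psi> assume a: "\<phi> \<in> carrier (dual R N)" "\<psi> \<in> carrier (dual R N)"
    have "dual_map M f (\<phi> \<oplus>\<^bsub>dual R N\<^esub> \<psi>) x = (dual_map M f \<phi> \<oplus>\<^bsub>dual R M\<^esub> dual_map M f \<psi>) x"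
      if "x \<in> carrier M" for x using that by (simp add: dual_map_def compose_def)
    then show "dual_map M f (\<phi> \<oplus>\<^bsub>dual R N\<^esub> \<psi>) = dual_map M f \<phi> \<oplus>\<^bsub>dual R M\<^esub> dual_map M f \<psi>"
      by (intro dual_ext[OF mem[OF DN.M.a_closed[OF a]] DM.M.a_closed[OF mem[OF a(1)] mem[OF a(2)]]])
  next
    fix c \<phi> assume a: "c \<in> carrier (opp_ring R)" "\<phi> \<in> carrier (dual R N)"
    have "dual_map M f (c \<odot>\<^bsub>dual R N\<^esub> \<phi>) x = (c \<odot>\<^bsub>dual R M\<^esub> dual_map M f \<phi>) x"
      if "x \<in> carrier M" for x using that by (simp add: dual_map_def compose_def)
    then show "dual_map M f (c \<odot>\<^bsub>dual R N\<^esub> \<phi>) = c \<odot>\<^bsub>dual R M\<^esub> dual_map M f \<phi>"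
      by (intro dual_ext[OF mem[OF DN.smult_closed[OF a]] DM.smult_closed[OF a(1) mem[OF a(2)]]])
  qed (rule mem)
qed

lemma dual_map_apply [simp]: "x \<in> carrier M \<Longrightarrow> dual_map M f \<phi> x = \<phi> (f x)"
  by (simp add: dual_map_def compose_def)

section \<open>Dual bases and reflexivity\<close>

definition dual_basis :: "'a ring \<Rightarrow> ('a, 'b) module \<Rightarrow> nat \<Rightarrow> (nat \<Rightarrow> 'b) \<Rightarrow> (nat \<Rightarrow> 'b \<Rightarrow> 'a) \<Rightarrow> bool" where
  "dual_basis R P n x \<phi> \<longleftrightarrow> (\<forall>i<n. x i \<in> carrier P \<and> \<phi> i \<in> carrier (dual R P)) \<and>
     (\<forall>y\<in>carrier P. lc P n (\<lambda>i. \<phi> i y) x = y)"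

text \<open>The \<open>x i\<close> are the images of the unit vectors under \<open>p\<close>, the
  \<open>\<phi> i\<close> are the coordinates of \<open>s\<close>. This description of projectivity
  is the one that passes to the dual, by exchanging vectors and functionals.\<close>

lemma proj_iff_dual_basis: "proj R P \<longleftrightarrow> left_module R P \<and> (\<exists>n x \<phi>. dual_basis R P n x \<phi>)"
proof
  assume P: "proj R P"
  then obtain n p s where p: "lhom R (free R n) P p" and s: "lhom R P (free R n) s"
    and ps: "\<And>x. x \<in> carrier P \<Longrightarrow> p (s x) = x"
    unfolding proj_def by blast
  interpret p: lhom R "free R n" P p by fact
  interpret s: lhom R P "free R n" s by fact
  have e: "unit_vec R i \<in> carrier (free R n)" if "i < n" for i
    using that unit_vec_closed p.M.R.ring_axioms by blast
  have sR: "s y i \<in> carrier R" if "i < n" "y \<in> carrier P" for i y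
    using s.closed[OF that(2)] that(1) by (simp add: free_def)
  have co: "lhom R P (regular_module R) (\<lambda>y. s y i)" if "i < n" for i
    by (rule lhomI[OF p.N.left_module_axioms left_module_regular[OF p.M.R.ring_axioms]])
      (use that sR in \<open>simp_all, simp_all add: free_def\<close>)
  have "dual_basis R P n (\<lambda>i. p (unit_vec R i)) (\<lambda>i. restrict (\<lambda>y. s y i) (carrier P))"
    unfolding dual_basis_def
  proof (intro conjI allI impI ballI)
    fix y assume y: "y \<in> carrier P"
    have "lc P n (\<lambda>i. restrict (\<lambda>y. s y i) (carrier P) y) (\<lambda>i. p (unit_vec R i))
        = lc P n (s y) (\<lambda>i. p (unit_vec R i))"
      by (rule lc_cong) (simp_all add: y)
    also have "\<dots> = p (lc (free R n) n (s y) (unit_vec R))"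
      by (rule p.lc[symmetric]) (simp_all add: sR y e)
    also have "\<dots> = y" by (simp add: lc_unit_vec[OF p.M.R.ring_axioms] y ps)
    finally show "lc P n (\<lambda>i. restrict (\<lambda>y. s y i) (carrier P) y) (\<lambda>i. p (unit_vec R i)) = y" .
  qed (simp_all add: e restrict_dual[OF co])
  then show "left_module R P \<and> (\<exists>n x \<phi>. dual_basis R P n x \<phi>)"
    using p.N.left_module_axioms by blast
next
  assume "left_module R P \<and> (\<exists>n x \<phi>. dual_basis R P n x \<phi>)"
  then obtain n x \<phi> where P: "left_module R P" and b: "dual_basis R P n x \<phi>" by blast
  interpret P: left_module R P by fact
  have x: "x i \<in> carrier P" and \<phi>: "\<phi> i \<in> carrier (dual R P)" if "i < n" for i
    using b that by (auto simp: dual_basis_def)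
  define s where "s y = (\<lambda>i. if i < n then \<phi> i y else \<zero>\<^bsub>R\<^esub>)" for y
  have \<phi>R: "\<phi> i y \<in> carrier R" if "i < n" "y \<in> carrier P" for i y
    using lhom.closed[OF dual_lhom[OF P \<phi>[OF that(1)]] that(2)] by simp
  have s: "lhom R P (free R n) s"
  proof (rule lhomI[OF P left_module_free[OF P.R.ring_axioms]])
    show "s y \<in> carrier (free R n)" if "y \<in> carrier P" for y
      using that by (simp add: s_def free_def \<phi>R)
    show "s (y \<oplus>\<^bsub>P\<^esub> z) = s y \<oplus>\<^bsub>free R n\<^esub> s z" if "y \<in> carrier P" "z \<in> carrier P" for y z
      using that lhom.add[OF dual_lhom[OF P \<phi>]] by (simp add: s_def free_def fun_eq_iff)
    show "s (a \<odot>\<^bsub>P\<^esub> y) = a \<odot>\<^bsub>free R n\<^esub> s y" if "a \<in> carrier R" "y \<in> carrier P" for a y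
      using that lhom.smult[OF dual_lhom[OF P \<phi>]] by (simp add: s_def free_def fun_eq_iff)
  qed
  have "lc P n (s y) x = y" if "y \<in> carrier P" for y
  proof -
    have "lc P n (s y) x = lc P n (\<lambda>i. \<phi> i y) x" by (rule lc_cong) (simp_all add: s_def)
    then show ?thesis using b that by (simp add: dual_basis_def)
  qed
  then show "proj R P" unfolding proj_def using s lhom_lc[OF P, of n x] x by blast
qed

lemma lc_dual_apply:
  assumes "y \<in> carrier P"
  shows "lc (dual R P) n a \<phi> y = lc (regular_module R) n (\<lambda>i. \<phi> i y) a"
  using assms by (induction n) auto

lemma lc_regular_opp: "lc (regular_module (opp_ring R)) n a b = lc (regular_module R) n b a"
  by (induction n) auto

text \<open>The canonical map into the double dual, restricted because functionals are extensional.
  The double dual is a module over \<open>R\<close> itself, as \<open>opp_ring\<close> is an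
  involution.\<close>

definition ev :: "'a ring \<Rightarrow> ('a, 'b) module \<Rightarrow> 'b \<Rightarrow> ('b \<Rightarrow> 'a) \<Rightarrow> 'a" where
  "ev R M y = (\<lambda>\<phi>\<in>carrier (dual R M). \<phi> y)"

lemma lhom_ev:
  assumes M: "left_module R M"
  shows "lhom R M (dual (opp_ring R) (dual R M)) (ev R M)"
proof -
  interpret M: left_module R M by fact
  let ?DD = "dual (opp_ring R) (dual R M)"
  note D = left_module_dual[OF M]
  interpret D: left_module "opp_ring R" "dual R M" by fact
  interpret DD: left_module R ?DD using left_module_dual[OF D] by simp
  have reg: "left_module (opp_ring R) (regular_module (opp_ring R))"
    by (rule left_module_regular[OF ring_opp_ring[OF M.R.ring_axioms]])
  have mem: "ev R M y \<in> carrier ?DD" if y: "y \<in> carrier M" for y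
  proof -
    have "lhom (opp_ring R) (dual R M) (regular_module (opp_ring R)) (\<lambda>\<phi>. \<phi> y)"
      by (rule lhomI[OF D reg]) (use y lhom.closed[OF dual_lhom[OF M] y] in simp_all)
    then show ?thesis unfolding ev_def by (rule restrict_dual)
  qed
  show ?thesis
  proof (rule lhomI[OF M])
    fix x y assume a: "x \<in> carrier M" "y \<in> carrier M"
    show "ev R M (x \<oplus>\<^bsub>M\<^esub> y) = ev R M x \<oplus>\<^bsub>?DD\<^esub> ev R M y"
      by (rule dual_ext[OF mem DD.M.a_closed]) (use a mem lhom.add[OF dual_lhom[OF M]] in \<open>simp_all add: ev_def\<close>)
  next
    fix c x assume a: "c \<in> carrier R" "x \<in> carrier M"
    show "ev R M (c \<odot>\<^bsub>M\<^esub> x) = c \<odot>\<^bsub>?DD\<^esub> ev R M x"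
      by (rule dual_ext[OF mem DD.smult_closed]) (use a mem lhom.smult[OF dual_lhom[OF M]] in \<open>simp_all add: ev_def\<close>)
  qed (auto intro: mem DD.left_module_axioms)
qed

lemma ev_apply [simp]: "\<phi> \<in> carrier (dual R M) \<Longrightarrow> ev R M y \<phi> = \<phi> y"
  by (simp add: ev_def)

text \<open>Applying \<open>\<psi>\<close> to the expansion of \<open>y\<close> exhibits
  \<open>\<psi>\<close> as a combination of the \<open>\<phi> i\<close> with coefficients
  \<open>\<psi> (x i)\<close>, which act on the right as they should over the opposite ring.\<close>

lemma dual_basis_dual:
  assumes P: "left_module R P" and b: "dual_basis R P n x \<phi>"
  shows "dual_basis (opp_ring R) (dual R P) n \<phi> (\<lambda>i. ev R P (x i))"
proof -
  have x: "x i \<in> carrier P" and \<phi>: "\<phi> i \<in> carrier (dual R P)" if "i < n" for i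
    using b that by (auto simp: dual_basis_def)
  have \<phi>R: "\<phi> i y \<in> carrier R" if "i < n" "y \<in> carrier P" for i y
    using lhom.closed[OF dual_lhom[OF P \<phi>[OF that(1)]] that(2)] by simp
  interpret P: left_module R P by fact
  interpret D: left_module "opp_ring R" "dual R P" by (rule left_module_dual[OF P])
  have "lc (dual R P) n (\<lambda>i. ev R P (x i) \<psi>) \<phi> = \<psi>" if \<psi>: "\<psi> \<in> carrier (dual R P)" for \<psi>
  proof (rule dual_ext[OF D.lc_closed \<psi>])
    interpret \<psi>: lhom R P "regular_module R" \<psi> by (rule dual_lhom[OF P \<psi>])
    show "ev R P (x i) \<psi> \<in> carrier (opp_ring R)" if "i < n" for i
      using \<psi>.closed[OF x[OF that]] \<psi> by simp
    fix y assume y: "y \<in> carrier P"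
    have "lc (dual R P) n (\<lambda>i. ev R P (x i) \<psi>) \<phi> y = lc (regular_module R) n (\<lambda>i. \<phi> i y) (\<lambda>i. \<psi> (x i))"
      using \<psi> by (simp add: lc_dual_apply[OF y])
    also have "\<dots> = \<psi> (lc P n (\<lambda>i. \<phi> i y) x)"
      by (rule \<psi>.lc[symmetric]) (simp_all add: \<phi>R x y)
    also have "\<dots> = \<psi> y" using b y by (simp add: dual_basis_def)
    finally show "lc (dual R P) n (\<lambda>i. ev R P (x i) \<psi>) \<phi> y = \<psi> y" .
  qed (rule \<phi>)
  then show ?thesis
    unfolding dual_basis_def using \<phi> x lhom.closed[OF lhom_ev[OF P]] by simp
qed

lemma proj_dual: "proj R P \<Longrightarrow> proj (opp_ring R) (dual R P)"
  unfolding proj_iff_dual_basis using dual_basis_dual left_module_dual by blast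

lemma ev_bij:
  assumes "proj R P"
  shows "bij_betw (ev R P) (carrier P) (carrier (dual (opp_ring R) (dual R P)))"
proof -
  obtain n x \<phi> where P: "left_module R P" and b: "dual_basis R P n x \<phi>"
    using assms proj_iff_dual_basis by blast
  have x: "x i \<in> carrier P" and \<phi>: "\<phi> i \<in> carrier (dual R P)" if "i < n" for i
    using b that by (auto simp: dual_basis_def)
  interpret P: left_module R P by fact
  note D = left_module_dual[OF P]
  interpret e: lhom R P "dual (opp_ring R) (dual R P)" "ev R P" by (rule lhom_ev[OF P])
  have "y = \<zero>\<^bsub>P\<^esub>" if y: "y \<in> carrier P" "ev R P y = \<zero>\<^bsub>dual (opp_ring R) (dual R P)\<^esub>" for y
  proof -
    have "\<phi> i y = \<zero>\<^bsub>R\<^esub>" if "i < n" for i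
    proof -
      have "\<phi> i y = ev R P y (\<phi> i)" using \<phi>[OF that] by simp
      also have "\<dots> = \<zero>\<^bsub>R\<^esub>" unfolding y(2) using \<phi>[OF that] by simp
      finally show ?thesis .
    qed
    then have "lc P n (\<lambda>i. \<phi> i y) x = \<zero>\<^bsub>P\<^esub>" using x by (intro P.lc_zero) auto
    then show ?thesis using b y(1) by (simp add: dual_basis_def)
  qed
  then have "inj_on (ev R P) (carrier P)" using inj_on_lhom_iff[OF e.lhom_axioms] by blast
  moreover have "\<Phi> \<in> ev R P ` carrier P" if \<Phi>: "\<Phi> \<in> carrier (dual (opp_ring R) (dual R P))" for \<Phi>
  proof
    interpret \<Phi>: lhom "opp_ring R" "dual R P" "regular_module (opp_ring R)" \<Phi> by (rule dual_lhom[OF D \<Phi>])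
    have \<Phi>R: "\<Phi> (\<phi> i) \<in> carrier R" if "i < n" for i using \<Phi>.closed[OF \<phi>[OF that]] by simp
    \<comment> \<open>\<open>\<Phi>\<close> is determined by its values on the
      \<open>\<phi> i\<close>, so the vector with these values as coefficients is the candidate for
      a preimage.\<close>
    let ?p = "lc P n (\<lambda>i. \<Phi> (\<phi> i)) x"
    show p: "?p \<in> carrier P" by (rule P.lc_closed) (simp_all add: \<Phi>R x)
    show "\<Phi> = ev R P ?p"
    proof (rule dual_ext[OF \<Phi> e.closed[OF p]])
      fix \<psi> assume \<psi>: "\<psi> \<in> carrier (dual R P)"
      interpret \<psi>: lhom R P "regular_module R" \<psi> by (rule dual_lhom[OF P \<psi>])
      have \<psi>R: "\<psi> (x i) \<in> carrier R" if "i < n" for i using \<psi>.closed[OF x[OF that]] by simp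
      have "\<psi> = lc (dual R P) n (\<lambda>i. \<psi> (x i)) \<phi>"
        using dual_basis_dual[OF P b] \<psi> by (simp add: dual_basis_def)
      then have "\<Phi> \<psi> = \<Phi> (lc (dual R P) n (\<lambda>i. \<psi> (x i)) \<phi>)" by simp
      also have "\<dots> = lc (regular_module (opp_ring R)) n (\<lambda>i. \<psi> (x i)) (\<lambda>i. \<Phi> (\<phi> i))"
        by (rule \<Phi>.lc) (simp_all add: \<psi>R \<phi>)
      also have "\<dots> = \<psi> ?p" unfolding lc_regular_opp
        by (rule \<psi>.lc[symmetric]) (simp_all add: \<Phi>R x)
      finally show "\<Phi> \<psi> = ev R P ?p \<psi>" using \<psi> by simp
    qed
  qed
  ultimately show ?thesis using e.closed unfolding bij_betw_def by blast
qed

text \<open>All laws are carried over along the surjection \<open>q\<close>, so the target need not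
  be known to be a module beforehand. This is how quotients obtain their structure.\<close>

lemma left_module_image:
  assumes M: "left_module R M" and q: "q ` carrier M = carrier Q"
    and add: "\<And>x y. \<lbrakk>x \<in> carrier M; y \<in> carrier M\<rbrakk> \<Longrightarrow> q x \<oplus>\<^bsub>Q\<^esub> q y = q (x \<oplus>\<^bsub>M\<^esub> y)"
    and smult: "\<And>a x. \<lbrakk>a \<in> carrier R; x \<in> carrier M\<rbrakk> \<Longrightarrow> a \<odot>\<^bsub>Q\<^esub> q x = q (a \<odot>\<^bsub>M\<^esub> x)"
    and zero: "\<zero>\<^bsub>Q\<^esub> = q \<zero>\<^bsub>M\<^esub>"
  shows "lhom R M Q q"
proof -
  interpret left_module R M by fact
  have c: "q x \<in> carrier Q" if "x \<in> carrier M" for x using that q by blast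
  have "left_module R Q"
  proof (rule left_moduleI)
    fix x assume "x \<in> carrier Q"
    then obtain y where "y \<in> carrier M" "x = q y" using q by (metis imageE)
    then show "\<exists>y\<in>carrier Q. y \<oplus>\<^bsub>Q\<^esub> x = \<zero>\<^bsub>Q\<^esub>"
      by (intro bexI[of _ "q (\<ominus>\<^bsub>M\<^esub> y)"]) (simp_all add: add zero c M.l_neg)
  qed (unfold q[symmetric] zero, auto simp: add smult R.ring_axioms M.a_ac smult_l_distr smult_r_distr smult_assoc)
  then show ?thesis by (intro lhomI left_module_axioms) (auto simp: c add smult)
qed

lemma lhom_quot:
  assumes M: "left_module R M" and N: "subm R M N"
  shows "lhom R M (quot_module M N) (\<lambda>x. N +>\<^bsub>M\<^esub> x)"
    and "(\<lambda>x. N +>\<^bsub>M\<^esub> x) ` carrier M = carrier (quot_module M N)"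
    and "a_kernel M (quot_module M N) (\<lambda>x. N +>\<^bsub>M\<^esub> x) = N"
proof -
  interpret left_module R M by fact
  interpret N: abelian_subgroup N M
    using submodule_iff_subm[OF M] N
    by (intro abelian_subgroupI3 additive_subgroup.intro M.abelian_group_axioms) (auto simp: submodule_def)
  have NM: "N \<subseteq> carrier M" using N by (simp add: subm_def)
  show im: "(\<lambda>x. N +>\<^bsub>M\<^esub> x) ` carrier M = carrier (quot_module M N)"
    by (auto simp: quot_module_def A_RCOSETS_def')
  show "lhom R M (quot_module M N) (\<lambda>x. N +>\<^bsub>M\<^esub> x)"
  proof (rule left_module_image[OF M im])
    fix x y assume "x \<in> carrier M" "y \<in> carrier M"
    then show "(N +>\<^bsub>M\<^esub> x) \<oplus>\<^bsub>quot_module M N\<^esub> (N +>\<^bsub>M\<^esub> y) = N +>\<^bsub>M\<^esub> (x \<oplus>\<^bsub>M\<^esub> y)"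
      by (simp add: quot_module_def N.a_rcos_sum)
  next
    show "\<zero>\<^bsub>quot_module M N\<^esub> = N +>\<^bsub>M\<^esub> \<zero>\<^bsub>M\<^esub>"
      by (simp add: quot_module_def NM)
  next
    fix a x assume ax: "a \<in> carrier R" "x \<in> carrier M"
    \<comment> \<open>The scalar multiples of the elements of a coset need not fill a coset; for the
      scalar zero they form a single point. Adding \<open>N\<close> restores the full coset.\<close>
    have "N <+>\<^bsub>M\<^esub> ((\<lambda>x. a \<odot>\<^bsub>M\<^esub> x) ` (N +>\<^bsub>M\<^esub> x)) = N +>\<^bsub>M\<^esub> (a \<odot>\<^bsub>M\<^esub> x)"
    proof (intro equalityI subsetI)
      fix z assume "z \<in> N <+>\<^bsub>M\<^esub> ((\<lambda>x. a \<odot>\<^bsub>M\<^esub> x) ` (N +>\<^bsub>M\<^esub> x))"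
      then obtain n m where nm: "n \<in> N" "m \<in> N" "z = n \<oplus>\<^bsub>M\<^esub> a \<odot>\<^bsub>M\<^esub> (m \<oplus>\<^bsub>M\<^esub> x)"
        by (auto simp: set_add_def' a_r_coset_def')
      then have "z = (n \<oplus>\<^bsub>M\<^esub> a \<odot>\<^bsub>M\<^esub> m) \<oplus>\<^bsub>M\<^esub> a \<odot>\<^bsub>M\<^esub> x"
        using ax NM subsetD[OF NM] by (simp add: smult_r_distr M.a_assoc)
      moreover have "n \<oplus>\<^bsub>M\<^esub> a \<odot>\<^bsub>M\<^esub> m \<in> N" using nm N ax by (simp add: subm_def)
      ultimately show "z \<in> N +>\<^bsub>M\<^esub> (a \<odot>\<^bsub>M\<^esub> x)" by (auto simp: a_r_coset_def')
    next
      fix z assume "z \<in> N +>\<^bsub>M\<^esub> (a \<odot>\<^bsub>M\<^esub> x)"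
      then obtain n where n: "n \<in> N" "z = n \<oplus>\<^bsub>M\<^esub> a \<odot>\<^bsub>M\<^esub> x" by (auto simp: a_r_coset_def')
      have "x \<in> N +>\<^bsub>M\<^esub> x" using N.a_rcos_self ax(2) .
      with n show "z \<in> N <+>\<^bsub>M\<^esub> ((\<lambda>x. a \<odot>\<^bsub>M\<^esub> x) ` (N +>\<^bsub>M\<^esub> x))"
        unfolding set_add_def' by blast
    qed
    then show "a \<odot>\<^bsub>quot_module M N\<^esub> (N +>\<^bsub>M\<^esub> x) = N +>\<^bsub>M\<^esub> (a \<odot>\<^bsub>M\<^esub> x)"
      by (simp add: quot_module_def)
  qed
  show "a_kernel M (quot_module M N) (\<lambda>x. N +>\<^bsub>M\<^esub> x) = N"
  proof (intro equalityI subsetI)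
    fix x assume "x \<in> a_kernel M (quot_module M N) (\<lambda>x. N +>\<^bsub>M\<^esub> x)"
    then have "x \<in> carrier M" "N +>\<^bsub>M\<^esub> x = N" by (auto simp: a_kernel_def' quot_module_def)
    then show "x \<in> N" using N.a_rcos_self[of x] by simp
  next
    fix x assume "x \<in> N"
    then show "x \<in> a_kernel M (quot_module M N) (\<lambda>x. N +>\<^bsub>M\<^esub> x)"
      using NM by (auto simp: a_kernel_def' quot_module_def N.a_rcos_const)
  qed
qed

section \<open>Projective resolutions and Ext\<close>

lemma proj_resolution_iff:
  assumes "left_module R X"
  shows "proj_resolution R X P \<delta> \<epsilon> \<longleftrightarrow>
    (\<forall>i. proj R (P i)) \<and> (\<forall>i. lhom R (P (Suc i)) (P i) (\<delta> i)) \<and>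
    (\<forall>i. \<delta> (Suc i) ` carrier (P (Suc (Suc i))) = a_kernel (P (Suc i)) (P i) (\<delta> i)) \<and>
    lhom R (P 0) X \<epsilon> \<and> \<epsilon> ` carrier (P 0) = carrier X \<and>
    \<delta> 0 ` carrier (P 1) = a_kernel (P 0) X \<epsilon>"
  using assms unfolding proj_resolution_def fg_projective_iff_proj lhom_iff
  by (auto dest: proj_left_module)

lemma proj_resolutionD:
  assumes "left_module R X" "proj_resolution R X P \<delta> \<epsilon>"
  shows "proj R (P i)" "lhom R (P (Suc i)) (P i) (\<delta> i)"
    "\<delta> (Suc i) ` carrier (P (Suc (Suc i))) = a_kernel (P (Suc i)) (P i) (\<delta> i)"
    "lhom R (P 0) X \<epsilon>" "\<epsilon> ` carrier (P 0) = carrier X"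
    "\<delta> 0 ` carrier (P (Suc 0)) = a_kernel (P 0) X \<epsilon>" "left_module R (P i)"
  using assms by (simp_all add: proj_resolution_iff proj_left_module)

lemma fg_module_sub_kernel:
  assumes "ring R" "left_noetherian R" "fg_module R M" "lhom R M N f"
  shows "fg_module R (sub M (a_kernel M N f))"
  using fg_module_noeth[OF assms(1-3)] subm_kernel[OF assms(4)] by (simp add: noeth_def)

text \<open>Only the augmentation changes, so the Ext modules of isomorphic modules can be computed
  from one and the same complex.\<close>

lemma proj_resolution_iso:
  assumes X: "left_module R X" and P: "proj_resolution R X P \<delta> \<epsilon>"
    and \<nu>: "lhom R X Y \<nu>" "bij_betw \<nu> (carrier X) (carrier Y)"
  shows "proj_resolution R Y P \<delta> (\<lambda>x. \<nu> (\<epsilon> x))"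
proof -
  note PD = proj_resolutionD[OF X P]
  have "\<nu> (\<epsilon> x) = \<zero>\<^bsub>Y\<^esub> \<longleftrightarrow> \<epsilon> x = \<zero>\<^bsub>X\<^esub>" if "x \<in> carrier (P 0)" for x
    using inj_on_lhom_iff[OF \<nu>(1)] \<nu>(2) lhom.closed[OF PD(4) that] lhom.zero[OF \<nu>(1)]
    unfolding bij_betw_def by metis
  then have "a_kernel (P 0) X \<epsilon> = a_kernel (P 0) Y (\<lambda>x. \<nu> (\<epsilon> x))" by (auto simp: a_kernel_def')
  moreover have "(\<lambda>x. \<nu> (\<epsilon> x)) ` carrier (P 0) = carrier Y"
    using PD(5) \<nu>(2) by (metis bij_betw_imp_surj_on image_image)
  ultimately show ?thesis
    unfolding proj_resolution_iff[OF lhom_modules(2)[OF \<nu>(1)]]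
    using PD(1-3,6) lhom_comp[OF PD(4) \<nu>(1)] by simp
qed

lemma univ_cover:
  fixes M :: "('a, 'b) module"
  assumes "fg_module R M"
  obtains V :: "('a, 'a univ) module" and p
  where "proj R V" "lhom R V M p" "p ` carrier V = carrier M"
proof -
  have R: "ring R" using left_module.axioms(1)[OF fg_module_left_module[OF assms]] .
  obtain n q where q: "lhom R (free R n) M q" "q ` carrier (free R n) = carrier M"
    using fg_module_free_surj[OF assms] .
  obtain V :: "('a, 'a univ) module" and \<psi>
    where V: "lhom R V (free R n) \<psi>" "bij_betw \<psi> (carrier V) (carrier (free R n))"
    using univ_copy_inv[OF fg_module_free[OF R]] .
  obtain s where s: "lhom R (free R n) V s" "\<And>x. x \<in> carrier V \<Longrightarrow> s (\<psi> x) = x"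
    "\<And>y. y \<in> carrier (free R n) \<Longrightarrow> s y \<in> carrier V \<and> \<psi> (s y) = y"
    using lhom_inv[OF V] by blast
  have V': "proj R V" by (rule proj_retract[OF proj_free[OF R] s(1) V(1)]) (rule s(2))
  have "(\<lambda>y. q (\<psi> y)) ` carrier V = q ` \<psi> ` carrier V" by (simp add: image_image)
  also have "\<dots> = carrier M" by (simp only: bij_betw_imp_surj_on[OF V(2)] q(2))
  finally show ?thesis
    by (rule that[OF V' lhom_comp[OF V(1) q(1)]])
qed

text \<open>The choice is fixed because \<open>syz\<close> iterates the passage to the kernel of a
  cover by primitive recursion. Kernels keep their type, so the recursion stays over
  \<open>'a univ\<close>.\<close>

definition cover :: "'a ring \<Rightarrow> ('a, 'a univ) module \<Rightarrow> ('a, 'a univ) module \<times> ('a univ \<Rightarrow> 'a univ)" where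
  "cover R K = (SOME (V, p). proj R V \<and> lhom R V K p \<and> p ` carrier V = carrier K)"

lemma cover:
  fixes K :: "('a, 'a univ) module"
  assumes "fg_module R K"
  shows "proj R (fst (cover R K))" "lhom R (fst (cover R K)) K (snd (cover R K))"
    "snd (cover R K) ` carrier (fst (cover R K)) = carrier K"
proof -
  have "\<exists>Vp. case Vp of (V :: ('a, 'a univ) module, p) \<Rightarrow> proj R V \<and> lhom R V K p \<and> p ` carrier V = carrier K"
  proof -
    obtain V :: "('a, 'a univ) module" and p where "proj R V" "lhom R V K p" "p ` carrier V = carrier K"
      using univ_cover[OF assms] .
    then show ?thesis by (intro exI[of _ "(V, p)"]) simp
  qed
  then have "case cover R K of (V, p) \<Rightarrow> proj R V \<and> lhom R V K p \<and> p ` carrier V = carrier K"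
    unfolding cover_def by (rule someI_ex)
  then show "proj R (fst (cover R K))" "lhom R (fst (cover R K)) K (snd (cover R K))"
    "snd (cover R K) ` carrier (fst (cover R K)) = carrier K"
    by (simp_all add: case_prod_unfold)
qed

primrec syz :: "'a ring \<Rightarrow> ('a, 'a univ) module \<Rightarrow> nat \<Rightarrow> ('a, 'a univ) module" where
  "syz R K 0 = K"
| "syz R K (Suc n) = sub (fst (cover R (syz R K n)))
     (a_kernel (fst (cover R (syz R K n))) (syz R K n) (snd (cover R (syz R K n))))"

lemma proj_resolution_exists:
  fixes M :: "('a, 'b) module"
  assumes R: "ring R" "left_noetherian R" and M: "fg_module R M"
  obtains P :: "nat \<Rightarrow> ('a, 'a univ) module" and \<delta> \<epsilon> where "proj_resolution R M P \<delta> \<epsilon>"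
proof -
  obtain K :: "('a, 'a univ) module" and g
    where g: "lhom R K M g" "bij_betw g (carrier K) (carrier M)" and fgK: "fg_module R K"
    using univ_copy_inv[OF M] .
  define P where "P i = fst (cover R (syz R K i))" for i
  define p where "p i = snd (cover R (syz R K i))" for i
  have S: "syz R K (Suc i) = sub (P i) (a_kernel (P i) (syz R K i) (p i))" for i
    by (simp add: P_def p_def)
  have fg: "fg_module R (syz R K i)" for i
  proof (induction i)
    case (Suc i)
    show ?case
      unfolding syz.simps using cover[OF Suc.IH] by (intro fg_module_sub_kernel[OF R] proj_fg)
  qed (simp add: fgK)
  have P: "proj R (P i)" and p: "lhom R (P i) (syz R K i) (p i)" "p i ` carrier (P i) = carrier (syz R K i)" for i
    using cover[OF fg[of i]] by (simp_all add: P_def p_def)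
  have k: "subm R (P i) (a_kernel (P i) (syz R K i) (p i))" for i by (rule subm_kernel[OF p(1)])
  \<comment> \<open>The cover of the next syzygy is read as a map into \<open>P i\<close>; its image
    is then the kernel of the preceding cover.\<close>
  have p': "lhom R (P (Suc i)) (P i) (p (Suc i))" for i
    using lhom_sub_codD[OF p(1)[of "Suc i", unfolded S] proj_left_module[OF P] k] .
  have ex: "p (Suc i) ` carrier (P (Suc i)) = a_kernel (P i) (syz R K i) (p i)" for i
    using p(2)[of "Suc i"] unfolding S by simp
  have "proj_resolution R K P (\<lambda>i. p (Suc i)) (p 0)"
    unfolding proj_resolution_iff[OF fg_module_left_module[OF fgK]]
  proof (intro conjI allI)
    show "p (Suc (Suc i)) ` carrier (P (Suc (Suc i))) = a_kernel (P (Suc i)) (P i) (p (Suc i))" for i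
      unfolding ex by (simp add: a_kernel_def' S del: syz.simps)
  qed (use P p' p[of 0] ex[of 0] in simp_all)
  from that[OF proj_resolution_iso[OF fg_module_left_module[OF fgK] this g]] show ?thesis .
qed

text \<open>Resolve the kernel of \<open>g\<close> and splice the result in from degree 2 on.
  Prescribing the first two terms is what makes the dual of a resolution of D(M) start with a given
  presentation of M.\<close>

lemma proj_resolution_extend:
  fixes Q0 Q1 :: "('a, 'a univ) module"
  assumes R: "ring R" "left_noetherian R" and Q: "proj R Q0" "proj R Q1" and g: "lhom R Q1 Q0 g"
    and q: "lhom R Q0 X q" "q ` carrier Q0 = carrier X" "g ` carrier Q1 = a_kernel Q0 X q"
  obtains P :: "nat \<Rightarrow> ('a, 'a univ) module" and \<delta>
  where "proj_resolution R X P \<delta> q" "P 0 = Q0" "P 1 = Q1" "\<delta> 0 = g"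
proof -
  let ?K = "a_kernel Q1 Q0 g"
  obtain P' :: "nat \<Rightarrow> ('a, 'a univ) module" and \<delta>' \<epsilon>' where P': "proj_resolution R (sub Q1 ?K) P' \<delta>' \<epsilon>'"
    using proj_resolution_exists[OF R fg_module_sub_kernel[OF R proj_fg[OF Q(2)] g]] .
  have K: "subm R Q1 ?K" by (rule subm_kernel[OF g])
  note P' = P'[unfolded proj_resolution_iff[OF left_module_sub[OF proj_left_module[OF Q(2)] K]]]
  define P where "P i = (case i of 0 \<Rightarrow> Q0 | Suc 0 \<Rightarrow> Q1 | Suc (Suc j) \<Rightarrow> P' j)" for i
  define \<delta> where "\<delta> i = (case i of 0 \<Rightarrow> g | Suc 0 \<Rightarrow> \<epsilon>' | Suc (Suc j) \<Rightarrow> \<delta>' j)" for i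
  have e: "lhom R (P' 0) Q1 \<epsilon>'"
    by (rule lhom_sub_codD[OF _ proj_left_module[OF Q(2)] K]) (use P' in blast)
  have "proj_resolution R X P \<delta> q"
    unfolding proj_resolution_iff[OF lhom_modules(2)[OF q(1)]]
  proof (intro conjI allI)
    show "proj R (P i)" for i using Q P' by (simp add: P_def split: nat.split)
    show "lhom R (P (Suc i)) (P i) (\<delta> i)" for i
      using g e P' by (simp add: P_def \<delta>_def split: nat.split)
    show "\<delta> (Suc i) ` carrier (P (Suc (Suc i))) = a_kernel (P (Suc i)) (P i) (\<delta> i)" for i
      using P' by (simp add: P_def \<delta>_def a_kernel_def' split: nat.split)
  qed (use q in \<open>simp_all add: P_def \<delta>_def\<close>)
  then show ?thesis by (rule that) (simp_all add: P_def \<delta>_def)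
qed

lemma chain_map_exists:
  assumes X: "left_module R X" and P: "proj_resolution R X P \<delta> \<epsilon>" and Q: "proj_resolution R X Q \<delta>' \<epsilon>'"
  obtains \<alpha> where "\<And>i. lhom R (P i) (Q i) (\<alpha> i)" "\<And>x. x \<in> carrier (P 0) \<Longrightarrow> \<epsilon>' (\<alpha> 0 x) = \<epsilon> x"
    "\<And>i x. x \<in> carrier (P (Suc i)) \<Longrightarrow> \<delta>' i (\<alpha> (Suc i) x) = \<alpha> i (\<delta> i x)"
proof -
  note PD = proj_resolutionD[OF X P] and QD = proj_resolutionD[OF X Q]
  note pP = PD(1) and d = PD(2) and d' = QD(2) and e = PD(4) and e' = QD(4,5)
  \<comment> \<open>The middle clause provides for the next lift: \<open>a\<close> sends boundaries
    of \<open>P\<close> to boundaries of \<open>Q\<close>.\<close>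
  define good where "good i a \<longleftrightarrow> lhom R (P i) (Q i) a \<and>
     (\<forall>x\<in>carrier (P (Suc i)). a (\<delta> i x) \<in> \<delta>' i ` carrier (Q (Suc i))) \<and>
     (i = 0 \<longrightarrow> (\<forall>x\<in>carrier (P 0). \<epsilon>' (a x) = \<epsilon> x))" for i a
  have "\<exists>\<alpha>. \<forall>i. good i (\<alpha> i) \<and> (\<forall>x\<in>carrier (P (Suc i)). \<delta>' i (\<alpha> (Suc i) x) = \<alpha> i (\<delta> i x))"
  proof (rule dependent_nat_choice)
    have "\<epsilon> x \<in> \<epsilon>' ` carrier (Q 0)" if "x \<in> carrier (P 0)" for x
      using lhom.closed[OF e that] e'(2) by simp
    then obtain a where a: "lhom R (P 0) (Q 0) a" "\<And>x. x \<in> carrier (P 0) \<Longrightarrow> \<epsilon>' (a x) = \<epsilon> x"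
      using proj_lift[OF pP e'(1) e] by blast
    have "a (\<delta> 0 x) \<in> \<delta>' 0 ` carrier (Q (Suc 0))" if x: "x \<in> carrier (P (Suc 0))" for x
    proof -
      have dx: "\<delta> 0 x \<in> carrier (P 0)" by (rule lhom.closed[OF d x])
      have "\<delta> 0 x \<in> a_kernel (P 0) X \<epsilon>" unfolding PD(6)[symmetric] using x by (rule imageI)
      then have "\<epsilon>' (a (\<delta> 0 x)) = \<zero>\<^bsub>X\<^esub>" using a(2)[OF dx] by (simp add: a_kernel_def')
      then have "a (\<delta> 0 x) \<in> a_kernel (Q 0) X \<epsilon>'" using lhom.closed[OF a(1) dx] by (simp add: a_kernel_def')
      then show ?thesis by (simp add: QD(6))
    qed
    with a show "\<exists>a. good 0 a" unfolding good_def by blast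
  next
    fix a i assume a: "good i a"
    then have al: "lhom R (P i) (Q i) a" by (simp add: good_def)
    have "a (\<delta> i x) \<in> \<delta>' i ` carrier (Q (Suc i))" if "x \<in> carrier (P (Suc i))" for x
      using a that by (simp add: good_def)
    then obtain b where b: "lhom R (P (Suc i)) (Q (Suc i)) b"
      "\<And>x. x \<in> carrier (P (Suc i)) \<Longrightarrow> \<delta>' i (b x) = a (\<delta> i x)"
      using proj_lift[OF pP d' lhom_comp[OF d al]] by blast
    have "b (\<delta> (Suc i) x) \<in> \<delta>' (Suc i) ` carrier (Q (Suc (Suc i)))" if x: "x \<in> carrier (P (Suc (Suc i)))" for x
    proof -
      have dx: "\<delta> (Suc i) x \<in> carrier (P (Suc i))" by (rule lhom.closed[OF d x])
      have "\<delta> (Suc i) x \<in> a_kernel (P (Suc i)) (P i) (\<delta> i)"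
        unfolding PD(3)[symmetric] using x by (rule imageI)
      then have "\<delta>' i (b (\<delta> (Suc i) x)) = \<zero>\<^bsub>Q i\<^esub>"
        using b(2)[OF dx] lhom.zero[OF al] by (simp add: a_kernel_def')
      then have "b (\<delta> (Suc i) x) \<in> a_kernel (Q (Suc i)) (Q i) (\<delta>' i)"
        using lhom.closed[OF b(1) dx] by (simp add: a_kernel_def')
      then show ?thesis by (simp add: QD(3))
    qed
    with b show "\<exists>b. good (Suc i) b \<and> (\<forall>x\<in>carrier (P (Suc i)). \<delta>' i (b x) = a (\<delta> i x))"
      unfolding good_def by blast
  qed
  then obtain \<alpha> where "\<And>i. good i (\<alpha> i)" "\<And>i x. x \<in> carrier (P (Suc i)) \<Longrightarrow> \<delta>' i (\<alpha> (Suc i) x) = \<alpha> i (\<delta> i x)"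
    by blast
  then show ?thesis by (intro that[of \<alpha>]) (auto simp: good_def)
qed

text \<open>The self-map \<open>\<alpha>\<close> is homotopic to the identity, and \<open>\<psi>\<close> is \<open>\<phi>\<close> composed with a homotopy.\<close>

lemma chain_self_map_cocycle:
  assumes X: "left_module R X" and P: "proj_resolution R X P \<delta> \<epsilon>"
    and \<alpha>: "\<And>i. lhom R (P i) (P i) (\<alpha> i)" "\<And>x. x \<in> carrier (P 0) \<Longrightarrow> \<epsilon> (\<alpha> 0 x) = \<epsilon> x"
      "\<And>i x. x \<in> carrier (P (Suc i)) \<Longrightarrow> \<delta> i (\<alpha> (Suc i) x) = \<alpha> i (\<delta> i x)"
    and \<phi>: "lhom R (P (Suc i)) L \<phi>" "\<And>x. x \<in> carrier (P (Suc (Suc i))) \<Longrightarrow> \<phi> (\<delta> (Suc i) x) = \<zero>\<^bsub>L\<^esub>"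
  obtains \<psi> where "lhom R (P i) L \<psi>"
    "\<And>x. x \<in> carrier (P (Suc i)) \<Longrightarrow> \<phi> (\<alpha> (Suc i) x) = \<psi> (\<delta> i x) \<oplus>\<^bsub>L\<^esub> \<phi> x"
proof -
  note PD = proj_resolutionD[OF X P]
  note pP = PD(1) and d = PD(2) and ker = PD(3) and e = PD(4) and lm = PD(7)
  have dd: "\<delta> i (\<delta> (Suc i) x) = \<zero>\<^bsub>P i\<^esub>" if "x \<in> carrier (P (Suc (Suc i)))" for i x
    using imageI[OF that, of "\<delta> (Suc i)"] unfolding ker by (simp add: a_kernel_def')
  \<comment> \<open>The homotopy identity is only needed on boundaries to continue: it makes
    \<open>\<alpha>\<close> minus the identity minus \<open>h \<delta>\<close> take cycles as values
    in the next degree.\<close>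
  define good where "good i h \<longleftrightarrow> lhom R (P i) (P (Suc i)) h \<and>
     (\<forall>x\<in>carrier (P (Suc i)). \<delta> i (h (\<delta> i x)) = \<alpha> i (\<delta> i x) \<ominus>\<^bsub>P i\<^esub> \<delta> i x)" for i h
  define rel where "rel i h h' \<longleftrightarrow> (\<forall>x\<in>carrier (P (Suc i)).
     \<delta> (Suc i) (h' x) = (\<alpha> (Suc i) x \<ominus>\<^bsub>P (Suc i)\<^esub> x) \<ominus>\<^bsub>P (Suc i)\<^esub> h (\<delta> i x))" for i h h'
  have "\<exists>h. \<forall>i. good i (h i) \<and> rel i (h i) (h (Suc i))"
  proof (rule dependent_nat_choice)
    have l: "lhom R (P 0) (P 0) (\<lambda>x. \<alpha> 0 x \<ominus>\<^bsub>P 0\<^esub> x)" by (intro lhom_diff \<alpha> lhom_id lm)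
    have "\<alpha> 0 x \<ominus>\<^bsub>P 0\<^esub> x \<in> \<delta> 0 ` carrier (P (Suc 0))" if x: "x \<in> carrier (P 0)" for x
    proof -
      have "\<epsilon> (\<alpha> 0 x \<ominus>\<^bsub>P 0\<^esub> x) = \<zero>\<^bsub>X\<^esub>"
        using lhom.diff[OF e lhom.closed[OF \<alpha>(1) x] x] \<alpha>(2)[OF x] left_module.diff_self[OF X]
          lhom.closed[OF e x] by simp
      then show ?thesis using lhom.closed[OF l x] by (simp add: PD(6) a_kernel_def')
    qed
    then obtain h where h: "lhom R (P 0) (P (Suc 0)) h"
      "\<And>x. x \<in> carrier (P 0) \<Longrightarrow> \<delta> 0 (h x) = \<alpha> 0 x \<ominus>\<^bsub>P 0\<^esub> x"
      using proj_lift[OF pP d l] by blast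
    then show "\<exists>h. good 0 h" unfolding good_def using lhom.closed[OF d] by blast
  next
    fix h i assume h: "good i h"
    then have hl: "lhom R (P i) (P (Suc i)) h" by (simp add: good_def)
    interpret S: left_module R "P (Suc i)" by (rule lm)
    interpret d: lhom R "P (Suc i)" "P i" "\<delta> i" by (rule d)
    interpret a: lhom R "P (Suc i)" "P (Suc i)" "\<alpha> (Suc i)" by (rule \<alpha>)
    interpret h: lhom R "P i" "P (Suc i)" h by (rule hl)
    let ?k = "\<lambda>x. (\<alpha> (Suc i) x \<ominus>\<^bsub>P (Suc i)\<^esub> x) \<ominus>\<^bsub>P (Suc i)\<^esub> h (\<delta> i x)"
    have l: "lhom R (P (Suc i)) (P (Suc i)) ?k"
      by (intro lhom_diff \<alpha> lhom_id lm lhom_comp[OF d hl])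
    have "?k x \<in> \<delta> (Suc i) ` carrier (P (Suc (Suc i)))" if x: "x \<in> carrier (P (Suc i))" for x
    proof -
      have "\<delta> i (?k x) = (\<delta> i (\<alpha> (Suc i) x) \<ominus>\<^bsub>P i\<^esub> \<delta> i x) \<ominus>\<^bsub>P i\<^esub> \<delta> i (h (\<delta> i x))"
        using x by simp
      also have "\<delta> i (h (\<delta> i x)) = \<alpha> i (\<delta> i x) \<ominus>\<^bsub>P i\<^esub> \<delta> i x" using h x by (simp add: good_def)
      also have "\<delta> i (\<alpha> (Suc i) x) = \<alpha> i (\<delta> i x)" by (rule \<alpha>(3)[OF x])
      finally have "\<delta> i (?k x) = \<zero>\<^bsub>P i\<^esub>"
        using x lhom.closed[OF \<alpha>(1)[of i] d.closed[OF x]] by simp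
      then have "?k x \<in> a_kernel (P (Suc i)) (P i) (\<delta> i)" using lhom.closed[OF l x] by (simp add: a_kernel_def')
      then show ?thesis by (simp add: ker)
    qed
    then obtain h' where h': "lhom R (P (Suc i)) (P (Suc (Suc i))) h'"
      "\<And>x. x \<in> carrier (P (Suc i)) \<Longrightarrow> \<delta> (Suc i) (h' x) = ?k x"
      using proj_lift[OF pP d l] by blast
    have "good (Suc i) h'"
      unfolding good_def
    proof (intro conjI ballI h')
      fix x assume x: "x \<in> carrier (P (Suc (Suc i)))"
      have dx: "\<delta> (Suc i) x \<in> carrier (P (Suc i))" by (rule lhom.closed[OF d x])
      show "\<delta> (Suc i) (h' (\<delta> (Suc i) x)) = \<alpha> (Suc i) (\<delta> (Suc i) x) \<ominus>\<^bsub>P (Suc i)\<^esub> \<delta> (Suc i) x"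
        using h'(2)[OF dx] dx dd[OF x] by simp
    qed
    moreover have "rel i h h'" using h'(2) by (simp add: rel_def)
    ultimately show "\<exists>h'. good (Suc i) h' \<and> rel i h h'" by blast
  qed
  then obtain h where h: "\<And>i. lhom R (P i) (P (Suc i)) (h i)" and rel: "\<And>i. rel i (h i) (h (Suc i))"
    unfolding good_def by blast
  interpret \<phi>: lhom R "P (Suc i)" L \<phi> by (rule \<phi>)
  show ?thesis
  proof (rule that)
    show "lhom R (P i) L (\<lambda>y. \<phi> (h i y))" by (rule lhom_comp[OF h \<phi>(1)])
    fix x assume x: "x \<in> carrier (P (Suc i))"
    have c: "\<alpha> (Suc i) x \<in> carrier (P (Suc i))" "h i (\<delta> i x) \<in> carrier (P (Suc i))" "h (Suc i) x \<in> carrier (P (Suc (Suc i)))"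
      using lhom.closed[OF \<alpha>(1) x] lhom.closed[OF h lhom.closed[OF d x]] lhom.closed[OF h x] by blast+
    \<comment> \<open>\<open>\<phi>\<close> kills boundaries, so the homotopy identity loses its
      term \<open>\<delta> h\<close> and only \<open>h \<delta>\<close> contributes.\<close>
    have "\<zero>\<^bsub>L\<^esub> = \<phi> (\<delta> (Suc i) (h (Suc i) x))" using \<phi>(2)[OF c(3)] by simp
    also have "\<dots> = (\<phi> (\<alpha> (Suc i) x) \<ominus>\<^bsub>L\<^esub> \<phi> x) \<ominus>\<^bsub>L\<^esub> \<phi> (h i (\<delta> i x))"
      using rel[of i] x c by (simp add: rel_def)
    finally have "\<phi> (\<alpha> (Suc i) x) \<ominus>\<^bsub>L\<^esub> \<phi> x = \<phi> (h i (\<delta> i x))"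
      using x c by (metis \<phi>.N.diff_closed \<phi>.N.diff_eq_zero \<phi>.closed)
    then show "\<phi> (\<alpha> (Suc i) x) = \<phi> (h i (\<delta> i x)) \<oplus>\<^bsub>L\<^esub> \<phi> x"
      using x c \<phi>.N.add_eq_iff_diff by simp
  qed
qed

section \<open>Cohomology of the dual complex and its independence of the resolution\<close>

definition cocycles where
  "cocycles R P \<delta> i = {\<phi> \<in> carrier (dual R (P i)). \<forall>x\<in>carrier (P (Suc i)). \<phi> (\<delta> i x) = \<zero>\<^bsub>R\<^esub>}"

definition coboundaries where
  "coboundaries R P \<delta> i = dual_map (P (Suc i)) (\<delta> i) ` carrier (dual R (P i))"

lemma a_kernel_dual_map:
  "a_kernel (dual R (P i)) (dual R (P (Suc i))) (dual_map (P (Suc i)) (\<delta> i)) = cocycles R P \<delta> i"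
  by (auto simp: a_kernel_def' cocycles_def dual_map_def compose_def dual_simps restrict_def fun_eq_iff)

lemma subm_cocycles_coboundaries:
  assumes "left_module R X" "proj_resolution R X P \<delta> \<epsilon>"
  shows "subm (opp_ring R) (dual R (P i)) (cocycles R P \<delta> i)"
    and "subm (opp_ring R) (dual R (P (Suc i))) (coboundaries R P \<delta> i)"
    and "coboundaries R P \<delta> i \<subseteq> cocycles R P \<delta> (Suc i)"
proof -
  note PD = proj_resolutionD[OF assms]
  show "subm (opp_ring R) (dual R (P i)) (cocycles R P \<delta> i)"
    using subm_kernel[OF lhom_dual_map[OF PD(2)]] by (simp add: a_kernel_dual_map[symmetric])
  show "subm (opp_ring R) (dual R (P (Suc i))) (coboundaries R P \<delta> i)"
    unfolding coboundaries_def by (rule subm_range[OF lhom_dual_map[OF PD(2)]])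
  show "coboundaries R P \<delta> i \<subseteq> cocycles R P \<delta> (Suc i)"
  proof
  fix \<phi> assume "\<phi> \<in> coboundaries R P \<delta> i"
  then obtain \<psi> where \<psi>: "\<psi> \<in> carrier (dual R (P i))" "\<phi> = dual_map (P (Suc i)) (\<delta> i) \<psi>"
    by (auto simp: coboundaries_def)
  have "\<phi> (\<delta> (Suc i) x) = \<zero>\<^bsub>R\<^esub>" if x: "x \<in> carrier (P (Suc (Suc i)))" for x
  proof -
    have "\<delta> (Suc i) x \<in> a_kernel (P (Suc i)) (P i) (\<delta> i)"
      unfolding PD(3)[symmetric] using x by (rule imageI)
    then show ?thesis using \<psi> lhom.zero[OF dual_lhom[OF PD(7) \<psi>(1)]] by (simp add: a_kernel_def')
  qed
  then show "\<phi> \<in> cocycles R P \<delta> (Suc i)"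
    using lhom.closed[OF lhom_dual_map[OF PD(2)] \<psi>(1)] \<psi>(2) by (simp add: cocycles_def)
  qed
qed

lemma dual_chain_map:
  assumes X: "left_module R X" and P: "proj_resolution R X P \<delta> \<epsilon>" and Q: "proj_resolution R X Q \<delta>' \<epsilon>'"
    and \<beta>: "\<And>i. lhom R (Q i) (P i) (\<beta> i)"
      "\<And>i x. x \<in> carrier (Q (Suc i)) \<Longrightarrow> \<delta> i (\<beta> (Suc i) x) = \<beta> i (\<delta>' i x)"
  shows "\<phi> \<in> cocycles R P \<delta> i \<Longrightarrow> dual_map (Q i) (\<beta> i) \<phi> \<in> cocycles R Q \<delta>' i"
    and "\<phi> \<in> coboundaries R P \<delta> i \<Longrightarrow> dual_map (Q (Suc i)) (\<beta> (Suc i)) \<phi> \<in> coboundaries R Q \<delta>' i"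
proof -
  note d = proj_resolutionD(2)[OF X P] proj_resolutionD(2)[OF X Q]
  note b = lhom.closed[OF lhom_dual_map[OF \<beta>(1)]] and bc = lhom.closed[OF \<beta>(1)]
  show "dual_map (Q i) (\<beta> i) \<phi> \<in> cocycles R Q \<delta>' i" if "\<phi> \<in> cocycles R P \<delta> i"
    using that b bc lhom.closed[OF d(2)] by (simp add: cocycles_def \<beta>(2)[symmetric])
  assume "\<phi> \<in> coboundaries R P \<delta> i"
  then obtain \<psi> where \<psi>: "\<psi> \<in> carrier (dual R (P i))" "\<phi> = dual_map (P (Suc i)) (\<delta> i) \<psi>"
    by (auto simp: coboundaries_def)
  have "dual_map (Q (Suc i)) (\<beta> (Suc i)) \<phi> = dual_map (Q (Suc i)) (\<delta>' i) (dual_map (Q i) (\<beta> i) \<psi>)"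
    unfolding \<psi>(2)
  proof (rule dual_ext)
    show "dual_map (Q (Suc i)) (\<beta> (Suc i)) (dual_map (P (Suc i)) (\<delta> i) \<psi>) \<in> carrier (dual R (Q (Suc i)))"
      by (rule b[OF lhom.closed[OF lhom_dual_map[OF d(1)] \<psi>(1)]])
    show "dual_map (Q (Suc i)) (\<delta>' i) (dual_map (Q i) (\<beta> i) \<psi>) \<in> carrier (dual R (Q (Suc i)))"
      by (rule lhom.closed[OF lhom_dual_map[OF d(2)] b[OF \<psi>(1)]])
  qed (simp add: bc lhom.closed[OF d(2)] \<beta>(2))
  then show "dual_map (Q (Suc i)) (\<beta> (Suc i)) \<phi> \<in> coboundaries R Q \<delta>' i"
    using b[OF \<psi>(1)] by (simp add: coboundaries_def)
qed

text \<open>The homotopy to the identity turns into a coboundary after dualising, so a lift of the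
  identity acts trivially on classes. The degree is positive, so that there is a preceding term for
  the homotopy to use.\<close>

lemma dual_chain_self_map:
  assumes X: "left_module R X" and P: "proj_resolution R X P \<delta> \<epsilon>"
    and \<alpha>: "\<And>i. lhom R (P i) (P i) (\<alpha> i)" "\<And>x. x \<in> carrier (P 0) \<Longrightarrow> \<epsilon> (\<alpha> 0 x) = \<epsilon> x"
      "\<And>i x. x \<in> carrier (P (Suc i)) \<Longrightarrow> \<delta> i (\<alpha> (Suc i) x) = \<alpha> i (\<delta> i x)"
    and \<phi>: "\<phi> \<in> cocycles R P \<delta> (Suc i)"
  obtains \<theta> where "\<theta> \<in> coboundaries R P \<delta> i"
    "dual_map (P (Suc i)) (\<alpha> (Suc i)) \<phi> = \<theta> \<oplus>\<^bsub>dual R (P (Suc i))\<^esub> \<phi>"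
proof -
  note PD = proj_resolutionD[OF X P]
  have \<phi>': "\<phi> \<in> carrier (dual R (P (Suc i)))" using \<phi> by (simp add: cocycles_def)
  have z: "\<phi> (\<delta> (Suc i) x) = \<zero>\<^bsub>regular_module R\<^esub>" if "x \<in> carrier (P (Suc (Suc i)))" for x
    using \<phi> that by (simp add: cocycles_def)
  obtain \<psi> where \<psi>: "lhom R (P i) (regular_module R) \<psi>"
    "\<And>x. x \<in> carrier (P (Suc i)) \<Longrightarrow> \<phi> (\<alpha> (Suc i) x) = \<psi> (\<delta> i x) \<oplus>\<^bsub>regular_module R\<^esub> \<phi> x"
    using chain_self_map_cocycle[OF X P \<alpha> dual_lhom[OF PD(7) \<phi>'] z] by blast
  interpret D: left_module "opp_ring R" "dual R (P (Suc i))" by (rule left_module_dual[OF PD(7)])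
  let ?\<theta> = "dual_map (P (Suc i)) (\<delta> i) (restrict \<psi> (carrier (P i)))"
  have m: "?\<theta> \<in> carrier (dual R (P (Suc i)))"
    by (rule lhom.closed[OF lhom_dual_map[OF PD(2)] restrict_dual[OF \<psi>(1)]])
  show ?thesis
  proof (rule that)
    show "?\<theta> \<in> coboundaries R P \<delta> i" using restrict_dual[OF \<psi>(1)] by (simp add: coboundaries_def)
    show "dual_map (P (Suc i)) (\<alpha> (Suc i)) \<phi> = ?\<theta> \<oplus>\<^bsub>dual R (P (Suc i))\<^esub> \<phi>"
      by (rule dual_ext[OF lhom.closed[OF lhom_dual_map[OF \<alpha>(1)] \<phi>'] D.M.a_closed[OF m \<phi>']])
        (simp add: \<psi>(2) lhom.closed[OF PD(2)])
  qed
qed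

text \<open>The choice made in \<open>Ext_ring\<close> does not involve the degree. Hence a single
  resolution serves all \<open>i\<close>, and a grade condition becomes exactness of one
  complex.\<close>

lemma Ext_ring_resolution:
  fixes P :: "nat \<Rightarrow> ('a, 'a univ) module"
  assumes "proj_resolution R X P \<delta> \<epsilon>"
  obtains Q :: "nat \<Rightarrow> ('a, 'a univ) module" and \<delta>' \<epsilon>'
  where "proj_resolution R X Q \<delta>' \<epsilon>'" "\<forall>i. Ext_ring R i X = dual_cohomology R Q \<delta>' i"
proof -
  define Q\<delta> where "Q\<delta> = (SOME (Q :: nat \<Rightarrow> ('a, 'a univ) module, \<delta>). \<exists>\<epsilon>. proj_resolution R X Q \<delta> \<epsilon>)"
  have "\<exists>Q\<delta>. case Q\<delta> of (Q :: nat \<Rightarrow> ('a, 'a univ) module, \<delta>) \<Rightarrow> \<exists>\<epsilon>. proj_resolution R X Q \<delta> \<epsilon>"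
    using assms by (intro exI[of _ "(P, \<delta>)"]) auto
  then have "case Q\<delta> of (Q :: nat \<Rightarrow> ('a, 'a univ) module, \<delta>) \<Rightarrow> \<exists>\<epsilon>. proj_resolution R X Q \<delta> \<epsilon>"
    unfolding Q\<delta>_def by (rule someI_ex)
  then obtain \<epsilon>' where Q: "proj_resolution R X (fst Q\<delta>) (snd Q\<delta>) \<epsilon>'" by (auto simp: case_prod_unfold)
  show ?thesis
    by (rule that[OF Q]) (simp add: Ext_ring_def Q\<delta>_def case_prod_unfold Let_def)
qed

text \<open>\<open>P\<close> need not be the resolution that \<open>Ext_ring\<close> chooses.\<close>

lemma Ext_ring_Suc:
  fixes P :: "nat \<Rightarrow> ('a, 'a univ) module" and X :: "('a, 'b) module"
  assumes X: "left_module R X" and P: "proj_resolution R X P \<delta> \<epsilon>"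
  obtains \<pi> where "lhom (opp_ring R) (sub (dual R (P (Suc i))) (cocycles R P \<delta> (Suc i))) (Ext_ring R (Suc i) X) \<pi>"
    "\<pi> ` cocycles R P \<delta> (Suc i) = carrier (Ext_ring R (Suc i) X)"
    "\<forall>\<phi>\<in>cocycles R P \<delta> (Suc i). \<pi> \<phi> = \<zero>\<^bsub>Ext_ring R (Suc i) X\<^esub> \<longleftrightarrow> \<phi> \<in> coboundaries R P \<delta> i"
proof -
  obtain Q :: "nat \<Rightarrow> ('a, 'a univ) module" and \<delta>' \<epsilon>'
    where Q: "proj_resolution R X Q \<delta>' \<epsilon>'" and Ext: "\<forall>i. Ext_ring R i X = dual_cohomology R Q \<delta>' i"
    using Ext_ring_resolution[OF P] .
  obtain \<alpha> where \<alpha>: "\<And>i. lhom R (P i) (Q i) (\<alpha> i)" "\<And>x. x \<in> carrier (P 0) \<Longrightarrow> \<epsilon>' (\<alpha> 0 x) = \<epsilon> x"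
    "\<And>i x. x \<in> carrier (P (Suc i)) \<Longrightarrow> \<delta>' i (\<alpha> (Suc i) x) = \<alpha> i (\<delta> i x)"
    using chain_map_exists[OF X P Q] by blast
  obtain \<beta> where \<beta>: "\<And>i. lhom R (Q i) (P i) (\<beta> i)" "\<And>x. x \<in> carrier (Q 0) \<Longrightarrow> \<epsilon> (\<beta> 0 x) = \<epsilon>' x"
    "\<And>i x. x \<in> carrier (Q (Suc i)) \<Longrightarrow> \<delta> i (\<beta> (Suc i) x) = \<beta> i (\<delta>' i x)"
    using chain_map_exists[OF X Q P] by blast
  note PD = proj_resolutionD[OF X P] and QD = proj_resolutionD[OF X Q]
  note \<alpha>c = lhom.closed[OF \<alpha>(1)] and \<beta>c = lhom.closed[OF \<beta>(1)]
  note sbP = subm_cocycles_coboundaries[OF X P] and sbQ = subm_cocycles_coboundaries[OF X Q]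
  let ?ZP = "cocycles R P \<delta> (Suc i)" and ?ZQ = "cocycles R Q \<delta>' (Suc i)"
    and ?BP = "coboundaries R P \<delta> i" and ?BQ = "coboundaries R Q \<delta>' i" and ?X = "Ext_ring R (Suc i) X"
  let ?C = "dual R (P (Suc i))" and ?E = "dual R (Q (Suc i))"
  define a where "a = dual_map (P (Suc i)) (\<alpha> (Suc i))"
  define b where "b = dual_map (Q (Suc i)) (\<beta> (Suc i))"
  have a: "a \<phi> \<in> ?ZP" if "\<phi> \<in> ?ZQ" for \<phi>
    unfolding a_def by (rule dual_chain_map(1)[OF X Q P \<alpha>(1,3) that])
  have aB: "a \<phi> \<in> ?BP" if "\<phi> \<in> ?BQ" for \<phi>
    unfolding a_def by (rule dual_chain_map(2)[OF X Q P \<alpha>(1,3) that])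
  have b: "b \<phi> \<in> ?ZQ" if "\<phi> \<in> ?ZP" for \<phi>
    unfolding b_def by (rule dual_chain_map(1)[OF X P Q \<beta>(1,3) that])
  have bB: "b \<phi> \<in> ?BQ" if "\<phi> \<in> ?BP" for \<phi>
    unfolding b_def by (rule dual_chain_map(2)[OF X P Q \<beta>(1,3) that])
  have sP: "subm (opp_ring R) ?C ?ZP" and sQ: "subm (opp_ring R) ?E ?ZQ"
    by (rule sbP sbQ)+
  note B = sbQ(3)
  have sB: "subm (opp_ring R) (sub ?E ?ZQ) ?BQ" using subm_sub[OF sQ B] sbQ(2) by blast
  define q where "q \<phi> = ?BQ +>\<^bsub>sub ?E ?ZQ\<^esub> \<phi>" for \<phi>
  have X': "?X = quot_module (sub ?E ?ZQ) ?BQ"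
    using Ext by (simp add: dual_cohomology_def a_kernel_dual_map coboundaries_def)
  have q: "lhom (opp_ring R) (sub ?E ?ZQ) ?X q" "q ` ?ZQ = carrier ?X" "a_kernel (sub ?E ?ZQ) ?X q = ?BQ"
    unfolding X' q_def using lhom_quot[OF left_module_sub[OF left_module_dual[OF QD(7)] sQ] sB] by simp_all
  have qz: "q \<phi> = \<zero>\<^bsub>?X\<^esub> \<longleftrightarrow> \<phi> \<in> ?BQ" if "\<phi> \<in> ?ZQ" for \<phi>
    using that q(3) by (auto simp: a_kernel_def')
  have ba: "\<exists>\<theta>\<in>?BQ. b (a \<phi>) = \<theta> \<oplus>\<^bsub>?E\<^esub> \<phi>" if \<phi>: "\<phi> \<in> ?ZQ" for \<phi>
  proof -
    obtain \<theta> where \<theta>: "\<theta> \<in> ?BQ"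
      "dual_map (Q (Suc i)) (\<lambda>x. \<alpha> (Suc i) (\<beta> (Suc i) x)) \<phi> = \<theta> \<oplus>\<^bsub>?E\<^esub> \<phi>"
      by (rule dual_chain_self_map[OF X Q lhom_comp[OF \<beta>(1) \<alpha>(1)] _ _ \<phi>]) (simp_all add: \<alpha> \<beta> \<beta>c)
    have "b (a \<phi>) = dual_map (Q (Suc i)) (\<lambda>x. \<alpha> (Suc i) (\<beta> (Suc i) x)) \<phi>"
      by (auto simp: a_def b_def dual_map_def compose_def \<beta>c fun_eq_iff)
    with \<theta> show ?thesis by auto
  qed
  have ab: "\<exists>\<theta>\<in>?BP. a (b \<phi>) = \<theta> \<oplus>\<^bsub>?C\<^esub> \<phi>" if \<phi>: "\<phi> \<in> ?ZP" for \<phi>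
  proof -
    obtain \<theta> where \<theta>: "\<theta> \<in> ?BP"
      "dual_map (P (Suc i)) (\<lambda>x. \<beta> (Suc i) (\<alpha> (Suc i) x)) \<phi> = \<theta> \<oplus>\<^bsub>?C\<^esub> \<phi>"
      by (rule dual_chain_self_map[OF X P lhom_comp[OF \<alpha>(1) \<beta>(1)] _ _ \<phi>]) (simp_all add: \<alpha> \<beta> \<alpha>c)
    have "a (b \<phi>) = dual_map (P (Suc i)) (\<lambda>x. \<beta> (Suc i) (\<alpha> (Suc i) x)) \<phi>"
      by (auto simp: a_def b_def dual_map_def compose_def \<alpha>c fun_eq_iff)
    with \<theta> show ?thesis by auto
  qed
  have "lhom (opp_ring R) (sub ?C ?ZP) (sub ?E ?ZQ) b"
    by (rule lhom_sub_cod[OF lhom_sub_dom[OF _ sP] sQ]) (simp_all add: b b_def[symmetric], simp add: b_def lhom_dual_map[OF \<beta>(1)])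
  \<comment> \<open>A cocycle on \<open>P\<close> is sent to the class of its pullback to
    \<open>Q\<close>. This is onto because \<open>b\<close> after \<open>a\<close> is the identity
    up to coboundaries, and only coboundaries are killed because the same holds for \<open>a\<close>
    after \<open>b\<close>.\<close>
  note \<pi> = lhom_comp[OF this q(1)]
  interpret q: lhom "opp_ring R" "sub ?E ?ZQ" ?X q by (rule q(1))
  show ?thesis
  proof (rule that[OF \<pi>])
    have "y \<in> (\<lambda>\<phi>. q (b \<phi>)) ` ?ZP" if y: "y \<in> carrier ?X" for y
    proof -
      obtain \<phi> where \<phi>: "\<phi> \<in> ?ZQ" "y = q \<phi>" using y q(2) by (metis imageE)
      obtain \<theta> where \<theta>: "\<theta> \<in> ?BQ" "b (a \<phi>) = \<theta> \<oplus>\<^bsub>?E\<^esub> \<phi>" using ba[OF \<phi>(1)] by blast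
      have \<theta>Z: "\<theta> \<in> ?ZQ" using B \<theta>(1) by blast
      have "q (b (a \<phi>)) = q \<theta> \<oplus>\<^bsub>?X\<^esub> q \<phi>" unfolding \<theta>(2) using q.add[of \<theta> \<phi>] \<theta>Z \<phi>(1) by simp
      also have "\<dots> = y" using qz[OF \<theta>Z] \<theta>(1) \<phi> q.closed[of \<phi>] by simp
      finally show ?thesis using a[OF \<phi>(1)] by blast
    qed
    then show "(\<lambda>\<phi>. q (b \<phi>)) ` ?ZP = carrier ?X" using b q(2) by blast
    show "\<forall>\<phi>\<in>?ZP. q (b \<phi>) = \<zero>\<^bsub>?X\<^esub> \<longleftrightarrow> \<phi> \<in> ?BP"
    proof (intro ballI iffI)
      fix \<phi> assume \<phi>: "\<phi> \<in> ?ZP" and "q (b \<phi>) = \<zero>\<^bsub>?X\<^esub>"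
      then have "a (b \<phi>) \<in> ?BP" using qz[OF b[OF \<phi>]] aB by blast
      moreover obtain \<theta> where \<theta>: "\<theta> \<in> ?BP" "a (b \<phi>) = \<theta> \<oplus>\<^bsub>?C\<^esub> \<phi>" using ab[OF \<phi>] by blast
      ultimately have "(\<theta> \<oplus>\<^bsub>?C\<^esub> \<phi>) \<ominus>\<^bsub>?C\<^esub> \<theta> \<in> ?BP"
        using subm_diff[OF left_module_dual[OF PD(7)] sbP(2)] by metis
      moreover interpret C: left_module "opp_ring R" ?C by (rule left_module_dual[OF PD(7)])
      have "\<theta> \<in> carrier ?C" "\<phi> \<in> carrier ?C"
        using \<theta>(1) \<phi> sbP(2)[of i] by (auto simp: subm_def cocycles_def)
      then have "(\<theta> \<oplus>\<^bsub>?C\<^esub> \<phi>) \<ominus>\<^bsub>?C\<^esub> \<theta> = \<phi>" using C.add_diff_cancel[of \<phi> \<theta>] C.M.a_comm by simp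
      ultimately show "\<phi> \<in> ?BP" by simp
    next
      fix \<phi> assume "\<phi> \<in> ?ZP" "\<phi> \<in> ?BP"
      then show "q (b \<phi>) = \<zero>\<^bsub>?X\<^esub>" using qz[OF b] bB by blast
    qed
  qed
qed

section \<open>Vanishing of cohomology\<close>

lemma lhom_lc_fun:
  assumes E: "left_module R E" and M: "left_module R M"
    and h: "\<And>i. i < n \<Longrightarrow> lhom R M (regular_module R) (h i)" and x: "\<And>i. i < n \<Longrightarrow> x i \<in> carrier E"
  shows "lhom R M E (\<lambda>y. lc E n (\<lambda>i. h i y) x)"
proof -
  interpret E: left_module R E by fact
  have hR: "h i y \<in> carrier R" if "i < n" "y \<in> carrier M" for i y
    using lhom.closed[OF h[OF that(1)] that(2)] by simp
  show ?thesis
  proof (rule lhomI[OF M E])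
    show "lc E n (\<lambda>i. h i y) x \<in> carrier E" if "y \<in> carrier M" for y
      by (rule E.lc_closed) (simp_all add: hR x that)
    show "lc E n (\<lambda>i. h i (y \<oplus>\<^bsub>M\<^esub> z)) x = lc E n (\<lambda>i. h i y) x \<oplus>\<^bsub>E\<^esub> lc E n (\<lambda>i. h i z) x"
      if "y \<in> carrier M" "z \<in> carrier M" for y z
    proof -
      have "lc E n (\<lambda>i. h i (y \<oplus>\<^bsub>M\<^esub> z)) x = lc E n (\<lambda>i. h i y \<oplus>\<^bsub>R\<^esub> h i z) x"
        by (rule lc_cong) (use lhom.add[OF h that] in simp_all)
      then show ?thesis using E.lc_add[of n "\<lambda>i. h i y" "\<lambda>i. h i z" x] by (simp add: hR x that)
    qed
    show "lc E n (\<lambda>i. h i (a \<odot>\<^bsub>M\<^esub> y)) x = a \<odot>\<^bsub>E\<^esub> lc E n (\<lambda>i. h i y) x"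
      if "a \<in> carrier R" "y \<in> carrier M" for a y
    proof -
      have "lc E n (\<lambda>i. h i (a \<odot>\<^bsub>M\<^esub> y)) x = lc E n (\<lambda>i. a \<otimes>\<^bsub>R\<^esub> h i y) x"
        by (rule lc_cong) (use lhom.smult[OF h that] in simp_all)
      then show ?thesis using E.lc_smult[of a n "\<lambda>i. h i y" x] by (simp add: hR x that)
    qed
  qed
qed

text \<open>The coordinates of \<open>g\<close> with respect to a dual basis of \<open>E\<close> are
  functionals. Each of them is extended along \<open>q\<close>, and the extensions are reassembled
  with the basis vectors. \<open>Z\<close> stands for the image on which the functionals have to
  vanish.\<close>

lemma factor_proj:
  assumes E: "proj R E" and q: "lhom R M N q" and g: "lhom R M E g"
    and Z: "\<And>z. z \<in> Z \<Longrightarrow> z \<in> carrier M \<and> g z = \<zero>\<^bsub>E\<^esub>"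
    and reg: "\<And>\<phi>. \<lbrakk>lhom R M (regular_module R) \<phi>; \<And>z. z \<in> Z \<Longrightarrow> \<phi> z = \<zero>\<^bsub>R\<^esub>\<rbrakk> \<Longrightarrow>
      \<exists>\<psi>. lhom R N (regular_module R) \<psi> \<and> (\<forall>x\<in>carrier M. \<psi> (q x) = \<phi> x)"
  obtains h where "lhom R N E h" "\<And>x. x \<in> carrier M \<Longrightarrow> h (q x) = g x"
proof -
  obtain n x \<phi> where lE: "left_module R E" and b: "dual_basis R E n x \<phi>"
    using E proj_iff_dual_basis by blast
  have x: "x i \<in> carrier E" and \<phi>: "\<phi> i \<in> carrier (dual R E)" if "i < n" for i
    using b that by (auto simp: dual_basis_def)
  have "\<exists>\<psi>. lhom R N (regular_module R) \<psi> \<and> (\<forall>y\<in>carrier M. \<psi> (q y) = \<phi> i (g y))" if i: "i < n" for i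
    using lhom_comp[OF g dual_lhom[OF lE \<phi>[OF i]]] Z lhom.zero[OF dual_lhom[OF lE \<phi>[OF i]]]
    by (intro reg) simp_all
  then obtain \<psi> where \<psi>: "\<And>i. i < n \<Longrightarrow> lhom R N (regular_module R) (\<psi> i)"
    "\<And>i y. i < n \<Longrightarrow> y \<in> carrier M \<Longrightarrow> \<psi> i (q y) = \<phi> i (g y)" by metis
  show ?thesis
  proof (rule that)
    show "lhom R N E (\<lambda>y. lc E n (\<lambda>i. \<psi> i y) x)"
      by (rule lhom_lc_fun[OF lE lhom_modules(2)[OF q] \<psi>(1) x])
    fix y assume y: "y \<in> carrier M"
    have "lc E n (\<lambda>i. \<psi> i (q y)) x = lc E n (\<lambda>i. \<phi> i (g y)) x" by (rule lc_cong) (simp_all add: \<psi>(2) y)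
    also have "\<dots> = g y" using b lhom.closed[OF g y] by (simp add: dual_basis_def)
    finally show "lc E n (\<lambda>i. \<psi> i (q y)) x = g y" .
  qed
qed

lemma quot_trivial:
  assumes "left_module R M" "subm R M N" "carrier (quot_module M N) = {\<zero>\<^bsub>quot_module M N\<^esub>}"
  shows "carrier M \<subseteq> N"
proof
  note q = lhom_quot[OF assms(1,2)]
  fix x assume x: "x \<in> carrier M"
  then have "N +>\<^bsub>M\<^esub> x = \<zero>\<^bsub>quot_module M N\<^esub>" using lhom.closed[OF q(1) x] assms(3) by simp
  then have "x \<in> a_kernel M (quot_module M N) (\<lambda>x. N +>\<^bsub>M\<^esub> x)" using x by (simp add: a_kernel_def')
  then show "x \<in> N" by (simp only: q(3))
qed

text \<open>Vanishing of Ext is exactness of the dual of a resolution, restated here for functionals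
  that need not be extensional. Degree 0 stands apart: without coboundaries, exactness there means
  that a cocycle is zero.\<close>

lemma grade_ge_exact:
  fixes X :: "('a, 'b) module"
  assumes R: "ring R" "left_noetherian R" and X: "fg_module R X" and gr: "grade_ge R X m"
  obtains G :: "nat \<Rightarrow> ('a, 'a univ) module" and \<delta> \<eta>
  where "proj_resolution R X G \<delta> \<eta>"
    "0 < m \<longrightarrow> (\<forall>\<phi>. lhom R (G 0) (regular_module R) \<phi> \<longrightarrow>
       (\<forall>x\<in>carrier (G (Suc 0)). \<phi> (\<delta> 0 x) = \<zero>\<^bsub>R\<^esub>) \<longrightarrow> (\<forall>x\<in>carrier (G 0). \<phi> x = \<zero>\<^bsub>R\<^esub>))"
    "\<forall>i \<phi>. Suc i < m \<longrightarrow> lhom R (G (Suc i)) (regular_module R) \<phi> \<longrightarrow>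
       (\<forall>x\<in>carrier (G (Suc (Suc i))). \<phi> (\<delta> (Suc i) x) = \<zero>\<^bsub>R\<^esub>) \<longrightarrow>
       (\<exists>\<psi>. lhom R (G i) (regular_module R) \<psi> \<and> (\<forall>x\<in>carrier (G (Suc i)). \<psi> (\<delta> i x) = \<phi> x))"
proof -
  obtain P :: "nat \<Rightarrow> ('a, 'a univ) module" and \<delta>' \<epsilon> where P: "proj_resolution R X P \<delta>' \<epsilon>"
    using proj_resolution_exists[OF R X] .
  obtain G :: "nat \<Rightarrow> ('a, 'a univ) module" and \<delta> \<eta>
    where G: "proj_resolution R X G \<delta> \<eta>" and Ext: "\<forall>i. Ext_ring R i X = dual_cohomology R G \<delta> i"
    using Ext_ring_resolution[OF P] .
  note lX = fg_module_left_module[OF X]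
  note GD = proj_resolutionD[OF lX G] and sb = subm_cocycles_coboundaries[OF lX G]
  have lC: "left_module (opp_ring R) (dual R (G i))" for i by (rule left_module_dual[OF GD(7)])
  have mK: "restrict \<phi> (carrier (G i)) \<in> cocycles R G \<delta> i"
    if "lhom R (G i) (regular_module R) \<phi>" "\<forall>x\<in>carrier (G (Suc i)). \<phi> (\<delta> i x) = \<zero>\<^bsub>R\<^esub>" for \<phi> i
    using that restrict_dual[OF that(1)] lhom.closed[OF GD(2)[of i]] by (simp add: cocycles_def)
  have triv: "cocycles R G \<delta> i \<subseteq> N"
    if "i < m" "N \<subseteq> cocycles R G \<delta> i" "subm (opp_ring R) (dual R (G i)) N"
      "Ext_ring R i X = quot_module (sub (dual R (G i)) (cocycles R G \<delta> i)) N" for i N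
  proof -
    have "carrier (Ext_ring R i X) = {\<zero>\<^bsub>Ext_ring R i X\<^esub>}" using gr that(1) by (simp add: grade_ge_def)
    then show ?thesis
      using quot_trivial[OF left_module_sub[OF lC sb(1)[of i]], of N] subm_sub[OF sb(1)[of i] that(2)] that(3,4)
      by simp
  qed
  show ?thesis
  proof (rule that[OF G]; intro allI impI ballI)
    fix \<phi> x assume m: "0 < m" and \<phi>: "lhom R (G 0) (regular_module R) \<phi>"
      "\<forall>x\<in>carrier (G (Suc 0)). \<phi> (\<delta> 0 x) = \<zero>\<^bsub>R\<^esub>" and x: "x \<in> carrier (G 0)"
    have "cocycles R G \<delta> 0 \<subseteq> {\<zero>\<^bsub>dual R (G 0)\<^esub>}"
      by (rule triv[OF m _ subm_zero[OF lC]])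
        (use sb(1)[of 0] Ext in \<open>simp_all add: subm_def dual_cohomology_def a_kernel_dual_map\<close>)
    then have "restrict \<phi> (carrier (G 0)) = \<zero>\<^bsub>dual R (G 0)\<^esub>" using mK[OF \<phi>] by blast
    then have "restrict \<phi> (carrier (G 0)) x = \<zero>\<^bsub>dual R (G 0)\<^esub> x" by simp
    then show "\<phi> x = \<zero>\<^bsub>R\<^esub>" using x by simp
  next
    fix i \<phi> assume m: "Suc i < m" and \<phi>: "lhom R (G (Suc i)) (regular_module R) \<phi>"
      "\<forall>x\<in>carrier (G (Suc (Suc i))). \<phi> (\<delta> (Suc i) x) = \<zero>\<^bsub>R\<^esub>"
    have "cocycles R G \<delta> (Suc i) \<subseteq> coboundaries R G \<delta> i"
      by (rule triv[OF m sb(3,2)]) (use Ext in \<open>simp add: dual_cohomology_def a_kernel_dual_map coboundaries_def\<close>)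
    then obtain \<psi> where \<psi>: "\<psi> \<in> carrier (dual R (G i))"
      "restrict \<phi> (carrier (G (Suc i))) = dual_map (G (Suc i)) (\<delta> i) \<psi>"
      using mK[OF \<phi>] by (auto simp: coboundaries_def)
    have "\<psi> (\<delta> i x) = \<phi> x" if x: "x \<in> carrier (G (Suc i))" for x
      using fun_cong[OF \<psi>(2), of x] x by simp
    then show "\<exists>\<psi>. lhom R (G i) (regular_module R) \<psi> \<and> (\<forall>x\<in>carrier (G (Suc i)). \<psi> (\<delta> i x) = \<phi> x)"
      using dual_lhom[OF GD(7) \<psi>(1)] by blast
  qed
qed

text \<open>The sets \<open>I j\<close> stand for the kernels in the exact sequence \<open>0 \<rightarrow> F n \<rightarrow> \<dots> \<rightarrow> F 0\<close>; naming
  them treats the end \<open>I n = 0\<close> like the other places.\<close>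

definition ladder where
  "ladder R n G D A a F f g I \<longleftrightarrow>
    (\<forall>i. proj R (G i) \<and> lhom R (G (Suc i)) (G i) (D i)) \<and>
    (\<forall>i. \<forall>x\<in>carrier (G (Suc (Suc i))). D i (D (Suc i) x) = \<zero>\<^bsub>G i\<^esub>) \<and>
    (\<forall>i<n. \<forall>\<phi>. lhom R (G (Suc i)) (regular_module R) \<phi> \<longrightarrow>
       (\<forall>x\<in>carrier (G (Suc (Suc i))). \<phi> (D (Suc i) x) = \<zero>\<^bsub>R\<^esub>) \<longrightarrow>
       (\<exists>\<psi>. lhom R (G i) (regular_module R) \<psi> \<and> (\<forall>x\<in>carrier (G (Suc i)). \<psi> (D i x) = \<phi> x))) \<and>
    (\<forall>i\<le>n. proj R (A i) \<and> lhom R (A (Suc i)) (A i) (a i) \<and> lhom R (A i) (F i) (g i)) \<and>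
    (\<forall>i<n. a_kernel (A (Suc i)) (A i) (a i) = a (Suc i) ` carrier (A (Suc (Suc i)))) \<and>
    (\<forall>i<n. lhom R (F (Suc i)) (F i) (f i) \<and> I i \<subseteq> f i ` carrier (F (Suc i)) \<and>
       a_kernel (F (Suc i)) (F i) (f i) \<subseteq> I (Suc i) \<and>
       (\<forall>x\<in>carrier (A (Suc i)). f i (g (Suc i) x) = g i (a i x))) \<and>
    I n \<subseteq> {\<zero>\<^bsub>F n\<^esub>} \<and>
    g n ` carrier (A n) = carrier (F n) \<and>
    a_kernel (A n) (F n) (g n) \<subseteq> a n ` carrier (A (Suc n))"

lemma ladder_shift:
  assumes "ladder R (Suc n) G D A a F f g I"
  shows "ladder R n (\<lambda>i. G (Suc i)) (\<lambda>i. D (Suc i)) (\<lambda>i. A (Suc i)) (\<lambda>i. a (Suc i))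
    (\<lambda>i. F (Suc i)) (\<lambda>i. f (Suc i)) (\<lambda>i. g (Suc i)) (\<lambda>i. I (Suc i))"
  using assms unfolding ladder_def by simp

text \<open>The chain map \<open>u\<close> into \<open>A\<close> and the homotopy \<open>h\<close>
  into \<open>F\<close> advance together, one step per induction. At the far end \<open>A\<close>
  maps onto \<open>F\<close> with the right kernel, so the homotopy itself lifts to
  \<open>A\<close>. On the way back, each lift corrects the chain map one place earlier, and
  exactness of the functionals on \<open>G\<close> turns what remains into a map factoring through
  \<open>D\<close>.\<close>

lemma ladder_split:
  fixes G :: "nat \<Rightarrow> ('a, 'g) module" and A :: "nat \<Rightarrow> ('a, 'c) module" and F :: "nat \<Rightarrow> ('a, 'e) module"
  assumes "ladder R n G D A a F f g I"
    and "lhom R (G (Suc 0)) (A 0) u" "lhom R (G 0) (F 0) h"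
    and "\<And>x. x \<in> carrier (G (Suc (Suc 0))) \<Longrightarrow> u (D (Suc 0) x) \<in> a 0 ` carrier (A (Suc 0))"
    and "\<And>x. x \<in> carrier (G (Suc 0)) \<Longrightarrow> g 0 (u x) \<ominus>\<^bsub>F 0\<^esub> h (D 0 x) \<in> I 0"
  shows "\<exists>s t. lhom R (G (Suc 0)) (A (Suc 0)) s \<and> lhom R (G 0) (A 0) t \<and>
    (\<forall>x\<in>carrier (G (Suc 0)). u x = a 0 (s x) \<oplus>\<^bsub>A 0\<^esub> t (D 0 x))"
  using assms
proof (induction n arbitrary: G D A a F f g I u h)
  case 0
  note L = 0(1)[unfolded ladder_def] and u = 0(2) and h = 0(3) and gu = 0(5)
  have pG: "proj R (G i)" and lD: "lhom R (G (Suc i)) (G i) (D i)" for i using L by simp_all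
  have la: "lhom R (A (Suc 0)) (A 0) (a 0)" and lg: "lhom R (A 0) (F 0) (g 0)"
    and sg: "g 0 ` carrier (A 0) = carrier (F 0)" and kg: "a_kernel (A 0) (F 0) (g 0) \<subseteq> a 0 ` carrier (A (Suc 0))"
    and I: "I 0 \<subseteq> {\<zero>\<^bsub>F 0\<^esub>}"
    using L by simp_all
  \<comment> \<open>Far end of the ladder: \<open>I 0\<close> is zero, so \<open>g 0\<close>
    composed with \<open>u\<close> equals \<open>h\<close> composed with \<open>D 0\<close>. Once
    \<open>h\<close> is lifted to \<open>t\<close>, the difference of \<open>u\<close> and
    \<open>t D\<close> lies in the kernel of \<open>g 0\<close>, hence in the image of
    \<open>a 0\<close>.\<close>
  have "h x \<in> g 0 ` carrier (A 0)" if "x \<in> carrier (G 0)" for x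
    using lhom.closed[OF h that] sg by simp
  then obtain t where t: "lhom R (G 0) (A 0) t" "\<And>x. x \<in> carrier (G 0) \<Longrightarrow> g 0 (t x) = h x"
    using proj_lift[OF pG lg h] by blast
  interpret A: left_module R "A 0" by (rule lhom_modules(2)[OF la])
  interpret g: lhom R "A 0" "F 0" "g 0" by (rule lg)
  have v: "lhom R (G (Suc 0)) (A 0) (\<lambda>x. u x \<ominus>\<^bsub>A 0\<^esub> t (D 0 x))"
    by (rule lhom_diff[OF u lhom_comp[OF lD t(1)]])
  have "u x \<ominus>\<^bsub>A 0\<^esub> t (D 0 x) \<in> a 0 ` carrier (A (Suc 0))" if x: "x \<in> carrier (G (Suc 0))" for x
  proof -
    have Dx: "D 0 x \<in> carrier (G 0)" by (rule lhom.closed[OF lD x])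
    have c: "u x \<in> carrier (A 0)" "t (D 0 x) \<in> carrier (A 0)"
      by (rule lhom.closed[OF u x] lhom.closed[OF t(1) Dx])+
    have "g 0 (u x \<ominus>\<^bsub>A 0\<^esub> t (D 0 x)) = g 0 (u x) \<ominus>\<^bsub>F 0\<^esub> h (D 0 x)"
      using c by (simp add: t(2)[OF Dx])
    also have "\<dots> = \<zero>\<^bsub>F 0\<^esub>" using gu[OF x] I by blast
    finally show ?thesis using kg c by (auto simp: a_kernel_def')
  qed
  then obtain s where s: "lhom R (G (Suc 0)) (A (Suc 0)) s"
    "\<And>x. x \<in> carrier (G (Suc 0)) \<Longrightarrow> a 0 (s x) = u x \<ominus>\<^bsub>A 0\<^esub> t (D 0 x)"
    using proj_lift[OF pG la v] by blast
  have "u x = a 0 (s x) \<oplus>\<^bsub>A 0\<^esub> t (D 0 x)" if x: "x \<in> carrier (G (Suc 0))" for x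
    using s(2)[OF x] lhom.closed[OF u x] lhom.closed[OF t(1) lhom.closed[OF lD x]] by simp
  with s(1) t(1) show ?case by blast
next
  case (Suc n)
  note L = Suc.prems(1)[unfolded ladder_def] and u = Suc.prems(2) and h = Suc.prems(3)
    and uD = Suc.prems(4) and gu = Suc.prems(5)
  have pG: "proj R (G i)" and lD: "lhom R (G (Suc i)) (G i) (D i)" for i using L by simp_all
  have DD: "D i (D (Suc i) x) = \<zero>\<^bsub>G i\<^esub>" if "x \<in> carrier (G (Suc (Suc i)))" for i x
    using L that by simp
  have Hom: "\<exists>\<psi>. lhom R (G 0) (regular_module R) \<psi> \<and> (\<forall>x\<in>carrier (G (Suc 0)). \<psi> (D 0 x) = \<phi> x)"
    if "lhom R (G (Suc 0)) (regular_module R) \<phi>" "\<forall>x\<in>carrier (G (Suc (Suc 0))). \<phi> (D (Suc 0) x) = \<zero>\<^bsub>R\<^esub>" for \<phi>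
    using L that by simp
  have pA: "proj R (A 0)" and la: "lhom R (A (Suc 0)) (A 0) (a 0)" and lg: "lhom R (A 0) (F 0) (g 0)"
    using L by simp_all
  have la1: "lhom R (A (Suc (Suc 0))) (A (Suc 0)) (a (Suc 0))" and lg1: "lhom R (A (Suc 0)) (F (Suc 0)) (g (Suc 0))"
    using L by simp_all
  have ka: "a_kernel (A (Suc 0)) (A 0) (a 0) = a (Suc 0) ` carrier (A (Suc (Suc 0)))"
    using L by simp
  have lf: "lhom R (F (Suc 0)) (F 0) (f 0)" and If: "I 0 \<subseteq> f 0 ` carrier (F (Suc 0))"
    and kf: "a_kernel (F (Suc 0)) (F 0) (f 0) \<subseteq> I (Suc 0)"
    and fg: "\<And>x. x \<in> carrier (A (Suc 0)) \<Longrightarrow> f 0 (g (Suc 0) x) = g 0 (a 0 x)"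
    using L by simp_all
  interpret A: left_module R "A 0" by (rule lhom_modules(2)[OF la])
  interpret f: lhom R "F (Suc 0)" "F 0" "f 0" by (rule lf)
  interpret g: lhom R "A 0" "F 0" "g 0" by (rule lg)
  have "lhom R (G (Suc 0)) (F 0) (\<lambda>x. g 0 (u x) \<ominus>\<^bsub>F 0\<^esub> h (D 0 x))"
    by (rule lhom_diff[OF lhom_comp[OF u lg] lhom_comp[OF lD h]])
  moreover have "g 0 (u x) \<ominus>\<^bsub>F 0\<^esub> h (D 0 x) \<in> f 0 ` carrier (F (Suc 0))" if "x \<in> carrier (G (Suc 0))" for x
    using gu[OF that] If by blast
  \<comment> \<open>The next component of the homotopy, one place further along \<open>G\<close> and
    \<open>F\<close>.\<close>
  ultimately obtain h' where h': "lhom R (G (Suc 0)) (F (Suc 0)) h'"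
    "\<And>x. x \<in> carrier (G (Suc 0)) \<Longrightarrow> f 0 (h' x) = g 0 (u x) \<ominus>\<^bsub>F 0\<^esub> h (D 0 x)"
    using proj_lift[OF pG lf] by blast
  \<comment> \<open>The next component of the chain map. Both hypotheses for the shifted ladder will
    follow from \<open>D D = 0\<close>.\<close>
  obtain u' where u': "lhom R (G (Suc (Suc 0))) (A (Suc 0)) u'"
    "\<And>x. x \<in> carrier (G (Suc (Suc 0))) \<Longrightarrow> a 0 (u' x) = u (D (Suc 0) x)"
    using proj_lift[OF pG la lhom_comp[OF lD u] uD] by blast
  have "\<exists>s t. lhom R (G (Suc (Suc 0))) (A (Suc (Suc 0))) s \<and> lhom R (G (Suc 0)) (A (Suc 0)) t \<and>
    (\<forall>x\<in>carrier (G (Suc (Suc 0))). u' x = a (Suc 0) (s x) \<oplus>\<^bsub>A (Suc 0)\<^esub> t (D (Suc 0) x))"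
  proof (rule Suc.IH[OF ladder_shift[OF Suc.prems(1)] u'(1) h'(1)])
    fix x assume x: "x \<in> carrier (G (Suc (Suc (Suc 0))))"
    note Dx = lhom.closed[OF lD x]
    have "a 0 (u' (D (Suc (Suc 0)) x)) = \<zero>\<^bsub>A 0\<^esub>"
      using u'(2)[OF Dx] DD[OF x] lhom.zero[OF u] by simp
    then show "u' (D (Suc (Suc 0)) x) \<in> a (Suc 0) ` carrier (A (Suc (Suc 0)))"
      using lhom.closed[OF u'(1) Dx] ka by (auto simp: a_kernel_def')
  next
    fix x assume x: "x \<in> carrier (G (Suc (Suc 0)))"
    note Dx = lhom.closed[OF lD x]
    have c: "u' x \<in> carrier (A (Suc 0))" "h' (D (Suc 0) x) \<in> carrier (F (Suc 0))"
      by (rule lhom.closed[OF u'(1) x] lhom.closed[OF h'(1) Dx])+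
    have c': "g (Suc 0) (u' x) \<in> carrier (F (Suc 0))" by (rule lhom.closed[OF lg1 c(1)])
    have uDx: "u (D (Suc 0) x) \<in> carrier (A 0)" by (rule lhom.closed[OF u Dx])
    have "f 0 (g (Suc 0) (u' x) \<ominus>\<^bsub>F (Suc 0)\<^esub> h' (D (Suc 0) x)) =
      g 0 (u (D (Suc 0) x)) \<ominus>\<^bsub>F 0\<^esub> (g 0 (u (D (Suc 0) x)) \<ominus>\<^bsub>F 0\<^esub> h \<zero>\<^bsub>G 0\<^esub>)"
      using c c' by (simp add: fg u'(2)[OF x] h'(2)[OF Dx] DD[OF x])
    also have "\<dots> = \<zero>\<^bsub>F 0\<^esub>" using lhom.zero[OF h] uDx by simp
    finally show "g (Suc 0) (u' x) \<ominus>\<^bsub>F (Suc 0)\<^esub> h' (D (Suc 0) x) \<in> I (Suc 0)"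
      using kf f.M.diff_closed[OF c' c(2)] by (auto simp: a_kernel_def')
  qed
  then obtain s t where s: "lhom R (G (Suc (Suc 0))) (A (Suc (Suc 0))) s" and t: "lhom R (G (Suc 0)) (A (Suc 0)) t"
    and st: "\<And>x. x \<in> carrier (G (Suc (Suc 0))) \<Longrightarrow> u' x = a (Suc 0) (s x) \<oplus>\<^bsub>A (Suc 0)\<^esub> t (D (Suc 0) x)"
    by blast
  \<comment> \<open>The lift \<open>t\<close> corrects \<open>u\<close> so that it vanishes on the
    image of \<open>D\<close>. As \<open>A 0\<close> is projective, the corrected map then factors
    through \<open>D 0\<close>.\<close>
  let ?v = "\<lambda>x. u x \<ominus>\<^bsub>A 0\<^esub> a 0 (t x)"
  have v: "lhom R (G (Suc 0)) (A 0) ?v" by (rule lhom_diff[OF u lhom_comp[OF t la]])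
  interpret a: lhom R "A (Suc 0)" "A 0" "a 0" by (rule la)
  have vD: "?v (D (Suc 0) y) = \<zero>\<^bsub>A 0\<^esub>" if y: "y \<in> carrier (G (Suc (Suc 0)))" for y
  proof -
    have c: "a (Suc 0) (s y) \<in> carrier (A (Suc 0))" "t (D (Suc 0) y) \<in> carrier (A (Suc 0))"
      using lhom.closed[OF la1 lhom.closed[OF s y]] lhom.closed[OF t lhom.closed[OF lD y]] by blast+
    have "a (Suc 0) (s y) \<in> a_kernel (A (Suc 0)) (A 0) (a 0)"
      unfolding ka using lhom.closed[OF s y] by (rule imageI)
    then have "u (D (Suc 0) y) = a 0 (t (D (Suc 0) y))"
      using c by (simp add: u'(2)[OF y, symmetric] st[OF y] a_kernel_def')
    then show ?thesis using lhom.closed[OF u lhom.closed[OF lD y]] by simp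
  qed
  obtain w where w: "lhom R (G 0) (A 0) w" "\<And>x. x \<in> carrier (G (Suc 0)) \<Longrightarrow> w (D 0 x) = ?v x"
  proof (rule factor_proj[OF pA lD v, of "D (Suc 0) ` carrier (G (Suc (Suc 0)))"])
    show "z \<in> carrier (G (Suc 0)) \<and> ?v z = \<zero>\<^bsub>A 0\<^esub>" if "z \<in> D (Suc 0) ` carrier (G (Suc (Suc 0)))" for z
      using that vD lhom.closed[OF lD] by blast
  qed (use Hom in blast, rule that)
  have "u x = a 0 (t x) \<oplus>\<^bsub>A 0\<^esub> w (D 0 x)" if x: "x \<in> carrier (G (Suc 0))" for x
    using w(2)[OF x] lhom.closed[OF u x] lhom.closed[OF t x] by simp
  with t w(1) show ?case by (intro exI[of _ t] exI[of _ w]) simp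
qed

text \<open>The index is that of the incoming map: this is the vanishing of cohomology in degree
  \<open>j + 1\<close>.\<close>

definition cohom_exact where
  "cohom_exact C c j \<longleftrightarrow> a_kernel (C (Suc j)) (C (Suc (Suc j))) (c (Suc j)) = c j ` carrier (C j)"

text \<open>The locale collects what is used of the dual of a projective resolution of \<open>D(M)\<close> starting
  with the dual of a presentation of \<open>M\<close>: every functional on \<open>C (i + 1)\<close> that vanishes on the
  image of \<open>c i\<close> factors through \<open>c (i + 1)\<close>.\<close>

locale cocomplex =
  fixes R :: "'a ring" and M :: "('a, 'b) module" and C :: "nat \<Rightarrow> ('a, 'c) module"
    and c :: "nat \<Rightarrow> 'c \<Rightarrow> 'c" and \<epsilon> :: "'c \<Rightarrow> 'b"
  assumes R: "ring R" "left_noetherian R"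
    and proj_C: "\<And>i. proj R (C i)"
    and lhom_c: "\<And>i. lhom R (C i) (C (Suc i)) (c i)"
    and c_c: "\<And>i x. x \<in> carrier (C i) \<Longrightarrow> c (Suc i) (c i x) = \<zero>\<^bsub>C (Suc (Suc i))\<^esub>"
    and factor_c: "\<And>i \<phi>. \<lbrakk>lhom R (C (Suc i)) (regular_module R) \<phi>;
      \<And>x. x \<in> carrier (C i) \<Longrightarrow> \<phi> (c i x) = \<zero>\<^bsub>R\<^esub>\<rbrakk> \<Longrightarrow>
      \<exists>\<psi>. lhom R (C (Suc (Suc i))) (regular_module R) \<psi> \<and> (\<forall>x\<in>carrier (C (Suc i)). \<psi> (c (Suc i) x) = \<phi> x)"
    and lhom_eps: "lhom R (C (Suc 0)) M \<epsilon>"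
    and eps_surj: "\<epsilon> ` carrier (C (Suc 0)) = carrier M"
    and eps_ker: "a_kernel (C (Suc 0)) M \<epsilon> = c 0 ` carrier (C 0)"
begin

lemma factor_c_proj:
  assumes E: "proj R E" and g: "lhom R (C (Suc i)) E g"
    and z: "\<And>x. x \<in> carrier (C i) \<Longrightarrow> g (c i x) = \<zero>\<^bsub>E\<^esub>"
  obtains h where "lhom R (C (Suc (Suc i))) E h" "\<And>x. x \<in> carrier (C (Suc i)) \<Longrightarrow> h (c (Suc i) x) = g x"
proof (rule factor_proj[OF E lhom_c g, of "c i ` carrier (C i)"])
  show "y \<in> carrier (C (Suc i)) \<and> g y = \<zero>\<^bsub>E\<^esub>" if "y \<in> c i ` carrier (C i)" for y
    using that z lhom.closed[OF lhom_c] by blast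
  show "\<exists>\<psi>. lhom R (C (Suc (Suc i))) (regular_module R) \<psi> \<and> (\<forall>x\<in>carrier (C (Suc i)). \<psi> (c (Suc i) x) = \<phi> x)"
    if "lhom R (C (Suc i)) (regular_module R) \<phi>" "\<And>y. y \<in> c i ` carrier (C i) \<Longrightarrow> \<phi> y = \<zero>\<^bsub>R\<^esub>" for \<phi>
    using that by (intro factor_c) auto
qed (rule that)

end

text \<open>The sequence \<open>0 \<rightarrow> E 0 \<rightarrow> \<dots> \<rightarrow> E d\<close>,
  exact before its last term and with all terms after \<open>E 0\<close> projective. It is the
  sequence of a \<open>d\<close>th syzygy \<open>E 0\<close>, numbered from the left.\<close>

definition coexact where
  "coexact R d E e \<longleftrightarrow> (\<forall>i<d. lhom R (E i) (E (Suc i)) (e i) \<and> proj R (E (Suc i))) \<and>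
    (0 < d \<longrightarrow> a_kernel (E 0) (E (Suc 0)) (e 0) \<subseteq> {\<zero>\<^bsub>E 0\<^esub>}) \<and>
    (\<forall>i. Suc i < d \<longrightarrow> a_kernel (E (Suc i)) (E (Suc (Suc i))) (e (Suc i)) = e i ` carrier (E i))"

context cocomplex
begin

text \<open>The \<open>E i\<close> are not injective. The extension works because maps into
  projectives that vanish on the image of one differential of \<open>C\<close> extend along the
  next. Note the shift: \<open>C (Suc i)\<close> goes to \<open>E i\<close>.\<close>

lemma coexact_extend:
  assumes E: "coexact R d E e" and E0: "E 0 = M"
  obtains \<gamma> where "\<gamma> 0 = \<epsilon>" "\<And>i. i \<le> d \<Longrightarrow> lhom R (C (Suc i)) (E i) (\<gamma> i)"
    "\<And>i x. \<lbrakk>i < d; x \<in> carrier (C (Suc i))\<rbrakk> \<Longrightarrow> \<gamma> (Suc i) (c (Suc i) x) = e i (\<gamma> i x)"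
proof -
  \<comment> \<open>The next extension requires that \<open>e i\<close> after
    \<open>\<gamma>\<close> vanishes on the image of \<open>c i\<close>. Beyond \<open>d\<close>
    nothing is demanded, so the choice may run over all \<open>i\<close>.\<close>
  define good where "good i \<gamma> \<longleftrightarrow> (i = 0 \<longrightarrow> \<gamma> = \<epsilon>) \<and> (i \<le> d \<longrightarrow> lhom R (C (Suc i)) (E i) \<gamma> \<and>
    (i < d \<longrightarrow> (\<forall>x\<in>carrier (C i). e i (\<gamma> (c i x)) = \<zero>\<^bsub>E (Suc i)\<^esub>)))" for i \<gamma>
  have le: "lhom R (E i) (E (Suc i)) (e i)" and pE: "proj R (E (Suc i))" if "i < d" for i
    using E that by (simp_all add: coexact_def)
  have "\<exists>\<gamma>. \<forall>i. good i (\<gamma> i) \<and> (i < d \<longrightarrow> (\<forall>x\<in>carrier (C (Suc i)). \<gamma> (Suc i) (c (Suc i) x) = e i (\<gamma> i x)))"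
  proof (rule dependent_nat_choice)
    have "\<epsilon> (c 0 x) = \<zero>\<^bsub>E 0\<^esub>" if "x \<in> carrier (C 0)" for x
      using imageI[OF that, of "c 0"] unfolding eps_ker[symmetric] E0 by (simp add: a_kernel_def')
    then show "\<exists>\<gamma>. good 0 \<gamma>"
      unfolding good_def using lhom_eps lhom.zero[OF le[of 0]] by (intro exI[of _ \<epsilon>]) (simp add: E0)
  next
    fix \<gamma> i assume \<gamma>: "good i \<gamma>"
    show "\<exists>\<gamma>'. good (Suc i) \<gamma>' \<and> (i < d \<longrightarrow> (\<forall>x\<in>carrier (C (Suc i)). \<gamma>' (c (Suc i) x) = e i (\<gamma> x)))"
    proof (cases "i < d")
      case True
      then have l\<gamma>: "lhom R (C (Suc i)) (E i) \<gamma>"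
        and z: "\<And>x. x \<in> carrier (C i) \<Longrightarrow> e i (\<gamma> (c i x)) = \<zero>\<^bsub>E (Suc i)\<^esub>"
        using \<gamma> by (simp_all add: good_def)
      obtain h where h: "lhom R (C (Suc (Suc i))) (E (Suc i)) h"
        "\<And>x. x \<in> carrier (C (Suc i)) \<Longrightarrow> h (c (Suc i) x) = e i (\<gamma> x)"
        using factor_c_proj[OF pE[OF True] lhom_comp[OF l\<gamma> le[OF True]] z] by blast
      have "e (Suc i) (h (c (Suc i) x)) = \<zero>\<^bsub>E (Suc (Suc i))\<^esub>" if "Suc i < d" "x \<in> carrier (C (Suc i))" for x
      proof -
        have "e i (\<gamma> x) \<in> a_kernel (E (Suc i)) (E (Suc (Suc i))) (e (Suc i))"
          using E that lhom.closed[OF l\<gamma>] by (simp add: coexact_def)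
        then show ?thesis using h(2) that by (simp add: a_kernel_def')
      qed
      with h show ?thesis unfolding good_def by blast
    next
      case False
      then show ?thesis by (simp add: good_def)
    qed
  qed
  then obtain \<gamma> where "\<And>i. good i (\<gamma> i)"
    "\<And>i x. \<lbrakk>i < d; x \<in> carrier (C (Suc i))\<rbrakk> \<Longrightarrow> \<gamma> (Suc i) (c (Suc i) x) = e i (\<gamma> i x)" by blast
  then show ?thesis by (intro that[of \<gamma>]) (auto simp: good_def)
qed

text \<open>\<open>X\<close> is any module that \<open>\<pi>\<close> presents as cocycles modulo
  boundaries in degree \<open>n + 1\<close>, because Ext may come from another resolution. The
  sequence \<open>E\<close> reaches one place beyond the ladder: cocycles become zero in
  \<open>E (Suc n)\<close>, and this starts the homotopy.\<close>

lemma cohom_exact_step: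
  fixes X :: "('a, 'x) module"
  assumes E: "coexact R (Suc n) E e" and E0: "E 0 = M"
    and H: "\<And>j. j < n \<Longrightarrow> cohom_exact C c j"
    and \<pi>: "lhom R (sub (C (Suc n)) (a_kernel (C (Suc n)) (C (Suc (Suc n))) (c (Suc n)))) X \<pi>"
      "\<pi> ` a_kernel (C (Suc n)) (C (Suc (Suc n))) (c (Suc n)) = carrier X"
      "\<And>x. x \<in> a_kernel (C (Suc n)) (C (Suc (Suc n))) (c (Suc n)) \<Longrightarrow>
         \<pi> x = \<zero>\<^bsub>X\<^esub> \<longleftrightarrow> x \<in> c n ` carrier (C n)"
    and gr: "grade_ge R X n"
  shows "cohom_exact C c n"
proof -
  let ?K = "a_kernel (C (Suc n)) (C (Suc (Suc n))) (c (Suc n))"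
  have sK: "subm R (C (Suc n)) ?K" by (rule subm_kernel[OF lhom_c])
  have lC: "left_module R (C i)" for i by (rule proj_left_module[OF proj_C])
  have fgX: "fg_module R X"
    by (rule fg_module_surj[OF fg_module_sub_kernel[OF R proj_fg[OF proj_C] lhom_c] \<pi>(1)]) (simp add: \<pi>(2))
  note lX = fg_module_left_module[OF fgX]
  obtain G :: "nat \<Rightarrow> ('a, 'a univ) module" and \<delta> \<eta> where G: "proj_resolution R X G \<delta> \<eta>"
    and Hom0: "0 < n \<longrightarrow> (\<forall>\<phi>. lhom R (G 0) (regular_module R) \<phi> \<longrightarrow>
       (\<forall>x\<in>carrier (G (Suc 0)). \<phi> (\<delta> 0 x) = \<zero>\<^bsub>R\<^esub>) \<longrightarrow> (\<forall>x\<in>carrier (G 0). \<phi> x = \<zero>\<^bsub>R\<^esub>))"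
    and HomS: "\<forall>i \<phi>. Suc i < n \<longrightarrow> lhom R (G (Suc i)) (regular_module R) \<phi> \<longrightarrow>
       (\<forall>x\<in>carrier (G (Suc (Suc i))). \<phi> (\<delta> (Suc i) x) = \<zero>\<^bsub>R\<^esub>) \<longrightarrow>
       (\<exists>\<psi>. lhom R (G i) (regular_module R) \<psi> \<and> (\<forall>x\<in>carrier (G (Suc i)). \<psi> (\<delta> i x) = \<phi> x))"
    using grade_ge_exact[OF R fgX gr] .
  note GD = proj_resolutionD[OF lX G]
  \<comment> \<open>\<open>u\<close> represents the generators of \<open>X\<close> by cocycles; the
    aim is to show that all of these are boundaries.\<close>
  obtain u where u: "lhom R (G 0) (sub (C (Suc n)) ?K) u" "\<And>x. x \<in> carrier (G 0) \<Longrightarrow> \<pi> (u x) = \<eta> x"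
    using proj_lift[OF GD(1) \<pi>(1) GD(4)] \<pi>(2) lhom.closed[OF GD(4)] by auto
  have uC: "lhom R (G 0) (C (Suc n)) u" by (rule lhom_sub_codD[OF u(1) lC sK])
  have uK: "u x \<in> ?K" if "x \<in> carrier (G 0)" for x using lhom.closed[OF u(1) that] by simp
  obtain \<gamma> where \<gamma>0: "\<gamma> 0 = \<epsilon>" and l\<gamma>: "\<And>i. i \<le> Suc n \<Longrightarrow> lhom R (C (Suc i)) (E i) (\<gamma> i)"
    and \<gamma>c: "\<And>i x. \<lbrakk>i < Suc n; x \<in> carrier (C (Suc i))\<rbrakk> \<Longrightarrow> \<gamma> (Suc i) (c (Suc i) x) = e i (\<gamma> i x)"
    using coexact_extend[OF E E0] by blast
  \<comment> \<open>A zero module is put below \<open>G 0\<close>. The splitting then loses its term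
    through \<open>D 0\<close>, and the vanishing of Hom(X, R) takes the same form as exactness in
    the other degrees.\<close>
  define Z where "Z = sub (G 0) {\<zero>\<^bsub>G 0\<^esub>}"
  interpret G0: left_module R "G 0" by (rule GD(7))
  have lZ: "left_module R Z" unfolding Z_def by (rule left_module_sub[OF GD(7) subm_zero[OF GD(7)]])
  have "dual_basis R Z 0 (\<lambda>_. undefined) (\<lambda>_. undefined)" by (simp add: dual_basis_def Z_def)
  then have pZ: "proj R Z" using lZ proj_iff_dual_basis by blast
  define G' where "G' i = (case i of 0 \<Rightarrow> Z | Suc j \<Rightarrow> G j)" for i
  define D where "D i = (case i of 0 \<Rightarrow> (\<lambda>_. \<zero>\<^bsub>G 0\<^esub>) | Suc j \<Rightarrow> \<delta> j)" for i
  have z: "lhom R (G 0) Z (\<lambda>_. \<zero>\<^bsub>G 0\<^esub>)" using lhom_zero[OF GD(7)[of 0] lZ] by (simp add: Z_def)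
  \<comment> \<open>\<open>C\<close> and \<open>E\<close> are read backwards: the ladder starts at
    \<open>C (Suc n)\<close> and \<open>E n\<close> and ends with the cokernel map from
    \<open>C 1\<close> to \<open>M\<close>, at index \<open>n\<close>, where \<open>a n\<close> is
    \<open>c 0\<close>.\<close>
  define A where "A i = C (Suc n - i)" for i
  define a where "a i = c (n - i)" for i
  define F where "F i = E (n - i)" for i
  define f where "f i = e (n - Suc i)" for i
  define g where "g i = \<gamma> (n - i)" for i
  define I where "I i = (if i < n then f i ` carrier (F (Suc i)) else {\<zero>\<^bsub>F i\<^esub>})" for i
  have le: "lhom R (E i) (E (Suc i)) (e i)" if "i < Suc n" for i using E that by (simp add: coexact_def)
  have inj: "a_kernel (E 0) (E (Suc 0)) (e 0) \<subseteq> {\<zero>\<^bsub>E 0\<^esub>}" using E by (simp add: coexact_def)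
  have ex: "a_kernel (E (Suc i)) (E (Suc (Suc i))) (e (Suc i)) = e i ` carrier (E i)" if "i < n" for i
    using E that by (simp add: coexact_def)
  \<comment> \<open>The case \<open>i = 0\<close> uses the map from \<open>E n\<close> to
    \<open>E (Suc n)\<close>, which is not a rung of the ladder.\<close>
  have Ik: "a_kernel (E (n - i)) (E (Suc (n - i))) (e (n - i)) \<subseteq> I i" if "i \<le> n" for i
  proof (cases "i = n")
    case True
    then show ?thesis using inj by (simp add: I_def F_def)
  next
    case False
    with that have "n - i = Suc (n - Suc i)" "n - Suc i < n" by auto
    then show ?thesis using ex[of "n - Suc i"] False that by (simp add: I_def f_def F_def)
  qed
  have lad: "ladder R n G' D A a F f g I"
    unfolding ladder_def
  proof (intro conjI allI impI ballI)
    fix i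
    show "proj R (G' i)" using pZ GD(1) by (simp add: G'_def split: nat.split)
    show "lhom R (G' (Suc i)) (G' i) (D i)" using z GD(2) by (simp add: G'_def D_def split: nat.split)
    fix x assume x: "x \<in> carrier (G' (Suc (Suc i)))"
    show "D i (D (Suc i) x) = \<zero>\<^bsub>G' i\<^esub>"
    proof (cases i)
      case 0
      then show ?thesis by (simp add: D_def G'_def Z_def)
    next
      case (Suc j)
      then have "\<delta> (Suc j) x \<in> a_kernel (G (Suc j)) (G j) (\<delta> j)"
        unfolding GD(3)[symmetric] using x by (intro imageI) (simp add: G'_def)
      then show ?thesis using Suc by (simp add: D_def G'_def a_kernel_def')
    qed
  next
    fix i \<phi> assume i: "i < n" and \<phi>: "lhom R (G' (Suc i)) (regular_module R) \<phi>"
      "\<forall>x\<in>carrier (G' (Suc (Suc i))). \<phi> (D (Suc i) x) = \<zero>\<^bsub>R\<^esub>"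
    show "\<exists>\<psi>. lhom R (G' i) (regular_module R) \<psi> \<and> (\<forall>x\<in>carrier (G' (Suc i)). \<psi> (D i x) = \<phi> x)"
    proof (cases i)
      case 0
      then have "\<phi> x = \<zero>\<^bsub>R\<^esub>" if "x \<in> carrier (G 0)" for x
        using \<phi> i that Hom0 by (simp add: G'_def D_def)
      moreover have "lhom R Z (regular_module R) (\<lambda>_. \<zero>\<^bsub>R\<^esub>)"
        using lhom_zero[OF lZ left_module_regular[OF R(1)]] by simp
      ultimately show ?thesis using 0 by (intro exI[of _ "\<lambda>_. \<zero>\<^bsub>R\<^esub>"]) (simp add: G'_def)
    next
      case (Suc j)
      then show ?thesis using HomS[rule_format, of j \<phi>] i \<phi> by (simp add: G'_def D_def)
    qed
  next
    fix i assume i: "i \<le> n"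
    then have s: "Suc n - i = Suc (n - i)" by simp
    show "proj R (A i)" "lhom R (A (Suc i)) (A i) (a i)" "lhom R (A i) (F i) (g i)"
      using proj_C lhom_c l\<gamma>[of "n - i"] by (simp_all add: A_def a_def F_def g_def s)
  next
    fix i assume i: "i < n"
    then have s: "Suc n - i = Suc (Suc (n - Suc i))" "n - i = Suc (n - Suc i)" by auto
    show "a_kernel (A (Suc i)) (A i) (a i) = a (Suc i) ` carrier (A (Suc (Suc i)))"
      using H[of "n - Suc i"] i by (simp add: A_def a_def s cohom_exact_def)
    show "lhom R (F (Suc i)) (F i) (f i)" using le[of "n - Suc i"] i by (simp add: F_def f_def s)
    show "I i \<subseteq> f i ` carrier (F (Suc i))" using i by (simp add: I_def)
    show "a_kernel (F (Suc i)) (F i) (f i) \<subseteq> I (Suc i)"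
      using Ik[of "Suc i"] i by (simp add: F_def f_def s)
    fix x assume x: "x \<in> carrier (A (Suc i))"
    then show "f i (g (Suc i) x) = g i (a i x)"
      using \<gamma>c[of "n - Suc i" x] i by (simp add: A_def a_def g_def f_def s)
  next
    show "I n \<subseteq> {\<zero>\<^bsub>F n\<^esub>}" by (simp add: I_def)
    show "g n ` carrier (A n) = carrier (F n)"
      using eps_surj by (simp add: g_def A_def F_def \<gamma>0 E0)
    show "a_kernel (A n) (F n) (g n) \<subseteq> a n ` carrier (A (Suc n))"
      using eps_ker by (simp add: g_def A_def F_def a_def \<gamma>0 E0)
  qed
  have lF: "left_module R (F 0)" using lhom_modules(2)[OF l\<gamma>[of n]] by (simp add: F_def)
  interpret F0: left_module R "F 0" by (rule lF)
  have "\<exists>s t. lhom R (G' (Suc 0)) (A (Suc 0)) s \<and> lhom R (G' 0) (A 0) t \<and>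
    (\<forall>x\<in>carrier (G' (Suc 0)). u x = a 0 (s x) \<oplus>\<^bsub>A 0\<^esub> t (D 0 x))"
  proof (rule ladder_split[OF lad])
    show "lhom R (G' (Suc 0)) (A 0) u" using uC by (simp add: G'_def A_def)
    show "lhom R (G' 0) (F 0) (\<lambda>_. \<zero>\<^bsub>F 0\<^esub>)" using lhom_zero[OF lZ lF] by (simp add: G'_def)
    fix x assume x: "x \<in> carrier (G' (Suc (Suc 0)))"
    then have "\<delta> 0 x \<in> a_kernel (G 0) X \<eta>"
      unfolding GD(6)[symmetric] by (intro imageI) (simp add: G'_def)
    then have z: "\<delta> 0 x \<in> carrier (G 0)" "\<eta> (\<delta> 0 x) = \<zero>\<^bsub>X\<^esub>" by (simp_all add: a_kernel_def')
    have "u (\<delta> 0 x) \<in> c n ` carrier (C n)" using \<pi>(3)[OF uK[OF z(1)]] u(2)[OF z(1)] z(2) by simp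
    then show "u (D (Suc 0) x) \<in> a 0 ` carrier (A (Suc 0))"
      by (simp add: D_def a_def A_def)
  next
    fix x assume "x \<in> carrier (G' (Suc 0))"
    then have x: "x \<in> carrier (G 0)" by (simp add: G'_def)
    have cu: "u x \<in> carrier (C (Suc n))" "c (Suc n) (u x) = \<zero>\<^bsub>C (Suc (Suc n))\<^esub>"
      using uK[OF x] by (simp_all add: a_kernel_def')
    \<comment> \<open>A cocycle dies in \<open>E (Suc n)\<close>, so its image in \<open>E n\<close>
      lies in \<open>I 0\<close>. Therefore the homotopy can start with the zero map.\<close>
    have "e n (\<gamma> n (u x)) = \<zero>\<^bsub>E (Suc n)\<^esub>"
      using \<gamma>c[OF _ cu(1)] cu(2) lhom.zero[OF l\<gamma>[of "Suc n"]] by simp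
    moreover have gu: "\<gamma> n (u x) \<in> carrier (E n)" using lhom.closed[OF l\<gamma> cu(1)] by simp
    ultimately have "\<gamma> n (u x) \<in> I 0" using Ik[of 0] by (auto simp: a_kernel_def')
    then show "g 0 (u x) \<ominus>\<^bsub>F 0\<^esub> \<zero>\<^bsub>F 0\<^esub> \<in> I 0"
      using gu F0.diff_zero[of "\<gamma> n (u x)"] by (simp add: g_def F_def)
  qed
  then obtain s t where s: "lhom R (G 0) (C n) s" and t: "lhom R Z (C (Suc n)) t"
    and st: "\<And>x. x \<in> carrier (G 0) \<Longrightarrow> u x = c n (s x) \<oplus>\<^bsub>C (Suc n)\<^esub> t \<zero>\<^bsub>G 0\<^esub>"
    by (auto simp: G'_def A_def a_def D_def)
  interpret Cn: left_module R "C (Suc n)" by (rule lC)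
  have "t \<zero>\<^bsub>G 0\<^esub> = \<zero>\<^bsub>C (Suc n)\<^esub>" using lhom.zero[OF t] by (simp add: Z_def)
  then have us: "u x = c n (s x)" if "x \<in> carrier (G 0)" for x
    using st[OF that] lhom.closed[OF lhom_c lhom.closed[OF s that]] by simp
  have X0: "y = \<zero>\<^bsub>X\<^esub>" if y: "y \<in> carrier X" for y
  proof -
    obtain x where x: "x \<in> carrier (G 0)" "y = \<eta> x" using y GD(5) by (metis imageE)
    have "u x \<in> c n ` carrier (C n)" using us[OF x(1)] lhom.closed[OF s x(1)] by simp
    then show ?thesis using \<pi>(3)[OF uK[OF x(1)]] u(2)[OF x(1)] x(2) by simp
  qed
  have "?K \<subseteq> c n ` carrier (C n)"
  proof
    fix x assume x: "x \<in> ?K"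
    then have "\<pi> x \<in> carrier X" using \<pi>(2) by blast
    then show "x \<in> c n ` carrier (C n)" using X0 \<pi>(3)[OF x] by blast
  qed
  moreover have "c n ` carrier (C n) \<subseteq> ?K"
    using lhom.closed[OF lhom_c] c_c by (auto simp: a_kernel_def')
  ultimately show ?thesis by (simp add: cohom_exact_def)
qed

end

section \<open>Syzygies and Evans-Griffith representations\<close>

lemma short_exact_lhom:
  assumes "short_exact R S \<alpha> B \<beta> M" "left_module R S" "left_module R B" "left_module R M"
  shows "lhom R S B \<alpha>" "lhom R B M \<beta>" "inj_on \<alpha> (carrier S)" "\<beta> ` carrier B = carrier M"
    "\<alpha> ` carrier S = a_kernel B M \<beta>"
  using assms by (simp_all add: short_exact_def lhom_iff)

lemma short_exactI:
  assumes "lhom R S B \<alpha>" "lhom R B M \<beta>" "inj_on \<alpha> (carrier S)" "\<beta> ` carrier B = carrier M"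
    "\<alpha> ` carrier S = a_kernel B M \<beta>"
  shows "short_exact R S \<alpha> B \<beta> M"
  using assms by (simp add: short_exact_def lhom_iff)

lemma short_exact_kernel:
  assumes "lhom R B M \<beta>" "\<beta> ` carrier B = carrier M"
  shows "short_exact R (sub B (a_kernel B M \<beta>)) (\<lambda>x. x) B \<beta> M"
  using assms lhom_incl[OF lhom_modules(1)[OF assms(1)] subm_kernel[OF assms(1)]]
  by (intro short_exactI) simp_all

text \<open>The new sequence begins
  \<open>0 \<rightarrow> L \<rightarrow> V \<rightarrow> P (n - 1)\<close>. Projectives are numbered
  from the right end, so the copy of \<open>V\<close> takes index \<open>n\<close> and the others
  keep theirs. For \<open>n = 0\<close> no term precedes, and the last three conclusions describe
  the copy as a cover of \<open>S\<close>.\<close>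

lemma exact_proj_seq_extend:
  fixes P :: "nat \<Rightarrow> ('a, 'a univ) module" and S :: "('a, 's) module" and V :: "('a, 'v) module"
  assumes ex: "exact_proj_seq R n S \<iota> P \<delta>" and V: "proj R V" and S: "left_module R S" and L: "left_module R L"
    and se: "short_exact R L i V p S"
  obtains \<iota>' and P' :: "nat \<Rightarrow> ('a, 'a univ) module" and \<delta>' p'
  where "exact_proj_seq R (Suc n) L \<iota>' P' \<delta>'" "\<forall>i<n. P' i = P i" "\<forall>i. Suc i < n \<longrightarrow> \<delta>' i = \<delta> i"
    "0 < n \<longrightarrow> \<delta>' (n - 1) ` carrier (P' n) = \<iota> ` carrier S"
    "lhom R (P' n) S p'" "p' ` carrier (P' n) = carrier S" "\<iota>' ` carrier L = a_kernel (P' n) S p'"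
proof -
  note se = short_exact_lhom[OF se L proj_left_module[OF V] S]
  obtain V' :: "('a, 'a univ) module" and \<phi> where \<phi>: "lhom R V V' \<phi>" "bij_betw \<phi> (carrier V) (carrier V')"
    using univ_copy[OF proj_fg[OF V]] .
  obtain \<psi> where \<psi>: "lhom R V' V \<psi>" "\<And>x. x \<in> carrier V \<Longrightarrow> \<psi> (\<phi> x) = x"
    "\<And>y. y \<in> carrier V' \<Longrightarrow> \<psi> y \<in> carrier V \<and> \<phi> (\<psi> y) = y"
    using lhom_inv[OF \<phi>] by blast
  define p' where "p' x = p (\<psi> x)" for x
  define P' where "P' j = (if j = n then V' else P j)" for j
  define \<delta>' where "\<delta>' j = (if Suc j = n then (\<lambda>x. \<iota> (p' x)) else \<delta> j)" for j
  define \<iota>' where "\<iota>' x = \<phi> (i x)" for x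
  have p': "lhom R V' S p'" unfolding p'_def by (rule lhom_comp[OF \<psi>(1) se(2)])
  have \<iota>': "lhom R L V' \<iota>'" unfolding \<iota>'_def by (rule lhom_comp[OF se(1) \<phi>(1)])
  have "y \<in> p' ` carrier V'" if y: "y \<in> carrier S" for y
  proof -
    obtain x where x: "x \<in> carrier V" "y = p x" using y se(4) by (metis imageE)
    then show ?thesis
      unfolding p'_def using \<psi>(2)[OF x(1)] lhom.closed[OF \<phi>(1) x(1)] by (intro image_eqI[of _ _ "\<phi> x"]) simp_all
  qed
  then have sp': "p' ` carrier V' = carrier S" using lhom.closed[OF p'] by blast
  have ker: "\<iota>' ` carrier L = a_kernel V' S p'"
  proof (intro equalityI subsetI)
    fix y assume "y \<in> \<iota>' ` carrier L"
    then obtain x where x: "x \<in> carrier L" "y = \<phi> (i x)" by (auto simp: \<iota>'_def)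
    have "i x \<in> a_kernel V S p" unfolding se(5)[symmetric] using x(1) by (rule imageI)
    then show "y \<in> a_kernel V' S p'"
      using \<psi>(2) lhom.closed[OF \<phi>(1)] x(2) by (simp add: a_kernel_def' p'_def)
  next
    fix y assume "y \<in> a_kernel V' S p'"
    then have y: "y \<in> carrier V'" "p (\<psi> y) = \<zero>\<^bsub>S\<^esub>" by (simp_all add: a_kernel_def' p'_def)
    then have "\<psi> y \<in> a_kernel V S p" using \<psi>(3) by (simp add: a_kernel_def')
    then obtain x where x: "x \<in> carrier L" "\<psi> y = i x" unfolding se(5)[symmetric] by blast
    then have "y = \<iota>' x" using \<psi>(3)[OF y(1)] by (simp add: \<iota>'_def)
    with x(1) show "y \<in> \<iota>' ` carrier L" by blast
  qed
  have inj: "inj_on \<iota>' (carrier L)"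
    unfolding \<iota>'_def using se(3) \<phi>(2) lhom.closed[OF se(1)]
    by (intro inj_onI) (metis bij_betw_imp_inj_on inj_onD)
  have pP: "proj R (P j)" if "j < n" for j
    using ex that by (simp add: exact_proj_seq_def fg_projective_iff_proj)
  have lP: "left_module R (P j)" if "j < n" for j by (rule proj_left_module[OF pP[OF that]])
  have d: "lhom R (P (Suc j)) (P j) (\<delta> j)" if "Suc j < n" for j
    using ex that lP[OF that] lP[OF Suc_lessD[OF that]] by (simp add: exact_proj_seq_def lhom_iff)
  have \<iota>: "lhom R S (P (n - 1)) \<iota>" "inj_on \<iota> (carrier S)" if "0 < n"
    using ex that lP[of "n - 1"] S by (simp_all add: exact_proj_seq_def lhom_iff)
  have \<iota>k: "\<iota> ` carrier S = a_kernel (P (n - 1)) (P (n - 2)) (\<delta> (n - 2))" if "1 < n"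
    using ex that by (simp add: exact_proj_seq_def)
  have dk: "\<delta> (Suc j) ` carrier (P (Suc (Suc j))) = a_kernel (P (Suc j)) (P j) (\<delta> j)" if "Suc (Suc j) < n" for j
    using ex that by (simp add: exact_proj_seq_def)
  have im: "(\<lambda>x. \<iota> (p' x)) ` carrier V' = \<iota> ` carrier S"
    using sp' by (metis image_image)
  have "exact_proj_seq R (Suc n) L \<iota>' P' \<delta>'"
    unfolding exact_proj_seq_def fg_projective_iff_proj
  proof (intro conjI allI impI)
    show "proj R (P' j)" if "j < Suc n" for j
      using pP that proj_iso[OF V \<phi>] by (simp add: P'_def)
    show "\<delta>' j \<in> mod_hom R (P' (Suc j)) (P' j)" if "Suc j < Suc n" for j
    proof (cases "Suc j = n")
      case True
      then show ?thesis using lhom_comp[OF p' \<iota>(1)] by (auto simp: P'_def \<delta>'_def lhom_iff)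
    next
      case False
      then show ?thesis using d[of j] that by (simp add: P'_def \<delta>'_def lhom_iff)
    qed
    show "\<delta>' (Suc j) ` carrier (P' (Suc (Suc j))) = a_kernel (P' (Suc j)) (P' j) (\<delta>' j)"
      if "Suc (Suc j) < Suc n" for j
    proof (cases "Suc (Suc j) = n")
      case True
      then show ?thesis using im \<iota>k by (auto simp: P'_def \<delta>'_def)
    next
      case False
      then show ?thesis using dk[of j] that by (simp add: P'_def \<delta>'_def)
    qed
    show "\<iota>' \<in> mod_hom R L (P' (Suc n - 1))" using \<iota>' by (simp add: P'_def lhom_iff)
    show "inj_on \<iota>' (carrier L)" by (rule inj)
    show "\<iota>' ` carrier L = a_kernel (P' (Suc n - 1)) (P' (Suc n - 2)) (\<delta>' (Suc n - 2))" if "1 < Suc n"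
    proof -
      have n: "0 < n" using that by simp
      have "\<iota> (p' x) = \<zero>\<^bsub>P (n - 1)\<^esub> \<longleftrightarrow> p' x = \<zero>\<^bsub>S\<^esub>" if "x \<in> carrier V'" for x
        using inj_on_lhom_iff[OF \<iota>(1)[OF n]] \<iota>(2)[OF n] lhom.closed[OF p' that] lhom.zero[OF \<iota>(1)[OF n]] by metis
      then have "a_kernel V' S p' = a_kernel V' (P (n - 1)) (\<lambda>x. \<iota> (p' x))" by (auto simp: a_kernel_def')
      then show ?thesis using ker n by (cases n) (simp_all add: P'_def \<delta>'_def)
    qed
  qed
  then show ?thesis
    by (rule that) (use im p' sp' ker in \<open>auto simp: P'_def \<delta>'_def\<close>)
qed

lemma in_Omega_Suc:
  fixes S :: "('a, 's) module" and V :: "('a, 'v) module"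
  assumes S: "in_Omega R n S" and V: "proj R V" and L: "fg_module R L" and se: "short_exact R L i V p S"
  shows "in_Omega R (Suc n) L"
proof -
  obtain \<iota> and P :: "nat \<Rightarrow> ('a, 'a univ) module" and \<delta> where ex: "exact_proj_seq R n S \<iota> P \<delta>"
    and fg: "fg_module R S" using S by (auto simp: in_Omega_def)
  obtain \<iota>' and P' :: "nat \<Rightarrow> ('a, 'a univ) module" and \<delta>' p' where "exact_proj_seq R (Suc n) L \<iota>' P' \<delta>'"
    by (rule exact_proj_seq_extend[OF ex V fg_module_left_module[OF fg] fg_module_left_module[OF L] se])
  then show ?thesis using L unfolding in_Omega_def by blast
qed

text \<open>The recursion on syzygies starts in degree 1, because \<open>is_syzygy\<close> has a
  different shape in degree 0.\<close>

lemma is_syzygy_Suc_0: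
  fixes X :: "('a, 'x) module" and V :: "('a, 'v) module"
  assumes V: "proj R V" and L: "left_module R L" and X: "left_module R X" and se: "short_exact R L i V p X"
  shows "is_syzygy R (Suc 0) X L"
proof -
  \<comment> \<open>In length 0 nothing is required, so arbitrary data form the sequence that is to
    be extended.\<close>
  have ex: "exact_proj_seq R 0 X undefined (\<lambda>_. undefined :: ('a, 'a univ) module) undefined"
    by (simp add: exact_proj_seq_def)
  obtain \<iota>' and P' :: "nat \<Rightarrow> ('a, 'a univ) module" and \<delta>' p' where "exact_proj_seq R (Suc 0) L \<iota>' P' \<delta>'"
    "lhom R (P' 0) X p'" "p' ` carrier (P' 0) = carrier X" "\<iota>' ` carrier L = a_kernel (P' 0) X p'"
    by (rule exact_proj_seq_extend[OF ex V X L se])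
  then show ?thesis using L unfolding is_syzygy_def lhom_iff by auto
qed

lemma is_syzygy_Suc:
  fixes S :: "('a, 's) module" and V :: "('a, 'v) module"
  assumes S: "is_syzygy R (Suc n) X S" and V: "proj R V" and L: "left_module R L" and se: "short_exact R L i V p S"
  shows "is_syzygy R (Suc (Suc n)) X L"
proof -
  obtain \<iota> and P :: "nat \<Rightarrow> ('a, 'a univ) module" and \<delta> \<epsilon> where ex: "exact_proj_seq R (Suc n) S \<iota> P \<delta>"
    and \<epsilon>: "\<epsilon> \<in> mod_hom R (P 0) X" "\<epsilon> ` carrier (P 0) = carrier X"
      "(if n = 0 then \<iota> ` carrier S else \<delta> 0 ` carrier (P 1)) = a_kernel (P 0) X \<epsilon>"
    and lS: "left_module R S" using S by (auto simp: is_syzygy_def)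
  obtain \<iota>' and P' :: "nat \<Rightarrow> ('a, 'a univ) module" and \<delta>' p' where ex': "exact_proj_seq R (Suc (Suc n)) L \<iota>' P' \<delta>'"
    and P': "\<forall>i<Suc n. P' i = P i" "\<forall>i. Suc i < Suc n \<longrightarrow> \<delta>' i = \<delta> i"
      "0 < Suc n \<longrightarrow> \<delta>' (Suc n - 1) ` carrier (P' (Suc n)) = \<iota> ` carrier S"
    by (rule exact_proj_seq_extend[OF ex V lS L se])
  have "\<delta>' 0 ` carrier (P' 1) = a_kernel (P 0) X \<epsilon>"
    using \<epsilon>(3) P' by (cases n) simp_all
  moreover have "P' 0 = P 0" using P'(1) by simp
  ultimately show ?thesis
    unfolding is_syzygy_def using L ex' \<epsilon>(1,2)
    by (simp, intro exI[of _ \<iota>'] exI[of _ P'] exI[of _ \<delta>'] exI[of _ \<epsilon>] conjI) simp_all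
qed

lemma in_Omega_iso:
  fixes S :: "('a, 's) module" and S' :: "('a, 't) module"
  assumes S: "in_Omega R n S" and \<sigma>: "lhom R S' S \<sigma>" "bij_betw \<sigma> (carrier S') (carrier S)"
    and fg: "fg_module R S'"
  shows "in_Omega R n S'"
proof -
  obtain \<iota> and P :: "nat \<Rightarrow> ('a, 'a univ) module" and \<delta> where ex: "exact_proj_seq R n S \<iota> P \<delta>"
    using S by (auto simp: in_Omega_def)
  have im: "(\<lambda>x. \<iota> (\<sigma> x)) ` carrier S' = \<iota> ` carrier S"
    using \<sigma>(2) by (metis bij_betw_imp_surj_on image_image)
  have "(\<lambda>x. \<iota> (\<sigma> x)) \<in> mod_hom R S' (P (n - 1))" "inj_on (\<lambda>x. \<iota> (\<sigma> x)) (carrier S')" if "0 < n"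
  proof -
    have \<iota>: "\<iota> \<in> mod_hom R S (P (n - 1))" "inj_on \<iota> (carrier S)" and P: "left_module R (P (n - 1))"
      using ex that by (simp_all add: exact_proj_seq_def fg_projective_iff_proj proj_left_module)
    show "(\<lambda>x. \<iota> (\<sigma> x)) \<in> mod_hom R S' (P (n - 1))"
      using lhom_comp[OF \<sigma>(1), of "P (n - 1)" \<iota>] \<iota>(1) P lhom_modules(2)[OF \<sigma>(1)] by (simp add: lhom_iff)
    show "inj_on (\<lambda>x. \<iota> (\<sigma> x)) (carrier S')"
      using comp_inj_on[of \<sigma> "carrier S'" \<iota>] \<sigma>(2) \<iota>(2) by (simp add: bij_betw_def comp_def)
  qed
  then have "exact_proj_seq R n S' (\<lambda>x. \<iota> (\<sigma> x)) P \<delta>"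
    using ex unfolding exact_proj_seq_def im by simp
  then show ?thesis using fg unfolding in_Omega_def by blast
qed

text \<open>Keeps an iterated construction within one type: the two terms on the left are copied
  back to \<open>'a univ\<close>, while the right end stays as it is.\<close>

lemma short_exact_univ:
  fixes S :: "('a, 's) module" and B :: "('a, 'b) module" and M :: "('a, 'm) module"
  assumes se: "short_exact R S \<alpha> B \<beta> M" and fg: "fg_module R S" "fg_module R B" and M: "left_module R M"
  obtains S' B' :: "('a, 'a univ) module" and \<sigma> \<phi> \<alpha>' \<beta>'
  where "short_exact R S' \<alpha>' B' \<beta>' M" "fg_module R S'" "fg_module R B'"
    "lhom R S' S \<sigma>" "bij_betw \<sigma> (carrier S') (carrier S)" "lhom R B' B \<phi>" "bij_betw \<phi> (carrier B') (carrier B)"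
proof -
  note se = short_exact_lhom[OF se fg_module_left_module[OF fg(1)] fg_module_left_module[OF fg(2)] M]
  obtain S' :: "('a, 'a univ) module" and \<sigma>
    where \<sigma>: "lhom R S' S \<sigma>" "bij_betw \<sigma> (carrier S') (carrier S)" "fg_module R S'"
    using univ_copy_inv[OF fg(1)] .
  obtain B' :: "('a, 'a univ) module" and \<phi>
    where \<phi>: "lhom R B' B \<phi>" "bij_betw \<phi> (carrier B') (carrier B)" "fg_module R B'"
    using univ_copy_inv[OF fg(2)] .
  obtain \<psi> where \<psi>: "lhom R B B' \<psi>" "\<And>x. x \<in> carrier B' \<Longrightarrow> \<psi> (\<phi> x) = x"
    "\<And>y. y \<in> carrier B \<Longrightarrow> \<psi> y \<in> carrier B' \<and> \<phi> (\<psi> y) = y"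
    using lhom_inv[OF \<phi>(1,2)] by blast
  define a where "a x = \<alpha> (\<sigma> x)" for x
  have a: "lhom R S' B a" unfolding a_def by (rule lhom_comp[OF \<sigma>(1) se(1)])
  have ia: "inj_on a (carrier S')"
    unfolding a_def using comp_inj_on[of \<sigma> "carrier S'" \<alpha>] \<sigma>(2) se(3) by (simp add: bij_betw_def comp_def)
  have ra: "a ` carrier S' = a_kernel B M \<beta>"
    unfolding a_def using \<sigma>(2) se(5) by (metis bij_betw_imp_surj_on image_image)
  have "short_exact R S' (\<lambda>x. \<psi> (a x)) B' (\<lambda>y. \<beta> (\<phi> y)) M"
  proof (rule short_exactI[OF lhom_comp[OF a \<psi>(1)] lhom_comp[OF \<phi>(1) se(2)]])
    show "inj_on (\<lambda>x. \<psi> (a x)) (carrier S')"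
    proof (rule inj_onI)
      fix x y assume xy: "x \<in> carrier S'" "y \<in> carrier S'" and eq: "\<psi> (a x) = \<psi> (a y)"
      have "a x = \<phi> (\<psi> (a x))" using \<psi>(3)[OF lhom.closed[OF a xy(1)]] by simp
      also have "\<dots> = \<phi> (\<psi> (a y))" by (rule arg_cong[OF eq])
      also have "\<dots> = a y" using \<psi>(3)[OF lhom.closed[OF a xy(2)]] by simp
      finally show "x = y" using inj_onD[OF ia] xy by blast
    qed
    show "(\<lambda>y. \<beta> (\<phi> y)) ` carrier B' = carrier M"
      using se(4) \<phi>(2) by (metis bij_betw_imp_surj_on image_image)
    show "(\<lambda>x. \<psi> (a x)) ` carrier S' = a_kernel B' M (\<lambda>y. \<beta> (\<phi> y))"
    proof (intro equalityI subsetI)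
      fix y assume "y \<in> (\<lambda>x. \<psi> (a x)) ` carrier S'"
      then obtain x where x: "x \<in> carrier S'" "y = \<psi> (a x)" by blast
      have "a x \<in> a_kernel B M \<beta>" unfolding ra[symmetric] using x(1) by (rule imageI)
      then show "y \<in> a_kernel B' M (\<lambda>y. \<beta> (\<phi> y))"
        using \<psi>(3)[of "a x"] x(2) by (simp add: a_kernel_def')
    next
      fix y assume "y \<in> a_kernel B' M (\<lambda>y. \<beta> (\<phi> y))"
      then have y: "y \<in> carrier B'" "\<phi> y \<in> a_kernel B M \<beta>"
        using lhom.closed[OF \<phi>(1)] by (simp_all add: a_kernel_def')
      then obtain x where x: "x \<in> carrier S'" "\<phi> y = a x" unfolding ra[symmetric] by blast
      then have "y = \<psi> (a x)" using \<psi>(2)[OF y(1)] by simp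
      with x(1) show "y \<in> (\<lambda>x. \<psi> (a x)) ` carrier S'" by blast
    qed
  qed
  from that[OF this \<sigma>(3) \<phi>(3) \<sigma>(1,2) \<phi>(1,2)] show ?thesis .
qed

text \<open>The horseshoe lemma for \<open>0 \<rightarrow> S \<rightarrow> B \<rightarrow> W \<rightarrow> 0\<close>, with a given cover \<open>w : C \<rightarrow> W\<close>, any cover \<open>V\<close> of
  \<open>S\<close>, and the cover \<open>V \<oplus> C\<close> of \<open>B\<close>.\<close>

lemma horseshoe_step:
  fixes S B :: "('a, 'a univ) module" and W :: "('a, 'w) module" and C :: "('a, 'c) module"
    and X :: "('a, 'x) module"
  assumes R: "ring R" "left_noetherian R"
    and se: "short_exact R S \<alpha> B \<beta> W" and fg: "fg_module R S" "fg_module R B" and C: "proj R C"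
    and w: "lhom R C W w" "w ` carrier C = carrier W"
    and Om: "in_Omega R m S" and sy: "is_syzygy R (Suc j) X B"
  obtains S' B' :: "('a, 'a univ) module" and \<alpha>' \<beta>'
  where "short_exact R S' \<alpha>' B' \<beta>' (sub C (a_kernel C W w))" "fg_module R S'" "fg_module R B'"
    "in_Omega R (Suc m) S'" "is_syzygy R (Suc (Suc j)) X B'"
proof -
  note lS = fg_module_left_module[OF fg(1)] and lB = fg_module_left_module[OF fg(2)]
  note lC = proj_left_module[OF C]
  note se = short_exact_lhom[OF se lS lB lhom_modules(2)[OF w(1)]]
  obtain V :: "('a, 'a univ) module" and s where V: "proj R V" and s: "lhom R V S s" "s ` carrier V = carrier S"
    using univ_cover[OF fg(1)] .
  note lV = proj_left_module[OF V]
  interpret \<alpha>: lhom R S B \<alpha> by (rule se(1))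
  interpret \<beta>: lhom R B W \<beta> by (rule se(2))
  interpret w: lhom R C W w by (rule w(1))
  interpret s: lhom R V S s by (rule s(1))
  have "w x \<in> \<beta> ` carrier B" if "x \<in> carrier C" for x using w.closed[OF that] se(4) by simp
  then obtain l where l: "lhom R C B l" "\<And>x. x \<in> carrier C \<Longrightarrow> \<beta> (l x) = w x"
    using proj_lift[OF C se(2) w(1)] by blast
  interpret l: lhom R C B l by (rule l(1))
  have \<beta>\<alpha>: "\<beta> (\<alpha> y) = \<zero>\<^bsub>W\<^esub>" if "y \<in> carrier S" for y
    using imageI[OF that, of \<alpha>] unfolding se(5) by (simp add: a_kernel_def')
  let ?T = "dsum V C"
  define \<tau> where "\<tau> x = \<alpha> (s (fst x)) \<oplus>\<^bsub>B\<^esub> l (snd x)" for x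
  have \<tau>: "lhom R ?T B \<tau>" unfolding \<tau>_def by (rule lhom_copair[OF lhom_comp[OF s(1) se(1)] l(1)])
  have lT: "left_module R ?T" by (rule left_module_dsum[OF lV lC])
  have "b \<in> \<tau> ` carrier ?T" if b: "b \<in> carrier B" for b
  proof -
    \<comment> \<open>Subtracting a lift of \<open>\<beta> b\<close> leaves an element of the image
      of \<open>\<alpha>\<close>, which is covered by \<open>V\<close>.\<close>
    obtain x where x: "x \<in> carrier C" "\<beta> b = w x" using \<beta>.closed[OF b] w(2) by (metis imageE)
    have "b \<ominus>\<^bsub>B\<^esub> l x \<in> a_kernel B W \<beta>" using b x by (simp add: a_kernel_def' l(2))
    then obtain y where y: "y \<in> carrier S" "b \<ominus>\<^bsub>B\<^esub> l x = \<alpha> y" unfolding se(5)[symmetric] by blast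
    obtain v where v: "v \<in> carrier V" "y = s v" using y(1) s(2) by (metis imageE)
    have "b = \<tau> (v, x)"
      using b x(1) v y \<alpha>.N.add_eq_iff_diff[of b "\<alpha> y" "l x"] by (simp add: \<tau>_def)
    then show ?thesis using v x by (intro image_eqI[of _ _ "(v, x)"]) simp_all
  qed
  then have s\<tau>: "\<tau> ` carrier ?T = carrier B" using lhom.closed[OF \<tau>] by blast
  let ?B = "sub ?T (a_kernel ?T B \<tau>)" and ?S = "sub V (a_kernel V S s)" and ?W = "sub C (a_kernel C W w)"
  have sB: "subm R ?T (a_kernel ?T B \<tau>)" by (rule subm_kernel[OF \<tau>])
  have fgB: "fg_module R ?B" by (rule fg_module_sub_kernel[OF R fg_module_dsum[OF proj_fg[OF V] proj_fg[OF C]] \<tau>])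
  have fgS: "fg_module R ?S" by (rule fg_module_sub_kernel[OF R proj_fg[OF V] s(1)])
  have kz: "(v, \<zero>\<^bsub>C\<^esub>) \<in> a_kernel ?T B \<tau>" if "v \<in> a_kernel V S s" for v
    using that by (simp add: a_kernel_def' \<tau>_def)
  have "lhom R V ?T (\<lambda>v. (v, \<zero>\<^bsub>C\<^esub>))" by (intro lhom_pair lhom_id lhom_zero lV lC)
  then have lin: "lhom R ?S ?B (\<lambda>v. (v, \<zero>\<^bsub>C\<^esub>))"
    using kz by (intro lhom_sub_cod[OF lhom_sub_dom[OF _ subm_kernel[OF s(1)]] sB]) simp_all
  have \<tau>w: "\<beta> (\<tau> x) = w (snd x)" if "x \<in> carrier ?T" for x
    using that by (auto simp: \<tau>_def l(2) \<beta>\<alpha>)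
  have kw: "snd x \<in> a_kernel C W w" if "x \<in> a_kernel ?T B \<tau>" for x
  proof -
    have x: "x \<in> carrier ?T" "\<tau> x = \<zero>\<^bsub>B\<^esub>" using that by (simp_all add: a_kernel_def')
    then show ?thesis using \<tau>w[OF x(1)] by (auto simp: a_kernel_def')
  qed
  have lsnd: "lhom R ?B ?W snd"
    by (rule lhom_sub_cod[OF lhom_sub_dom[OF lhom_snd[OF lV lC] sB] subm_kernel[OF w(1)]]) (simp add: kw)
  have "c \<in> snd ` carrier ?B" if c: "c \<in> a_kernel C W w" for c
  proof -
    have c': "c \<in> carrier C" "w c = \<zero>\<^bsub>W\<^esub>" using c by (simp_all add: a_kernel_def')
    have "l c \<in> a_kernel B W \<beta>" using c' by (simp add: a_kernel_def' l(2))
    then obtain y where y: "y \<in> carrier S" "l c = \<alpha> y" unfolding se(5)[symmetric] by blast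
    \<comment> \<open>As \<open>w c\<close> is zero, \<open>l c\<close> comes from \<open>S\<close>;
      the sign is chosen so that the two terms of \<open>\<tau> (v, c)\<close> cancel.\<close>
    obtain v where v: "v \<in> carrier V" "s v = \<ominus>\<^bsub>S\<^esub> y" using y(1) s(2) \<alpha>.M.M.a_inv_closed by (metis imageE)
    have "(v, c) \<in> a_kernel ?T B \<tau>"
      using v y c' by (simp add: a_kernel_def' \<tau>_def \<alpha>.N.M.l_neg)
    then show ?thesis by (intro image_eqI[of _ _ "(v, c)"]) simp_all
  qed
  then have ssnd: "snd ` carrier ?B = carrier ?W" using kw by auto
  have seS: "short_exact R ?S (\<lambda>v. (v, \<zero>\<^bsub>C\<^esub>)) ?B snd ?W"
  proof (rule short_exactI[OF lin lsnd _ ssnd])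
    show "inj_on (\<lambda>v. (v, \<zero>\<^bsub>C\<^esub>)) (carrier ?S)" by (rule inj_onI) simp
    show "(\<lambda>v. (v, \<zero>\<^bsub>C\<^esub>)) ` carrier ?S = a_kernel ?B ?W snd"
    proof (intro equalityI subsetI)
      fix y assume "y \<in> (\<lambda>v. (v, \<zero>\<^bsub>C\<^esub>)) ` carrier ?S"
      then obtain v where "v \<in> a_kernel V S s" "y = (v, \<zero>\<^bsub>C\<^esub>)" by auto
      then show "y \<in> a_kernel ?B ?W snd" using kz by (simp add: a_kernel_def'[of ?B])
    next
      fix y assume "y \<in> a_kernel ?B ?W snd"
      then have y: "y \<in> a_kernel ?T B \<tau>" "snd y = \<zero>\<^bsub>C\<^esub>" by (simp_all add: a_kernel_def'[of ?B])
      obtain v where v: "y = (v, \<zero>\<^bsub>C\<^esub>)" using y(2) by (metis prod.collapse)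
      have vV: "v \<in> carrier V" and "\<alpha> (s v) \<oplus>\<^bsub>B\<^esub> \<zero>\<^bsub>B\<^esub> = \<zero>\<^bsub>B\<^esub>"
        using y(1) unfolding v by (simp_all add: a_kernel_def' \<tau>_def)
      then have "\<alpha> (s v) = \<zero>\<^bsub>B\<^esub>" using \<alpha>.N.M.r_zero[OF \<alpha>.closed[OF s.closed[OF vV]]] by simp
      then have "v \<in> carrier ?S"
        using inj_on_lhom_iff[OF se(1)] se(3) vV by (simp add: a_kernel_def')
      then show "y \<in> (\<lambda>v. (v, \<zero>\<^bsub>C\<^esub>)) ` carrier ?S" using v by blast
    qed
  qed
  obtain S' B' :: "('a, 'a univ) module" and \<sigma> \<phi> \<alpha>' \<beta>'
    where se': "short_exact R S' \<alpha>' B' \<beta>' ?W" and fg': "fg_module R S'" "fg_module R B'"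
      and \<sigma>: "lhom R S' ?S \<sigma>" "bij_betw \<sigma> (carrier S') (carrier ?S)"
      and \<phi>: "lhom R B' ?B \<phi>" "bij_betw \<phi> (carrier B') (carrier ?B)"
    using short_exact_univ[OF seS fgS fgB lhom_modules(2)[OF lsnd]] .
  \<comment> \<open>\<open>B'\<close> is the kernel of a surjection from a projective onto
    \<open>B\<close>, hence one syzygy further.\<close>
  have "short_exact R B' \<phi> ?T \<tau> B"
    using \<phi>(2) by (intro short_exactI[OF lhom_sub_codD[OF \<phi>(1) lT sB] \<tau> _ s\<tau>]) (simp_all add: bij_betw_def)
  then have sy': "is_syzygy R (Suc (Suc j)) X B'"
    by (rule is_syzygy_Suc[OF sy proj_dsum[OF V C] fg_module_left_module[OF fg'(2)]])
  have "in_Omega R (Suc m) S'"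
    by (rule in_Omega_iso[OF in_Omega_Suc[OF Om V fgS short_exact_kernel[OF s]] \<sigma> fg'(1)])
  from that[OF se' fg' this sy'] show ?thesis .
qed

section \<open>Evans-Griffith sequences from the dual complex\<close>

context cocomplex
begin

abbreviation ker_c where "ker_c i \<equiv> a_kernel (C i) (C (Suc i)) (c i)"

lemma lm_C: "left_module R (C i)"
  by (rule proj_left_module[OF proj_C])

lemma im_c_ker: "c i ` carrier (C i) \<subseteq> ker_c (Suc i)"
  using lhom.closed[OF lhom_c] c_c by (auto simp: a_kernel_def')

lemma fg_ker_c: "fg_module R (sub (C i) (ker_c i))"
  by (rule fg_module_sub_kernel[OF R proj_fg[OF proj_C] lhom_c])

text \<open>The image of \<open>c i\<close> is the kernel of \<open>C (Suc i)\<close> onto a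
  quotient, hence a first syzygy; the kernel of \<open>c i\<close> lies one step further.\<close>

lemma ker_c_Omega: "in_Omega R 2 (sub (C i) (ker_c i))"
proof -
  let ?I = "c i ` carrier (C i)"
  have sI: "subm R (C (Suc i)) ?I" by (rule subm_range[OF lhom_c])
  have cI: "lhom R (C i) (sub (C (Suc i)) ?I) (c i)" by (rule lhom_sub_cod[OF lhom_c sI]) simp
  have fgI: "fg_module R (sub (C (Suc i)) ?I)" by (rule fg_module_surj[OF proj_fg[OF proj_C] cI]) simp
  note q = lhom_quot[OF lm_C sI]
  have "in_Omega R 0 (quot_module (C (Suc i)) ?I)"
    using fg_module_surj[OF proj_fg[OF proj_C] q(1,2)] by (simp add: in_Omega_def exact_proj_seq_def)
  moreover have "short_exact R (sub (C (Suc i)) ?I) (\<lambda>x. x) (C (Suc i)) (\<lambda>x. ?I +>\<^bsub>C (Suc i)\<^esub> x)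
      (quot_module (C (Suc i)) ?I)"
    using short_exact_kernel[OF q(1,2)] by (simp only: q(3))
  ultimately have "in_Omega R (Suc 0) (sub (C (Suc i)) ?I)" using in_Omega_Suc proj_C fgI by blast
  moreover have "short_exact R (sub (C i) (ker_c i)) (\<lambda>x. x) (C i) (c i) (sub (C (Suc i)) ?I)"
    using short_exact_kernel[OF cI] by (simp add: a_kernel_def')
  ultimately have "in_Omega R (Suc (Suc 0)) (sub (C i) (ker_c i))" using in_Omega_Suc proj_C fg_ker_c by blast
  then show ?thesis by (simp add: numeral_2_eq_2)
qed

text \<open>For d = 0 the module \<open>X\<close> sits inside \<open>M\<close> and
  \<open>\<epsilon>\<close> covers the rest, so the sum of \<open>X\<close> and \<open>C 1\<close>
  maps onto \<open>M\<close>. The kernel is a copy of the cocycles, embedded by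
  \<open>x \<mapsto> (\<pi> x, - x)\<close>.\<close>

lemma Evans_Griffith_0:
  fixes X :: "('a, 'x) module"
  assumes \<pi>: "lhom R (sub (C (Suc 0)) (ker_c (Suc 0))) X \<pi>" "\<pi> ` ker_c (Suc 0) = carrier X"
      "\<And>x. x \<in> ker_c (Suc 0) \<Longrightarrow> \<pi> x = \<zero>\<^bsub>X\<^esub> \<longleftrightarrow> x \<in> c 0 ` carrier (C 0)"
  obtains S B :: "('a, 'a univ) module" and \<alpha> \<beta>
  where "fg_module R S" "fg_module R B" "short_exact R S \<alpha> B \<beta> M" "is_syzygy R 0 X B" "in_Omega R 2 S"
proof -
  let ?C = "C (Suc 0)" and ?k = "ker_c (Suc 0)"
  let ?K = "sub ?C ?k"
  have sk: "subm R ?C ?k" by (rule subm_kernel[OF lhom_c])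
  have fgX: "fg_module R X" by (rule fg_module_surj[OF fg_ker_c \<pi>(1)]) (simp add: \<pi>(2))
  note lX = fg_module_left_module[OF fgX]
  have \<epsilon>c: "\<epsilon> x = \<zero>\<^bsub>M\<^esub> \<longleftrightarrow> x \<in> c 0 ` carrier (C 0)" if "x \<in> carrier ?C" for x
    using that by (simp add: eps_ker[symmetric] a_kernel_def')
  interpret \<pi>: lhom R ?K X \<pi> by (rule \<pi>(1))
  interpret e: lhom R ?C M \<epsilon> by (rule lhom_eps)
  have kC: "x \<in> carrier ?C" if "x \<in> ?k" for x using that by (simp add: a_kernel_def')
  obtain \<rho> where \<rho>: "lhom R X M \<rho>" "\<And>x. x \<in> ?k \<Longrightarrow> \<rho> (\<pi> x) = \<epsilon> x"
  proof (rule lhom_factor[OF \<pi>(1) _ lhom_sub_dom[OF lhom_eps sk]])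
    show "\<epsilon> x = \<zero>\<^bsub>M\<^esub>" if "x \<in> carrier ?K" "\<pi> x = \<zero>\<^bsub>X\<^esub>" for x
      using that \<pi>(3) \<epsilon>c kC by simp
  qed (simp_all add: \<pi>(2))
  let ?T = "dsum X ?C"
  let ?t = "\<lambda>x. \<rho> (fst x) \<oplus>\<^bsub>M\<^esub> \<epsilon> (snd x)"
  let ?a = "\<lambda>x. (\<pi> x, \<zero>\<^bsub>?C\<^esub> \<ominus>\<^bsub>?C\<^esub> x)"
  have fgT: "fg_module R ?T" by (rule fg_module_dsum[OF fgX proj_fg[OF proj_C]])
  have t: "lhom R ?T M ?t" by (rule lhom_copair[OF \<rho>(1) lhom_eps])
  have a: "lhom R ?K ?T ?a"
    by (rule lhom_pair[OF \<pi>(1) lhom_sub_dom[OF lhom_diff[OF lhom_zero lhom_id] sk]]) (rule lm_C)+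
  interpret \<rho>: lhom R X M \<rho> by (rule \<rho>(1))
  have seT: "short_exact R ?K ?a ?T ?t M"
  proof (rule short_exactI[OF a t])
    show "inj_on ?a (carrier ?K)"
      unfolding inj_on_lhom_iff[OF a]
    proof (intro ballI impI)
      fix x assume x: "x \<in> carrier ?K" and "?a x = \<zero>\<^bsub>?T\<^esub>"
      then have "\<zero>\<^bsub>?C\<^esub> \<ominus>\<^bsub>?C\<^esub> x = \<zero>\<^bsub>?C\<^esub>" by simp
      then show "x = \<zero>\<^bsub>?K\<^esub>" using e.M.diff_eq_zero[of "\<zero>\<^bsub>?C\<^esub>" x] kC x by auto
    qed
    have "m \<in> ?t ` carrier ?T" if m: "m \<in> carrier M" for m
    proof -
      obtain x where x: "x \<in> carrier ?C" "m = \<epsilon> x" using m eps_surj by (metis imageE)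
      then show ?thesis by (intro image_eqI[of _ _ "(\<zero>\<^bsub>X\<^esub>, x)"]) simp_all
    qed
    then show "?t ` carrier ?T = carrier M" using lhom.closed[OF t] by blast
    show "?a ` carrier ?K = a_kernel ?T M ?t"
    proof (intro equalityI subsetI)
      fix y assume "y \<in> ?a ` carrier ?K"
      then obtain x where x: "x \<in> ?k" "y = ?a x" by auto
      then have "?t y = \<epsilon> x \<oplus>\<^bsub>M\<^esub> (\<zero>\<^bsub>M\<^esub> \<ominus>\<^bsub>M\<^esub> \<epsilon> x)" using kC[OF x(1)] \<rho>(2) by simp
      also have "\<dots> = \<zero>\<^bsub>M\<^esub>" using kC[OF x(1)] by (simp only: e.closed e.N.add_diff_cancel_left e.N.M.zero_closed)
      finally show "y \<in> a_kernel ?T M ?t" using lhom.closed[OF a, of x] x unfolding a_kernel_def' by simp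
    next
      fix y assume y: "y \<in> a_kernel ?T M ?t"
      obtain x' z where xz: "y = (x', z)" by (cases y)
      have x': "x' \<in> carrier X" and z: "z \<in> carrier ?C" and 0: "\<rho> x' \<oplus>\<^bsub>M\<^esub> \<epsilon> z = \<zero>\<^bsub>M\<^esub>"
        using y xz by (simp_all add: a_kernel_def')
      obtain k where k: "k \<in> ?k" "x' = \<pi> k" using x' \<pi>(2) by (metis imageE)
      have "\<epsilon> (k \<oplus>\<^bsub>?C\<^esub> z) = \<zero>\<^bsub>M\<^esub>" using 0 k z kC by (simp add: \<rho>(2))
      then have im: "k \<oplus>\<^bsub>?C\<^esub> z \<in> c 0 ` carrier (C 0)"
        using \<epsilon>c[OF e.M.M.a_closed[OF kC[OF k(1)] z]] by blast
      then have imk: "k \<oplus>\<^bsub>?C\<^esub> z \<in> ?k" using im_c_ker by blast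
      \<comment> \<open>This is \<open>- z\<close>, written so that it is visibly a cocycle in the
        class of \<open>k\<close>: the element subtracted is a boundary.\<close>
      define k' where "k' = k \<ominus>\<^bsub>?C\<^esub> (k \<oplus>\<^bsub>?C\<^esub> z)"
      have k': "k' \<in> ?k" unfolding k'_def by (rule subm_diff[OF lm_C sk k(1) imk])
      have "k = k' \<oplus>\<^bsub>?C\<^esub> (k \<oplus>\<^bsub>?C\<^esub> z)" unfolding k'_def using kC[OF k(1)] kC[OF imk] by simp
      then have "\<pi> k = \<pi> k' \<oplus>\<^bsub>X\<^esub> \<pi> (k \<oplus>\<^bsub>?C\<^esub> z)" using \<pi>.add[of k' "k \<oplus>\<^bsub>?C\<^esub> z"] k' imk by simp
      then have "\<pi> k = \<pi> k'" using \<pi>(3)[OF imk] im \<pi>.closed[of k'] k' by simp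
      moreover have "z = \<zero>\<^bsub>?C\<^esub> \<ominus>\<^bsub>?C\<^esub> k'"
        unfolding k'_def using kC[OF k(1)] z
        by (simp add: a_minus_def e.M.M.minus_add e.M.M.a_ac e.M.M.r_neg e.M.M.r_neg1 e.M.M.r_neg2)
      ultimately show "y \<in> ?a ` carrier ?K" using k' k(2) xz by (intro image_eqI[of _ _ k']) simp_all
    qed
  qed
  obtain S B :: "('a, 'a univ) module" and \<sigma> \<phi> \<alpha> \<beta>
    where se: "short_exact R S \<alpha> B \<beta> M" and fg: "fg_module R S" "fg_module R B"
      and \<sigma>: "lhom R S ?K \<sigma>" "bij_betw \<sigma> (carrier S) (carrier ?K)"
      and \<phi>: "lhom R B ?T \<phi>" "bij_betw \<phi> (carrier B) (carrier ?T)"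
    using short_exact_univ[OF seT fg_ker_c fgT e.N.left_module_axioms] .
  \<comment> \<open>A copy of \<open>C 1\<close> over \<open>'a univ\<close>, as
    \<open>is_syzygy\<close> asks of the projective summand in degree 0.\<close>
  obtain Q :: "('a, 'a univ) module" and \<kappa> where \<kappa>: "lhom R ?C Q \<kappa>" "bij_betw \<kappa> (carrier ?C) (carrier Q)"
    using univ_copy[OF proj_fg[OF proj_C]] .
  have "is_syzygy R 0 X B"
    unfolding is_syzygy_def
  proof (simp, intro conjI exI)
    show "left_module R B" by (rule fg_module_left_module[OF fg(2)])
    show "fg_projective R Q" using proj_iso[OF proj_C \<kappa>] by (simp add: fg_projective_iff_proj)
    show "(\<lambda>b. fst (\<phi> b)) \<in> mod_hom R B X"
      using lhom_comp[OF \<phi>(1) lhom_fst[OF lX lm_C]] by (simp add: lhom_iff)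
    show "(\<lambda>b. \<kappa> (snd (\<phi> b))) \<in> mod_hom R B Q"
      using lhom_comp[OF lhom_comp[OF \<phi>(1) lhom_snd[OF lX lm_C]] \<kappa>(1)] by (simp add: lhom_iff)
    have "bij_betw (map_prod id \<kappa>) (carrier X \<times> carrier ?C) (carrier X \<times> carrier Q)"
      using bij_betw_map_prod[OF bij_betw_id \<kappa>(2)] .
    then have "bij_betw (map_prod id \<kappa> \<circ> \<phi>) (carrier B) (carrier X \<times> carrier Q)"
      using bij_betw_trans[OF \<phi>(2)] by simp
    then show "bij_betw (\<lambda>b. (fst (\<phi> b), \<kappa> (snd (\<phi> b)))) (carrier B) (carrier X \<times> carrier Q)"
      by (simp add: comp_def map_prod_def case_prod_unfold)
  qed
  from that[OF fg se this in_Omega_iso[OF ker_c_Omega \<sigma> fg(1)]] show ?thesis .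
qed

text \<open>Here d is \<open>Suc n\<close>. The descent goes through the images \<open>W m\<close>
  of \<open>c m\<close>, from \<open>m = Suc n\<close> down to \<open>1\<close>: the module
  \<open>C m\<close> covers \<open>W m\<close>, and the kernel is \<open>W (m - 1)\<close> because
  cohomology in degree \<open>m\<close> vanishes. Each step adds one syzygy to both outer terms of
  the eventual sequence, \<open>S\<close> and \<open>B\<close>.\<close>

lemma Evans_Griffith_Suc:
  fixes X :: "('a, 'x) module"
  assumes H: "\<And>j. j \<le> n \<Longrightarrow> cohom_exact C c j"
    and \<pi>: "lhom R (sub (C (Suc (Suc n))) (ker_c (Suc (Suc n)))) X \<pi>" "\<pi> ` ker_c (Suc (Suc n)) = carrier X"
      "\<And>x. x \<in> ker_c (Suc (Suc n)) \<Longrightarrow> \<pi> x = \<zero>\<^bsub>X\<^esub> \<longleftrightarrow> x \<in> c (Suc n) ` carrier (C (Suc n))"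
  obtains S B :: "('a, 'a univ) module" and \<alpha> \<beta>
  where "fg_module R S" "fg_module R B" "short_exact R S \<alpha> B \<beta> M" "is_syzygy R (Suc n) X B"
    "in_Omega R (n + 3) S"
proof -
  define W where "W i = sub (C (Suc i)) (c i ` carrier (C i))" for i
  have sW: "subm R (C (Suc i)) (c i ` carrier (C i))" for i by (rule subm_range[OF lhom_c])
  have cW: "lhom R (C i) (W i) (c i)" for i unfolding W_def by (rule lhom_sub_cod[OF lhom_c sW]) simp
  have lW: "left_module R (W i)" for i by (rule lhom_modules(2)[OF cW])
  let ?C = "C (Suc (Suc n))" and ?k = "ker_c (Suc (Suc n))"
  let ?K = "sub ?C ?k"
  have sk: "subm R ?C ?k" by (rule subm_kernel[OF lhom_c])
  have fgX: "fg_module R X" by (rule fg_module_surj[OF fg_ker_c \<pi>(1)]) (simp add: \<pi>(2))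
  note lX = fg_module_left_module[OF fgX]
  have ex: "\<exists>(S :: ('a, 'a univ) module) (B :: ('a, 'a univ) module) \<alpha> \<beta>. short_exact R S \<alpha> B \<beta> (W (Suc n - i)) \<and>
    fg_module R S \<and> fg_module R B \<and> in_Omega R (i + 3) S \<and> is_syzygy R (Suc i) X B" if "i \<le> n" for i
    using that
  proof (induction i)
    case 0
    \<comment> \<open>The first syzygy is taken at once. For a cover \<open>V\<close> of the
      cocycles, the kernel of \<open>V \<rightarrow> X\<close> is a first syzygy of \<open>X\<close>
      and maps onto the boundaries \<open>W (Suc n)\<close>. The kernel of that map is a syzygy of
      the cocycles, which are themselves a second syzygy.\<close>
    obtain V :: "('a, 'a univ) module" and r where V: "proj R V" and r: "lhom R V ?K r" "r ` carrier V = carrier ?K"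
      using univ_cover[OF fg_ker_c] .
    let ?p = "\<lambda>v. \<pi> (r v)"
    have p: "lhom R V X ?p" by (rule lhom_comp[OF r(1) \<pi>(1)])
    have "r ` carrier V = ?k" using r(2) by simp
    then have sp: "?p ` carrier V = carrier X" using \<pi>(2) by (metis image_image)
    have rC: "lhom R V ?C r" by (rule lhom_sub_codD[OF r(1) lm_C sk])
    let ?L = "sub V (a_kernel V X ?p)" and ?S = "sub V (a_kernel V ?K r)"
    have sL: "subm R V (a_kernel V X ?p)" by (rule subm_kernel[OF p])
    have fgL: "fg_module R ?L" and fgS: "fg_module R ?S"
      by (rule fg_module_sub_kernel[OF R proj_fg[OF V]] p r(1))+
    have rk: "r v \<in> ?k" if "v \<in> carrier V" for v using lhom.closed[OF r(1) that] by simp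
    have rI: "r v \<in> c (Suc n) ` carrier (C (Suc n))" if "v \<in> a_kernel V X ?p" for v
    proof -
      have v: "v \<in> carrier V" "\<pi> (r v) = \<zero>\<^bsub>X\<^esub>" using that by (simp_all add: a_kernel_def')
      show ?thesis using \<pi>(3)[OF rk[OF v(1)]] v(2) by blast
    qed
    have SL: "a_kernel V ?K r \<subseteq> a_kernel V X ?p"
      using lhom.zero[OF \<pi>(1)] by (auto simp: a_kernel_def'[of V])
    have "short_exact R ?S (\<lambda>v. v) ?L r (W (Suc n))"
    proof (rule short_exactI)
      show "lhom R ?S ?L (\<lambda>v. v)"
        by (rule lhom_sub_cod[OF lhom_incl[OF proj_left_module[OF V] subm_kernel[OF r(1)]] sL]) (use SL in auto)
      show "lhom R ?L (W (Suc n)) r"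
        unfolding W_def by (rule lhom_sub_cod[OF lhom_sub_dom[OF rC sL] sW]) (use rI in simp)
      show "inj_on (\<lambda>v. v) (carrier ?S)" by simp
      have "y \<in> r ` a_kernel V X ?p" if y: "y \<in> c (Suc n) ` carrier (C (Suc n))" for y
      proof -
        have yk: "y \<in> ?k" using im_c_ker y by blast
        then obtain v where v: "v \<in> carrier V" "y = r v" using r(2) by auto
        have "v \<in> a_kernel V X ?p" using v \<pi>(3)[OF yk] y by (simp add: a_kernel_def')
        then show ?thesis using v(2) by blast
      qed
      then show "r ` carrier ?L = carrier (W (Suc n))" using rI by (auto simp: W_def)
      show "(\<lambda>v. v) ` carrier ?S = a_kernel ?L (W (Suc n)) r"
        using SL by (auto simp: a_kernel_def'[of ?L] a_kernel_def'[of V ?K] W_def) (auto simp: a_kernel_def')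
    qed
    moreover have "in_Omega R (0 + 3) ?S"
      using in_Omega_Suc[OF ker_c_Omega V fgS short_exact_kernel[OF r]] by (simp add: numeral_eq_Suc)
    moreover have "is_syzygy R (Suc 0) X ?L"
      by (rule is_syzygy_Suc_0[OF V fg_module_left_module[OF fgL] lX short_exact_kernel[OF p sp]])
    ultimately show ?case using fgL fgS unfolding diff_zero by blast
  next
    case (Suc i)
    from Suc.IH[OF Suc_leD[OF Suc.prems]] obtain S B :: "('a, 'a univ) module" and \<alpha> \<beta>
      where se: "short_exact R S \<alpha> B \<beta> (W (Suc n - i))"
      and fg: "fg_module R S" "fg_module R B" and Om: "in_Omega R (i + 3) S" and sy: "is_syzygy R (Suc i) X B"
      by blast
    let ?m = "Suc n - i"
    have cm: "c ?m ` carrier (C ?m) = carrier (W ?m)" by (simp add: W_def)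
    obtain S' B' :: "('a, 'a univ) module" and \<alpha>' \<beta>'
      where se': "short_exact R S' \<alpha>' B' \<beta>' (sub (C ?m) (a_kernel (C ?m) (W ?m) (c ?m)))"
        and o: "fg_module R S'" "fg_module R B'" "in_Omega R (Suc (i + 3)) S'" "is_syzygy R (Suc (Suc i)) X B'"
      using horseshoe_step[OF R se fg proj_C cW cm Om sy] .
    have m: "?m = Suc (n - i)" using Suc.prems by simp
    have "a_kernel (C ?m) (W ?m) (c ?m) = ker_c ?m" by (simp add: W_def a_kernel_def')
    also have "\<dots> = c (n - i) ` carrier (C (n - i))"
      using H[of "n - i"] by (simp add: m cohom_exact_def)
    finally have "sub (C ?m) (a_kernel (C ?m) (W ?m) (c ?m)) = W (Suc n - Suc i)"
      by (simp add: W_def m)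
    with se' have "short_exact R S' \<alpha>' B' \<beta>' (W (Suc n - Suc i))" by simp
    then show ?case
      using o by (intro exI[of _ S'] exI[of _ B'] exI[of _ \<alpha>'] exI[of _ \<beta>']) simp
  qed
  have n1: "Suc n - n = Suc 0" by simp
  from ex[OF le_refl, unfolded n1] obtain S B :: "('a, 'a univ) module" and \<alpha> \<beta> where se: "short_exact R S \<alpha> B \<beta> (W (Suc 0))"
    and fg: "fg_module R S" "fg_module R B" and o: "in_Omega R (n + 3) S" "is_syzygy R (Suc n) X B"
    by blast
  \<comment> \<open>Vanishing in degree 1 identifies the kernel of \<open>\<epsilon>\<close> with
    that of \<open>c (Suc 0)\<close>, so \<open>M\<close> and \<open>W 1\<close> are quotients of
    \<open>C 1\<close> by the same submodule.\<close>
  have \<epsilon>0: "\<epsilon> x = \<zero>\<^bsub>M\<^esub> \<longleftrightarrow> c (Suc 0) x = \<zero>\<^bsub>W (Suc 0)\<^esub>" if "x \<in> carrier (C (Suc 0))" for x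
  proof -
    have "\<epsilon> x = \<zero>\<^bsub>M\<^esub> \<longleftrightarrow> x \<in> a_kernel (C (Suc 0)) M \<epsilon>" using that by (simp add: a_kernel_def')
    also have "\<dots> \<longleftrightarrow> x \<in> ker_c (Suc 0)" using H[of 0] by (simp add: eps_ker cohom_exact_def)
    finally show ?thesis using that by (simp add: a_kernel_def' W_def)
  qed
  have s1: "c (Suc 0) ` carrier (C (Suc 0)) = carrier (W (Suc 0))" by (simp add: W_def)
  obtain h where h: "lhom R (W (Suc 0)) M h" "\<And>x. x \<in> carrier (C (Suc 0)) \<Longrightarrow> h (c (Suc 0) x) = \<epsilon> x"
    using lhom_factor[OF cW s1 lhom_eps] \<epsilon>0 by blast
  note se = short_exact_lhom[OF se fg_module_left_module[OF fg(1)] fg_module_left_module[OF fg(2)] lW]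
  have h0: "h y = \<zero>\<^bsub>M\<^esub> \<longleftrightarrow> y = \<zero>\<^bsub>W (Suc 0)\<^esub>" if y: "y \<in> carrier (W (Suc 0))" for y
  proof -
    obtain x where x: "x \<in> carrier (C (Suc 0))" "y = c (Suc 0) x" using y s1 by (metis imageE)
    then show ?thesis using h(2) \<epsilon>0 by simp
  qed
  have "short_exact R S \<alpha> B (\<lambda>b. h (\<beta> b)) M"
  proof (rule short_exactI[OF se(1) lhom_comp[OF se(2) h(1)] se(3)])
    have "h ` carrier (W (Suc 0)) = carrier M"
      using h(2) eps_surj by (simp add: s1[symmetric] image_image cong: image_cong)
    then show "(\<lambda>b. h (\<beta> b)) ` carrier B = carrier M" using se(4) by (metis image_image)
    show "\<alpha> ` carrier S = a_kernel B M (\<lambda>b. h (\<beta> b))"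
      using h0 lhom.closed[OF se(2)] unfolding se(5) by (auto simp: a_kernel_def')
  qed
  from that[OF fg this o(2,1)] show ?thesis .
qed

end

section \<open>The complex of a presentation\<close>

lemma dual_map_bij:
  assumes \<phi>: "lhom R A B \<phi>" "bij_betw \<phi> (carrier A) (carrier B)"
  shows "bij_betw (dual_map A \<phi>) (carrier (dual R B)) (carrier (dual R A))"
proof -
  obtain \<psi> where \<psi>: "lhom R B A \<psi>" "\<And>x. x \<in> carrier A \<Longrightarrow> \<psi> (\<phi> x) = x"
    "\<And>y. y \<in> carrier B \<Longrightarrow> \<psi> y \<in> carrier A \<and> \<phi> (\<psi> y) = y"
    using lhom_inv[OF \<phi>] by blast
  note a = lhom.closed[OF lhom_dual_map[OF \<phi>(1)]] and b = lhom.closed[OF lhom_dual_map[OF \<psi>(1)]]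
  show ?thesis
  proof (rule bij_betw_byWitness[where f' = "dual_map B \<psi>"])
    show "\<forall>\<chi>\<in>carrier (dual R B). dual_map B \<psi> (dual_map A \<phi> \<chi>) = \<chi>"
    proof
      fix \<chi> assume \<chi>: "\<chi> \<in> carrier (dual R B)"
      show "dual_map B \<psi> (dual_map A \<phi> \<chi>) = \<chi>"
        by (rule dual_ext[OF b[OF a[OF \<chi>]] \<chi>]) (simp add: \<psi>(3))
    qed
    show "\<forall>\<chi>\<in>carrier (dual R A). dual_map A \<phi> (dual_map B \<psi> \<chi>) = \<chi>"
    proof
      fix \<chi> assume \<chi>: "\<chi> \<in> carrier (dual R A)"
      show "dual_map A \<phi> (dual_map B \<psi> \<chi>) = \<chi>"
        by (rule dual_ext[OF a[OF b[OF \<chi>]] \<chi>]) (simp add: \<psi>(2) lhom.closed[OF \<phi>(1)])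
    qed
  qed (use a b in blast)+
qed

text \<open>Only the end of the complex changes, so the complex of a module also serves its copy
  over \<open>'a univ\<close>.\<close>

lemma cocomplex_iso:
  assumes "cocomplex R M C c \<epsilon>" and \<mu>: "lhom R M' M \<mu>" "bij_betw \<mu> (carrier M') (carrier M)"
  shows "\<exists>\<epsilon>'. cocomplex R M' C c \<epsilon>'"
proof -
  interpret cocomplex R M C c \<epsilon> by fact
  obtain \<psi> where \<psi>: "lhom R M M' \<psi>" "\<And>x. x \<in> carrier M' \<Longrightarrow> \<psi> (\<mu> x) = x"
    "\<And>y. y \<in> carrier M \<Longrightarrow> \<psi> y \<in> carrier M' \<and> \<mu> (\<psi> y) = y"
    using lhom_inv[OF \<mu>] by blast
  have z: "\<psi> (\<epsilon> x) = \<zero>\<^bsub>M'\<^esub> \<longleftrightarrow> \<epsilon> x = \<zero>\<^bsub>M\<^esub>" if "x \<in> carrier (C (Suc 0))" for x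
    using \<psi>(3)[OF lhom.closed[OF lhom_eps that]] lhom.zero[OF \<mu>(1)] lhom.zero[OF \<psi>(1)] by metis
  have "cocomplex R M' C c (\<lambda>x. \<psi> (\<epsilon> x))"
  proof (rule cocomplex.intro[OF R proj_C lhom_c c_c factor_c lhom_comp[OF lhom_eps \<psi>(1)]])
    have "y \<in> (\<lambda>x. \<psi> (\<epsilon> x)) ` carrier (C (Suc 0))" if y: "y \<in> carrier M'" for y
    proof -
      obtain x where x: "x \<in> carrier (C (Suc 0))" "\<mu> y = \<epsilon> x"
        using lhom.closed[OF \<mu>(1) y] eps_surj by (metis imageE)
      then show ?thesis using \<psi>(2)[OF y] by (intro image_eqI[of _ _ x]) simp_all
    qed
    then show "(\<lambda>x. \<psi> (\<epsilon> x)) ` carrier (C (Suc 0)) = carrier M'"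
      using lhom.closed[OF lhom_comp[OF lhom_eps \<psi>(1)]] by blast
    show "a_kernel (C (Suc 0)) M' (\<lambda>x. \<psi> (\<epsilon> x)) = c 0 ` carrier (C 0)"
      unfolding eps_ker[symmetric] using z by (auto simp: a_kernel_def')
  qed
  then show ?thesis by blast
qed

text \<open>\<open>M\<close> becomes the term \<open>E 0\<close>, so it must have the type of the
  projectives. The numbering is reversed: \<open>P (d - 1)\<close>, the neighbour of
  \<open>M\<close>, becomes \<open>E 1\<close>.\<close>

lemma in_Omega_coexact:
  fixes M :: "('a, 'a univ) module"
  assumes "in_Omega R d M"
  obtains E :: "nat \<Rightarrow> ('a, 'a univ) module" and e where "coexact R d E e" "E 0 = M"
proof -
  obtain \<iota> and P :: "nat \<Rightarrow> ('a, 'a univ) module" and \<delta> where ex: "exact_proj_seq R d M \<iota> P \<delta>"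
    and M: "left_module R M" using assms by (auto simp: in_Omega_def fg_module_left_module)
  define E where "E i = (case i of 0 \<Rightarrow> M | Suc j \<Rightarrow> P (d - 1 - j))" for i
  define e where "e i = (case i of 0 \<Rightarrow> \<iota> | Suc j \<Rightarrow> \<delta> (d - 2 - j))" for i
  have pP: "proj R (P i)" if "i < d" for i using ex that by (simp add: exact_proj_seq_def fg_projective_iff_proj)
  note lP = proj_left_module[OF pP]
  have d: "lhom R (P (Suc i)) (P i) (\<delta> i)" if "Suc i < d" for i
    using ex that lP[OF that] lP[OF Suc_lessD[OF that]] by (simp add: exact_proj_seq_def lhom_iff)
  have \<iota>: "lhom R M (P (d - 1)) \<iota>" "inj_on \<iota> (carrier M)" if "0 < d"
    using ex that lP[of "d - 1"] M by (simp_all add: exact_proj_seq_def lhom_iff)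
  have "coexact R d E e"
    unfolding coexact_def
  proof (intro conjI allI impI)
    fix i assume i: "i < d"
    show "proj R (E (Suc i))" using i pP by (simp add: E_def)
    show "lhom R (E i) (E (Suc i)) (e i)"
    proof (cases i)
      case 0
      then show ?thesis using \<iota> i by (simp add: E_def e_def)
    next
      case (Suc j)
      then have "d - Suc j = Suc (d - 2 - j)" using i by simp
      then show ?thesis using d[of "d - 2 - j"] Suc i by (simp add: E_def e_def numeral_2_eq_2)
    qed
  next
    assume "0 < d"
    then show "a_kernel (E 0) (E (Suc 0)) (e 0) \<subseteq> {\<zero>\<^bsub>E 0\<^esub>}"
      using \<iota> inj_on_lhom_iff[OF \<iota>(1)] by (auto simp: E_def e_def a_kernel_def')
  next
    fix i assume i: "Suc i < d"
    show "a_kernel (E (Suc i)) (E (Suc (Suc i))) (e (Suc i)) = e i ` carrier (E i)"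
    proof (cases i)
      case 0
      then show ?thesis using ex i by (simp add: E_def e_def exact_proj_seq_def numeral_2_eq_2)
    next
      case (Suc j)
      define m where "m = d - 3 - j"
      have m: "d - Suc j = Suc (Suc m)" "d - Suc (Suc j) = Suc m" "d - Suc (Suc (Suc j)) = m" "Suc (Suc m) < d"
        using i Suc by (simp_all add: m_def)
      have "\<delta> (Suc m) ` carrier (P (Suc (Suc m))) = a_kernel (P (Suc m)) (P m) (\<delta> m)"
        using ex m(4) by (simp add: exact_proj_seq_def)
      then show ?thesis using Suc m by (simp add: E_def e_def numeral_2_eq_2)
    qed
  qed
  moreover have "E 0 = M" by (simp add: E_def)
  ultimately show ?thesis by (rule that)
qed

text \<open>Projectives are reflexive, so dualising the first two terms of the resolution returns
  \<open>P1 \<rightarrow> P0\<close>. Reflexivity also gives the factorisation property: a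
  functional on \<open>C (Suc i)\<close> is evaluation at some \<open>y\<close> in
  \<open>Q (Suc i)\<close>. If it vanishes on the image of \<open>c i\<close>, then every functional
  kills \<open>\<delta> i y\<close>, so this element is zero; by exactness
  \<open>y = \<delta> (Suc i) z\<close>, and evaluation at \<open>z\<close> is the required
  extension.\<close>

lemma presentation_cocomplex:
  fixes M :: "('a, 'b) module" and P0 :: "('a, 'p) module" and P1 :: "('a, 'q) module"
  assumes R: "ring R" "left_noetherian R" and rR: "right_noetherian R" and M: "left_module R M"
    and pres: "proj_presentation R P1 f P0 \<epsilon> M"
  obtains Q :: "nat \<Rightarrow> ('a, 'a univ) module" and \<delta> q \<epsilon>'
  where "proj_resolution (opp_ring R) (transpose_module R P1 f P0) Q \<delta> q"
    "fg_module (opp_ring R) (transpose_module R P1 f P0)"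
    "cocomplex R M (\<lambda>i. dual (opp_ring R) (Q i)) (\<lambda>i. dual_map (Q (Suc i)) (\<delta> i)) \<epsilon>'"
proof -
  let ?S = "opp_ring R" and ?D = "transpose_module R P1 f P0"
  have S: "ring ?S" "left_noetherian ?S" using ring_opp_ring[OF R(1)] rR by (simp_all add: right_noetherian_def)
  have P: "proj R P1" "proj R P0" using pres by (simp_all add: proj_presentation_def fg_projective_iff_proj)
  note lP = proj_left_module[OF P(1)] proj_left_module[OF P(2)]
  have f: "lhom R P1 P0 f" and \<epsilon>: "lhom R P0 M \<epsilon>" "\<epsilon> ` carrier P0 = carrier M"
    and k\<epsilon>: "f ` carrier P1 = a_kernel P0 M \<epsilon>"
    using pres lP M by (simp_all add: proj_presentation_def lhom_iff)
  let ?f = "dual_map P1 f"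
  let ?I = "?f ` carrier (dual R P0)"
  have lf: "lhom ?S (dual R P0) (dual R P1) ?f" by (rule lhom_dual_map[OF f])
  note dP = proj_dual[OF P(1)] proj_dual[OF P(2)]
  note ldP = proj_left_module[OF dP(1)] proj_left_module[OF dP(2)]
  \<comment> \<open>Dualising reverses the order: the resolution of D(M) has the dual of
    \<open>P1\<close> in degree 0 and the dual of \<open>P0\<close> in degree 1.\<close>
  obtain Q0 :: "('a, 'a univ) module" and \<phi>0
    where \<phi>0: "lhom ?S Q0 (dual R P1) \<phi>0" "bij_betw \<phi>0 (carrier Q0) (carrier (dual R P1))"
    using univ_copy_inv[OF proj_fg[OF dP(1)]] .
  obtain Q1 :: "('a, 'a univ) module" and \<phi>1
    where \<phi>1: "lhom ?S Q1 (dual R P0) \<phi>1" "bij_betw \<phi>1 (carrier Q1) (carrier (dual R P0))"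
    using univ_copy_inv[OF proj_fg[OF dP(2)]] .
  obtain \<psi>0 where \<psi>0: "lhom ?S (dual R P1) Q0 \<psi>0" "\<And>x. x \<in> carrier Q0 \<Longrightarrow> \<psi>0 (\<phi>0 x) = x"
    "\<And>y. y \<in> carrier (dual R P1) \<Longrightarrow> \<psi>0 y \<in> carrier Q0 \<and> \<phi>0 (\<psi>0 y) = y"
    using lhom_inv[OF \<phi>0] by blast
  obtain \<psi>1 where \<psi>1: "lhom ?S (dual R P0) Q1 \<psi>1" "\<And>x. x \<in> carrier Q1 \<Longrightarrow> \<psi>1 (\<phi>1 x) = x"
    "\<And>y. y \<in> carrier (dual R P0) \<Longrightarrow> \<psi>1 y \<in> carrier Q1 \<and> \<phi>1 (\<psi>1 y) = y"
    using lhom_inv[OF \<phi>1] by blast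
  have pQ0: "proj ?S Q0"
    using proj_iso[OF dP(1) \<psi>0(1)] bij_betw_byWitness[of "carrier (dual R P1)" \<phi>0 \<psi>0 "carrier Q0"] \<psi>0(2,3)
      lhom.closed[OF \<phi>0(1)] by blast
  have pQ1: "proj ?S Q1"
    using proj_iso[OF dP(2) \<psi>1(1)] bij_betw_byWitness[of "carrier (dual R P0)" \<phi>1 \<psi>1 "carrier Q1"] \<psi>1(2,3)
      lhom.closed[OF \<phi>1(1)] by blast
  define g where "g y = \<psi>0 (?f (\<phi>1 y))" for y
  have g: "lhom ?S Q1 Q0 g" unfolding g_def by (rule lhom_comp[OF lhom_comp[OF \<phi>1(1) lf] \<psi>0(1)])
  have \<phi>g: "\<phi>0 (g y) = ?f (\<phi>1 y)" if "y \<in> carrier Q1" for y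
    unfolding g_def using \<psi>0(3) lhom.closed[OF lf lhom.closed[OF \<phi>1(1) that]] by blast
  have sI: "subm ?S (dual R P1) ?I" by (rule subm_range[OF lf])
  define q where "q y = ?I +>\<^bsub>dual R P1\<^esub> \<phi>0 y" for y
  note qq = lhom_quot[OF ldP(1) sI, folded transpose_module_def]
  have q: "lhom ?S Q0 ?D q" unfolding q_def by (rule lhom_comp[OF \<phi>0(1) qq(1)])
  have sq: "q ` carrier Q0 = carrier ?D"
  proof -
    have "q ` carrier Q0 = (\<lambda>x. ?I +>\<^bsub>dual R P1\<^esub> x) ` \<phi>0 ` carrier Q0" by (simp add: q_def image_image)
    then show ?thesis by (simp only: bij_betw_imp_surj_on[OF \<phi>0(2)] qq(2))
  qed
  have kq: "g ` carrier Q1 = a_kernel Q0 ?D q"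
  proof (intro equalityI subsetI)
    fix y assume "y \<in> g ` carrier Q1"
    then obtain x where x: "x \<in> carrier Q1" "y = g x" by blast
    have "\<phi>0 y \<in> ?I" using \<phi>g[OF x(1)] lhom.closed[OF \<phi>1(1) x(1)] x(2) by simp
    then have "\<phi>0 y \<in> a_kernel (dual R P1) ?D (\<lambda>x. ?I +>\<^bsub>dual R P1\<^esub> x)" by (simp only: qq(3))
    then show "y \<in> a_kernel Q0 ?D q" using lhom.closed[OF g x(1)] x(2) by (simp add: a_kernel_def' q_def)
  next
    fix y assume "y \<in> a_kernel Q0 ?D q"
    then have y: "y \<in> carrier Q0" "\<phi>0 y \<in> a_kernel (dual R P1) ?D (\<lambda>x. ?I +>\<^bsub>dual R P1\<^esub> x)"
      using lhom.closed[OF \<phi>0(1)] by (simp_all add: a_kernel_def' q_def)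
    then have "\<phi>0 y \<in> ?I" by (simp only: qq(3))
    then obtain x where x: "x \<in> carrier (dual R P0)" "\<phi>0 y = ?f x" by blast
    have "g (\<psi>1 x) = y" using \<psi>1(3)[OF x(1)] x(2)[symmetric] \<psi>0(2)[OF y(1)] by (simp add: g_def)
    then show "y \<in> g ` carrier Q1" using \<psi>1(3)[OF x(1)] by blast
  qed
  obtain Q :: "nat \<Rightarrow> ('a, 'a univ) module" and \<delta>
    where Q: "proj_resolution ?S ?D Q \<delta> q" "Q 0 = Q0" "Q 1 = Q1" "\<delta> 0 = g"
    using proj_resolution_extend[OF S pQ0 pQ1 g q sq kq] .
  have fgD: "fg_module ?S ?D" by (rule fg_module_surj[OF proj_fg[OF pQ0] q sq])
  note QD = proj_resolutionD[OF fg_module_left_module[OF fgD] Q(1)]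
  define C where "C i = dual ?S (Q i)" for i
  define c where "c i = dual_map (Q (Suc i)) (\<delta> i)" for i
  have C01: "C 0 = dual ?S Q0" "C (Suc 0) = dual ?S Q1" using Q by (simp_all add: C_def)
  have c0: "c 0 = dual_map Q1 g" using Q by (simp add: c_def)
  have pC: "proj R (C i)" for i using proj_dual[OF QD(1)] by (simp add: C_def)
  have lc: "lhom R (C i) (C (Suc i)) (c i)" for i using lhom_dual_map[OF QD(2)] by (simp add: C_def c_def)
  have dd: "\<delta> i (\<delta> (Suc i) x) = \<zero>\<^bsub>Q i\<^esub>" if "x \<in> carrier (Q (Suc (Suc i)))" for i x
    using imageI[OF that, of "\<delta> (Suc i)"] unfolding QD(3) by (simp add: a_kernel_def')
  have cc: "c (Suc i) (c i x) = \<zero>\<^bsub>C (Suc (Suc i))\<^esub>" if x: "x \<in> carrier (C i)" for i x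
  proof (rule dual_ext[of _ ?S "Q (Suc (Suc i))"], fold C_def)
    show "c (Suc i) (c i x) \<in> carrier (C (Suc (Suc i)))" by (rule lhom.closed[OF lc lhom.closed[OF lc x]])
    interpret L: left_module R "C (Suc (Suc i))" by (rule proj_left_module[OF pC])
    show "\<zero>\<^bsub>C (Suc (Suc i))\<^esub> \<in> carrier (C (Suc (Suc i)))" by simp
    fix y assume y: "y \<in> carrier (Q (Suc (Suc i)))"
    show "c (Suc i) (c i x) y = \<zero>\<^bsub>C (Suc (Suc i))\<^esub> y"
      using y lhom.closed[OF QD(2) y] dd[OF y] lhom.zero[OF dual_lhom[OF QD(7) x[unfolded C_def]]]
      by (simp add: c_def C_def)
  qed
  have fac: "\<exists>\<psi>. lhom R (C (Suc (Suc i))) (regular_module R) \<psi> \<and> (\<forall>x\<in>carrier (C (Suc i)). \<psi> (c (Suc i) x) = \<chi> x)"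
    if \<chi>: "lhom R (C (Suc i)) (regular_module R) \<chi>" "\<And>x. x \<in> carrier (C i) \<Longrightarrow> \<chi> (c i x) = \<zero>\<^bsub>R\<^esub>" for i \<chi>
  proof -
    note evb = ev_bij[OF QD(1), unfolded opp_ring_simps]
    note evl = lhom_ev[OF QD(7), unfolded opp_ring_simps]
    have "restrict \<chi> (carrier (C (Suc i))) \<in> carrier (dual R (dual ?S (Q (Suc i))))"
      using restrict_dual[OF \<chi>(1)] by (simp add: C_def)
    then have "restrict \<chi> (carrier (C (Suc i))) \<in> ev ?S (Q (Suc i)) ` carrier (Q (Suc i))"
      by (simp only: bij_betw_imp_surj_on[OF evb])
    then obtain y where y: "y \<in> carrier (Q (Suc i))" "restrict \<chi> (carrier (C (Suc i))) = ev ?S (Q (Suc i)) y"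
      by blast
    have \<chi>y: "\<chi> x = x y" if x: "x \<in> carrier (C (Suc i))" for x
      using fun_cong[OF y(2), of x] x by (simp add: C_def)
    have dy: "\<delta> i y \<in> carrier (Q i)" by (rule lhom.closed[OF QD(2) y(1)])
    have "x (\<delta> i y) = \<zero>\<^bsub>R\<^esub>" if x: "x \<in> carrier (C i)" for x
      using \<chi>(2)[OF x] \<chi>y[OF lhom.closed[OF lc x]] y(1) by (simp add: c_def)
    then have "ev ?S (Q i) (\<delta> i y) = \<zero>\<^bsub>dual R (dual ?S (Q i))\<^esub>"
      by (simp add: ev_def dual_simps C_def cong: restrict_cong)
    then have "\<delta> i y = \<zero>\<^bsub>Q i\<^esub>"
      using inj_on_lhom_iff[OF evl[of i]] evb[of i] dy by (simp add: bij_betw_def)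
    then have "y \<in> a_kernel (Q (Suc i)) (Q i) (\<delta> i)" using y(1) by (simp add: a_kernel_def')
    then obtain z where z: "z \<in> carrier (Q (Suc (Suc i)))" "y = \<delta> (Suc i) z" unfolding QD(3)[symmetric] by blast
    have evz: "ev ?S (Q (Suc (Suc i))) z \<in> carrier (dual R (C (Suc (Suc i))))"
      unfolding C_def by (rule lhom.closed[OF evl z(1)])
    have "ev ?S (Q (Suc (Suc i))) z (c (Suc i) x) = \<chi> x" if x: "x \<in> carrier (C (Suc i))" for x
      using ev_apply[OF lhom.closed[OF lc x, unfolded C_def]] \<chi>y[OF x] z by (simp add: c_def)
    then show ?thesis using dual_lhom[OF proj_left_module[OF pC] evz] by blast
  qed
  \<comment> \<open>These identify \<open>P1\<close> with \<open>C 0\<close> and \<open>P0\<close>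
    with \<open>C 1\<close>: evaluation, followed by the dual of the isomorphism from the copy over
    \<open>'a univ\<close>.\<close>
  define \<theta>0 where "\<theta>0 p = dual_map Q0 \<phi>0 (ev R P1 p)" for p
  define \<theta>1 where "\<theta>1 p = dual_map Q1 \<phi>1 (ev R P0 p)" for p
  have l\<theta>1: "lhom R P0 (C (Suc 0)) \<theta>1"
    unfolding \<theta>1_def C01 using lhom_comp[OF lhom_ev[OF lP(2)]] lhom_dual_map[OF \<phi>1(1)] by simp
  have b\<theta>0: "bij_betw \<theta>0 (carrier P1) (carrier (C 0))"
    unfolding C01 using bij_betw_trans[OF ev_bij[OF P(1)] dual_map_bij[OF \<phi>0]] by (simp add: \<theta>0_def[abs_def] comp_def)
  have b\<theta>1: "bij_betw \<theta>1 (carrier P0) (carrier (C (Suc 0)))"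
    unfolding C01 using bij_betw_trans[OF ev_bij[OF P(2)] dual_map_bij[OF \<phi>1]] by (simp add: \<theta>1_def[abs_def] comp_def)
  \<comment> \<open>So \<open>c 0\<close> is \<open>f\<close> up to isomorphism, and
    \<open>M\<close> is its cokernel.\<close>
  have c\<theta>: "c 0 (\<theta>0 p) = \<theta>1 (f p)" if p: "p \<in> carrier P1" for p
  proof (rule dual_ext[of _ ?S Q1], fold C01)
    show "c 0 (\<theta>0 p) \<in> carrier (C (Suc 0))"
      using lhom.closed[OF lc] b\<theta>0 p by (metis bij_betwE)
    show "\<theta>1 (f p) \<in> carrier (C (Suc 0))"
      by (rule lhom.closed[OF l\<theta>1 lhom.closed[OF f p]])
    fix y assume y: "y \<in> carrier Q1"
    note p1 = lhom.closed[OF \<phi>1(1) y]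
    have "c 0 (\<theta>0 p) y = ev R P1 p (?f (\<phi>1 y))"
      using y lhom.closed[OF g y] by (simp add: c0 \<theta>0_def \<phi>g)
    also have "\<dots> = \<phi>1 y (f p)" using lhom.closed[OF lf p1] p by simp
    also have "\<dots> = \<theta>1 (f p) y" using y p1 by (simp add: \<theta>1_def)
    finally show "c 0 (\<theta>0 p) y = \<theta>1 (f p) y" .
  qed
  obtain \<kappa> where \<kappa>: "lhom R (C (Suc 0)) P0 \<kappa>" "\<And>x. x \<in> carrier P0 \<Longrightarrow> \<kappa> (\<theta>1 x) = x"
    "\<And>y. y \<in> carrier (C (Suc 0)) \<Longrightarrow> \<kappa> y \<in> carrier P0 \<and> \<theta>1 (\<kappa> y) = y"
    using lhom_inv[OF l\<theta>1 b\<theta>1] by blast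
  have "cocomplex R M C c (\<lambda>x. \<epsilon> (\<kappa> x))"
  proof (rule cocomplex.intro[OF R pC lc cc fac lhom_comp[OF \<kappa>(1) \<epsilon>(1)]])
    have "m \<in> (\<lambda>x. \<epsilon> (\<kappa> x)) ` carrier (C (Suc 0))" if m: "m \<in> carrier M" for m
    proof -
      obtain x where x: "x \<in> carrier P0" "m = \<epsilon> x" using m \<epsilon>(2) by (metis imageE)
      then show ?thesis
        using \<kappa>(2)[OF x(1)] lhom.closed[OF l\<theta>1 x(1)] by (intro image_eqI[of _ _ "\<theta>1 x"]) simp_all
    qed
    then show "(\<lambda>x. \<epsilon> (\<kappa> x)) ` carrier (C (Suc 0)) = carrier M"
      using lhom.closed[OF lhom_comp[OF \<kappa>(1) \<epsilon>(1)]] by blast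
    show "a_kernel (C (Suc 0)) M (\<lambda>x. \<epsilon> (\<kappa> x)) = c 0 ` carrier (C 0)"
    proof (intro equalityI subsetI)
      fix y assume "y \<in> a_kernel (C (Suc 0)) M (\<lambda>x. \<epsilon> (\<kappa> x))"
      then have y: "y \<in> carrier (C (Suc 0))" "\<epsilon> (\<kappa> y) = \<zero>\<^bsub>M\<^esub>" by (simp_all add: a_kernel_def')
      then have "\<kappa> y \<in> a_kernel P0 M \<epsilon>" using \<kappa>(3) by (simp add: a_kernel_def')
      then obtain p where p: "p \<in> carrier P1" "\<kappa> y = f p" unfolding k\<epsilon>[symmetric] by blast
      have "y = c 0 (\<theta>0 p)" using c\<theta>[OF p(1)] \<kappa>(3)[OF y(1)] p(2) by simp
      then show "y \<in> c 0 ` carrier (C 0)" using b\<theta>0 p(1) by (metis bij_betwE imageI)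
    next
      fix y assume "y \<in> c 0 ` carrier (C 0)"
      then obtain x where x: "x \<in> carrier (C 0)" "y = c 0 x" by blast
      obtain p where p: "p \<in> carrier P1" "x = \<theta>0 p" using x(1) b\<theta>0 by (metis bij_betw_imp_surj_on imageE)
      have fp: "f p \<in> carrier P0" by (rule lhom.closed[OF f p(1)])
      have "f p \<in> a_kernel P0 M \<epsilon>" unfolding k\<epsilon>[symmetric] using p(1) by (rule imageI)
      then have "\<epsilon> (\<kappa> y) = \<zero>\<^bsub>M\<^esub>" using x(2) p(2) c\<theta>[OF p(1)] \<kappa>(2)[OF fp] by (simp add: a_kernel_def')
      then show "y \<in> a_kernel (C (Suc 0)) M (\<lambda>x. \<epsilon> (\<kappa> x))"
        using lhom.closed[OF lc x(1)] x(2) by (simp add: a_kernel_def')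
    qed
  qed
  then show ?thesis by (rule that[OF Q(1) fgD, folded C_def c_def])
qed

theorem proposition4p4:
  fixes \<Lambda> :: "'a ring" and k d :: nat
    and M :: "('a, 'b) module" and P0 :: "('a, 'p) module" and P1 :: "('a, 'q) module"
    and f :: "'q \<Rightarrow> 'p" and \<epsilon> :: "'p \<Rightarrow> 'b"
  assumes "0 < k"
    and "ring \<Lambda>" and "left_noetherian \<Lambda>" and "right_noetherian \<Lambda>"
    and "quasi_gorenstein k \<Lambda>"
    and "d \<le> k - 1"
    and "in_Omega \<Lambda> d M"
    and "proj_presentation \<Lambda> P1 f P0 \<epsilon> M"
  shows "\<exists>(S :: ('a, 'a univ) module) (B :: ('a, 'a univ) module) \<alpha> \<beta>.
           fg_module \<Lambda> S \<and> fg_module \<Lambda> B \<and> short_exact \<Lambda> S \<alpha> B \<beta> M \<and>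
           is_syzygy \<Lambda> d
             (Ext_ring (opp_ring \<Lambda>) (d + 1) (transpose_module \<Lambda> P1 f P0)) B \<and>
           in_Omega \<Lambda> (d + 2) S"
proof -
  let ?S = "opp_ring \<Lambda>" and ?D = "transpose_module \<Lambda> P1 f P0"
  note R = \<open>ring \<Lambda>\<close> \<open>left_noetherian \<Lambda>\<close>
  have fgM: "fg_module \<Lambda> M" using \<open>in_Omega \<Lambda> d M\<close> by (simp add: in_Omega_def)
  note lM = fg_module_left_module[OF fgM]
  obtain Q :: "nat \<Rightarrow> ('a, 'a univ) module" and \<delta> q \<epsilon>'
    where Q: "proj_resolution ?S ?D Q \<delta> q" and fgD: "fg_module ?S ?D"
      and K: "cocomplex \<Lambda> M (\<lambda>i. dual ?S (Q i)) (\<lambda>i. dual_map (Q (Suc i)) (\<delta> i)) \<epsilon>'"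
    using presentation_cocomplex[OF R \<open>right_noetherian \<Lambda>\<close> lM \<open>proj_presentation \<Lambda> P1 f P0 \<epsilon> M\<close>] .
  define C where "C i = dual ?S (Q i)" for i
  define c where "c i = dual_map (Q (Suc i)) (\<delta> i)" for i
  have ZB: "a_kernel (C i) (C (Suc i)) (c i) = cocycles ?S Q \<delta> i" "c i ` carrier (C i) = coboundaries ?S Q \<delta> i" for i
    unfolding C_def c_def by (rule a_kernel_dual_map, simp add: coboundaries_def)
  have K: "cocomplex \<Lambda> M C c \<epsilon>'" using K unfolding C_def[symmetric] c_def[symmetric] .
  \<comment> \<open>The sequence \<open>E\<close> has the syzygy itself as a term, which calls for a
    copy of \<open>M\<close>; the complex \<open>C\<close> is kept.\<close>
  obtain M' :: "('a, 'a univ) module" and \<mu> where \<mu>: "lhom \<Lambda> M' M \<mu>" "bij_betw \<mu> (carrier M') (carrier M)"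
    and fgM': "fg_module \<Lambda> M'"
    using univ_copy_inv[OF fgM] .
  obtain E :: "nat \<Rightarrow> ('a, 'a univ) module" and e where E: "coexact \<Lambda> d E e" "E 0 = M'"
    using in_Omega_coexact[OF in_Omega_iso[OF \<open>in_Omega \<Lambda> d M\<close> \<mu> fgM']] .
  obtain \<epsilon>'' where K': "cocomplex \<Lambda> M' C c \<epsilon>''"
    using cocomplex_iso[OF K \<mu>] by blast
  \<comment> \<open>The Gorenstein condition speaks of modules over \<open>'a univ\<close>, so it is
    applied to a copy of D(M). The resolution \<open>Q\<close> serves both.\<close>
  obtain N :: "('a, 'a univ) module" and \<nu> where \<nu>: "lhom ?S ?D N \<nu>" "bij_betw \<nu> (carrier ?D) (carrier N)"
    using univ_copy[OF fgD] .
  have fgN: "fg_module ?S N" using fg_module_surj[OF fgD \<nu>(1)] \<nu>(2) by (simp add: bij_betw_def)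
  note lD = fg_module_left_module[OF fgD] and lN = fg_module_left_module[OF fgN]
  have QN: "proj_resolution ?S N Q \<delta> (\<lambda>x. \<nu> (q x))" by (rule proj_resolution_iso[OF lD Q \<nu>])
  \<comment> \<open>The index \<open>n\<close> stands for degree \<open>n + 1\<close>, which is at
    most \<open>d\<close> and hence below \<open>k\<close>, so the grade condition is available
    there.\<close>
  have H: "cohom_exact C c n" if "n < d" for n
    using that
  proof (induction n rule: less_induct)
    case (less n)
    obtain \<pi> where \<pi>: "lhom \<Lambda> (sub (C (Suc n)) (a_kernel (C (Suc n)) (C (Suc (Suc n))) (c (Suc n)))) (Ext_ring ?S (Suc n) N) \<pi>"
      "\<pi> ` a_kernel (C (Suc n)) (C (Suc (Suc n))) (c (Suc n)) = carrier (Ext_ring ?S (Suc n) N)"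
      "\<forall>x\<in>a_kernel (C (Suc n)) (C (Suc (Suc n))) (c (Suc n)).
         \<pi> x = \<zero>\<^bsub>Ext_ring ?S (Suc n) N\<^esub> \<longleftrightarrow> x \<in> c n ` carrier (C n)"
      using Ext_ring_Suc[OF lN QN, of n, unfolded opp_ring_simps, folded C_def, folded ZB] .
    have "grade_ge \<Lambda> (Ext_ring ?S (Suc n) N) (Suc n)"
      using \<open>quasi_gorenstein k \<Lambda>\<close> fgN less.prems \<open>d \<le> k - 1\<close> unfolding quasi_gorenstein_def by simp
    then have gr: "grade_ge \<Lambda> (Ext_ring ?S (Suc n) N) n" by (simp add: grade_ge_def)
    \<comment> \<open>The sequence for \<open>d\<close> is cut off at \<open>n + 1\<close>:
      \<open>E\<close> is numbered from \<open>M'\<close>, so its initial part is exact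
      again.\<close>
    have E': "coexact \<Lambda> (Suc n) E e" using E(1) less.prems by (simp add: coexact_def)
    show ?case
      by (rule cocomplex.cohom_exact_step[OF K' E' E(2) _ \<pi>(1,2) \<pi>(3)[rule_format] gr]) (use less in simp)
  qed
  \<comment> \<open>This time D(M) itself is used and not its copy, because the conclusion names its
    Ext module.\<close>
  obtain \<pi> where \<pi>: "lhom \<Lambda> (sub (C (Suc d)) (a_kernel (C (Suc d)) (C (Suc (Suc d))) (c (Suc d)))) (Ext_ring ?S (Suc d) ?D) \<pi>"
    "\<pi> ` a_kernel (C (Suc d)) (C (Suc (Suc d))) (c (Suc d)) = carrier (Ext_ring ?S (Suc d) ?D)"
    "\<forall>x\<in>a_kernel (C (Suc d)) (C (Suc (Suc d))) (c (Suc d)).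
       \<pi> x = \<zero>\<^bsub>Ext_ring ?S (Suc d) ?D\<^esub> \<longleftrightarrow> x \<in> c d ` carrier (C d)"
    using Ext_ring_Suc[OF lD Q, of d, unfolded opp_ring_simps, folded C_def, folded ZB] .
  obtain S B :: "('a, 'a univ) module" and \<alpha> \<beta> where "fg_module \<Lambda> S" "fg_module \<Lambda> B" "short_exact \<Lambda> S \<alpha> B \<beta> M"
    "is_syzygy \<Lambda> d (Ext_ring ?S (Suc d) ?D) B" "in_Omega \<Lambda> (d + 2) S"
  proof (cases d)
    case 0
    obtain S B :: "('a, 'a univ) module" and \<alpha> \<beta> where "fg_module \<Lambda> S" "fg_module \<Lambda> B" "short_exact \<Lambda> S \<alpha> B \<beta> M"
      "is_syzygy \<Lambda> 0 (Ext_ring ?S (Suc 0) ?D) B" "in_Omega \<Lambda> 2 S"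
      using cocomplex.Evans_Griffith_0[OF K \<pi>(1,2)[unfolded 0] \<pi>(3)[unfolded 0, rule_format]] .
    then show ?thesis by (intro that) (simp_all add: 0 numeral_2_eq_2)
  next
    case (Suc n)
    have "cohom_exact C c j" if "j \<le> n" for j using H Suc that by simp
    from cocomplex.Evans_Griffith_Suc[OF K this \<pi>(1,2)[unfolded Suc] \<pi>(3)[unfolded Suc, rule_format]]
    obtain S B :: "('a, 'a univ) module" and \<alpha> \<beta> where "fg_module \<Lambda> S" "fg_module \<Lambda> B" "short_exact \<Lambda> S \<alpha> B \<beta> M"
      "is_syzygy \<Lambda> (Suc n) (Ext_ring ?S (Suc (Suc n)) ?D) B" "in_Omega \<Lambda> (n + 3) S" .
    moreover have "d + 2 = n + 3" using Suc by simp
    ultimately show ?thesis by (intro that) (simp_all only: Suc)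
  qed
  then show ?thesis by (intro exI[of _ S] exI[of _ B] exI[of _ \<alpha>] exI[of _ \<beta>]) simp
qed

end
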